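(* Let $A,B\in\mathbb{B}(\mathscr{H})$ be positive operators and let $m,m',M,M'$ be positive real numbers satisfying either one of the following conditions: (1) $0<m\le B\le m'<M'\le A\le M$; (2) $0<m\le A\le m'<M'\le B\le M$. Then for every positive unital linear map $\Phi$, every $0\le\nu\le 1$ and every $p\ge 4$, $$\Phi^{p}\big(A\nabla_\nu B+2rMm(A^{-1}\nabla B^{-1}-A^{-1}\sharp B^{-1})\big)\le\left(\frac{K(h)(M^2+m^2)}{4^{\frac{2}{p}}Mm\,K^{r}(h')}\right)^{p}\Phi^{p}(A\sharp_\nu B)$$ and $$\Phi^{p}\big(A\nabla_\nu B+2rMm(A^{-1}\nabla B^{-1}-A^{-1}\sharp B^{-1})\big)\le\left(\frac{K(h)(M^2+m^2)}{4^{\frac{2}{p}}Mm\,K^{r}(h')}\right)^{p}\big(\Phi(A)\sharp_\nu\Phi(B)\big)^{p},$$ where $r=\min\{\nu,1-\nu\}$, $K(h)=\frac{(1+h)^2}{4h}$, $h=\frac{M}{m}$, $h'=\frac{M'}{m'}$ and $r_1=\min\{2r,1-2r\}$.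
   Context: $\mathscr{H}$ is a complex Hilbert space; $\mathbb{B}(\mathscr{H})$ is the $C^*$-algebra of bounded linear operators on $\mathscr{H}$ with identity $I$. For self-adjoint $X,Y$, $X\le Y$ means $Y-X$ is positive, i.e. $\langle (Y-X)x,x\rangle\ge 0$ for all $x$. A scalar $c$ in an operator inequality stands for $cI$. $\Phi$ is a linear map from $\mathbb{B}(\mathscr{H})$ to $\mathbb{B}(\mathscr{K})$, with $\mathscr{K}$ a complex Hilbert space; it is positive if $\Phi(X)\ge0$ whenever $X\ge0$, and unital if $\Phi(I)=I$. $\Phi^{p}(X)$ denotes $(\Phi(X))^{p}$ (functional calculus). For positive invertible $X,Y$ and $0\le\nu\le1$: $X\nabla_\nu Y=(1-\nu)X+\nu Y$ and $X\sharp_\nu Y=X^{1/2}(X^{-1/2}YX^{-1/2})^{\nu}X^{1/2}$; $\nabla$ and $\sharp$ denote $\nabla_{1/2}$ and $\sharp_{1/2}$. The Kantorovich constant is $K(t)=\frac{(1+t)^2}{4t}$ for $t>0$, and $K^{r}(h')$ means $(K(h'))^{r}$. *)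

theory Defs
  imports "HOL-Analysis.Analysis"
begin

section \<open>Complex Hilbert spaces\<close>

class complex_vector = real_vector +
  fixes scaleC :: "complex \<Rightarrow> 'a \<Rightarrow> 'a"  (infixr \<open>*\<^sub>C\<close> 75)
  assumes scaleC_add_right: "c *\<^sub>C (x + y) = c *\<^sub>C x + c *\<^sub>C y"
    and scaleC_add_left: "(c + d) *\<^sub>C x = c *\<^sub>C x + d *\<^sub>C x"
    and scaleC_scaleC: "c *\<^sub>C d *\<^sub>C x = (c * d) *\<^sub>C x"
    and scaleC_of_real: "complex_of_real a *\<^sub>C x = a *\<^sub>R x"

lemma scaleC_zero_right: "c *\<^sub>C (0 :: 'a::complex_vector) = 0"
  using scaleC_add_right [of c 0 "0 :: 'a"] by simp

lemma scaleC_minus_right: "c *\<^sub>C (- x :: 'a::complex_vector) = - (c *\<^sub>C x)"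
  using scaleC_add_right [of c "- x" x] by (simp add: scaleC_zero_right eq_neg_iff_add_eq_0)

lemma scaleC_diff_right: "c *\<^sub>C (x - y :: 'a::complex_vector) = c *\<^sub>C x - c *\<^sub>C y"
  using scaleC_add_right [of c x "- y"] by (simp add: scaleC_minus_right)

text \<open>The inner product is linear in its first argument. Positive definiteness is
  contained in \<open>cinner_self\<close>, since the norm is definite.\<close>

class complex_inner = complex_vector + real_normed_vector +
  fixes cinner :: "'a \<Rightarrow> 'a \<Rightarrow> complex"
  assumes cinner_commute: "cinner x y = cnj (cinner y x)"
    and cinner_add_left: "cinner (x + y) z = cinner x z + cinner y z"
    and cinner_scaleC_left: "cinner (c *\<^sub>C x) y = c * cinner x y"
    and cinner_self: "cinner x x = complex_of_real ((norm x)\<^sup>2)"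

class complex_hilbert_space = complex_inner + complete_space

lemma cinner_diff_left:
  "cinner (x - y) (z :: 'a::complex_inner) = cinner x z - cinner y z"
  using cinner_add_left [of "x - y" y z] by simp

lemma cinner_add_right:
  "cinner (x :: 'a::complex_inner) (y + z) = cinner x y + cinner x z"
  by (metis cinner_add_left cinner_commute complex_cnj_add)

lemma cinner_scaleC_right:
  "cinner (x :: 'a::complex_inner) (c *\<^sub>C y) = cnj c * cinner x y"
  by (metis cinner_scaleC_left cinner_commute complex_cnj_mult)

lemma cinner_eq_zero_imp: "cinner x x = 0 \<Longrightarrow> (x :: 'a::complex_inner) = 0"
  by (simp add: cinner_self)

lemma norm_scaleC: "norm (c *\<^sub>C (x :: 'a::complex_inner)) = cmod c * norm x"
proof -
  have "complex_of_real ((norm (c *\<^sub>C x))\<^sup>2) = c * cnj c * cinner x x"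
    by (simp only: cinner_self [symmetric] cinner_scaleC_left cinner_scaleC_right ac_simps)
  also have "\<dots> = complex_of_real ((cmod c * norm x)\<^sup>2)"
    by (simp only: complex_norm_square [symmetric] cinner_self of_real_mult of_real_power
        power_mult_distrib)
  finally have "(norm (c *\<^sub>C x))\<^sup>2 = (cmod c * norm x)\<^sup>2"
    using of_real_eq_iff by blast
  then show ?thesis
    by (simp add: power2_eq_iff_nonneg)
qed


section \<open>The algebra of bounded operators\<close>

typedef (overloaded) 'a bop =
  "{T :: 'a::complex_inner \<Rightarrow> 'a. bounded_linear T \<and> (\<forall>c x. T (c *\<^sub>C x) = c *\<^sub>C T x)}"
  morphisms op_apply Bop
  by (rule exI [of _ "\<lambda>x. x"]) (simp add: bounded_linear_ident)

setup_lifting type_definition_bop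

lemma bop_eqI: "(\<And>x. op_apply S x = op_apply T x) \<Longrightarrow> S = T"
  by (metis ext op_apply_inject)

lemma bounded_linear_op_apply: "bounded_linear (op_apply T)"
  using op_apply [of T] by simp

lemma op_apply_scaleC: "op_apply T (c *\<^sub>C x) = c *\<^sub>C op_apply T x"
  using op_apply [of T] by simp

lemma op_apply_add: "op_apply T (x + y) = op_apply T x + op_apply T y"
  by (rule linear_add [OF bounded_linear.linear [OF bounded_linear_op_apply]])

lemma bounded_linear_scaleC: "bounded_linear (\<lambda>x :: 'a::complex_inner. c *\<^sub>C x)"
proof (rule bounded_linear_intro [where K = "cmod c"])
  show "c *\<^sub>C (r *\<^sub>R x) = r *\<^sub>R (c *\<^sub>C x)" for r and x :: 'a
    by (simp add: scaleC_of_real [symmetric] scaleC_scaleC mult.commute)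
qed (simp_all add: scaleC_add_right norm_scaleC mult.commute)

text \<open>The norm is the operator norm; multiplication is composition.\<close>

instantiation bop :: (complex_inner) real_normed_vector
begin

lift_definition zero_bop :: "'a bop" is "\<lambda>x. 0"
  by (simp add: bounded_linear_zero scaleC_zero_right)

lift_definition plus_bop :: "'a bop \<Rightarrow> 'a bop \<Rightarrow> 'a bop" is "\<lambda>S T x. S x + T x"
  by (simp add: bounded_linear_add scaleC_add_right)

lift_definition uminus_bop :: "'a bop \<Rightarrow> 'a bop" is "\<lambda>T x. - T x"
  by (simp add: bounded_linear_minus scaleC_minus_right)

lift_definition minus_bop :: "'a bop \<Rightarrow> 'a bop \<Rightarrow> 'a bop" is "\<lambda>S T x. S x - T x"
  by (simp add: bounded_linear_sub scaleC_diff_right)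

lift_definition scaleR_bop :: "real \<Rightarrow> 'a bop \<Rightarrow> 'a bop" is "\<lambda>r T x. r *\<^sub>R T x"
  by (simp add: bounded_linear_const_scaleR)
    (simp add: scaleC_of_real [symmetric] scaleC_scaleC mult.commute)

lift_definition norm_bop :: "'a bop \<Rightarrow> real" is onorm .

definition dist_bop :: "'a bop \<Rightarrow> 'a bop \<Rightarrow> real"
  where "dist_bop S T = norm (S - T)"

definition sgn_bop :: "'a bop \<Rightarrow> 'a bop"
  where "sgn_bop T = scaleR (inverse (norm T)) T"

definition uniformity_bop :: "('a bop \<times> 'a bop) filter"
  where "uniformity_bop = (INF e\<in>{0<..}. principal {(S, T). dist S T < e})"

definition open_bop :: "'a bop set \<Rightarrow> bool"
  where "open_bop U = (\<forall>S\<in>U. \<forall>\<^sub>F (S', T) in uniformity. S' = S \<longrightarrow> T \<in> U)"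

instance
proof
  fix S T U :: "'a bop" and a b :: real and V :: "'a bop set"
  show "S + T + U = S + (T + U)" by transfer (simp add: add.assoc)
  show "S + T = T + S" by transfer (simp add: add.commute)
  show "0 + S = S" by transfer simp
  show "- S + S = 0" by transfer simp
  show "S - T = S + - T" by transfer simp
  show "a *\<^sub>R (S + T) = a *\<^sub>R S + a *\<^sub>R T" by transfer (simp add: scaleR_add_right)
  show "(a + b) *\<^sub>R S = a *\<^sub>R S + b *\<^sub>R S" by transfer (simp add: scaleR_add_left)
  show "a *\<^sub>R b *\<^sub>R S = (a * b) *\<^sub>R S" by transfer simp
  show "1 *\<^sub>R S = S" by transfer simp
  show "dist S T = norm (S - T)" by (rule dist_bop_def)
  show "sgn S = scaleR (inverse (norm S)) S" by (rule sgn_bop_def)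
  show "uniformity = (INF e\<in>{0<..}. principal {(S :: 'a bop, T). dist S T < e})"
    by (rule uniformity_bop_def)
  show "open V = (\<forall>S\<in>V. \<forall>\<^sub>F (S', T) in uniformity. S' = S \<longrightarrow> T \<in> V)"
    by (rule open_bop_def)
  show "norm S = 0 \<longleftrightarrow> S = 0" by transfer (auto simp: onorm_eq_0)
  show "norm (S + T) \<le> norm S + norm T" by transfer (auto intro: onorm_triangle)
  show "norm (a *\<^sub>R S) = \<bar>a\<bar> * norm S" by transfer (auto simp: onorm_scaleR)
qed

end

instantiation bop :: (complex_inner) complex_vector
begin

lift_definition scaleC_bop :: "complex \<Rightarrow> 'a bop \<Rightarrow> 'a bop" is "\<lambda>c T x. c *\<^sub>C T x"
  by (auto intro: bounded_linear_compose [OF bounded_linear_scaleC]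
      simp: scaleC_scaleC mult.commute)

instance
  by standard (transfer; simp add: scaleC_add_right scaleC_add_left scaleC_scaleC scaleC_of_real)+

end

instantiation bop :: (complex_inner) "{real_normed_algebra, monoid_mult}"
begin

lift_definition one_bop :: "'a bop" is "\<lambda>x. x"
  by (simp add: bounded_linear_ident)

lift_definition times_bop :: "'a bop \<Rightarrow> 'a bop \<Rightarrow> 'a bop" is "\<lambda>S T x. S (T x)"
  by (auto intro: bounded_linear_compose)

instance
proof
  fix S T U :: "'a bop" and a :: real
  show "S * T * U = S * (T * U)" by transfer simp
  show "(S + T) * U = S * U + T * U" by transfer simp
  show "S * (T + U) = S * T + S * U"
    by transfer (auto simp: linear_add [OF bounded_linear.linear])
  show "a *\<^sub>R S * T = a *\<^sub>R (S * T)" by transfer simp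
  show "S * a *\<^sub>R T = a *\<^sub>R (S * T)"
    by transfer (auto simp: linear_scale [OF bounded_linear.linear])
  show "norm (S * T) \<le> norm S * norm T"
    by transfer (use onorm_compose in \<open>auto simp: o_def\<close>)
  show "1 * S = S" by transfer simp
  show "S * 1 = S" by transfer simp
qed

end


section \<open>Positivity and the operator order\<close>

definition positive_op :: "'a::complex_inner bop \<Rightarrow> bool"
  where "positive_op T \<longleftrightarrow> (\<forall>x. cinner (op_apply T x) x \<in> \<real>\<^sub>\<ge>\<^sub>0)"

lemma quadratic_form_zero_imp:
  assumes zero: "\<And>x. cinner (op_apply T x) x = 0"
  shows "T = 0"
proof (rule bop_eqI)
  fix x
  let ?y = "op_apply T x"
  have eq: "cinner ?y z + cinner (op_apply T z) x = 0" for z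
    using zero [of "x + z"] zero [of x] zero [of z]
    by (simp add: op_apply_add cinner_add_left cinner_add_right add.commute)
  have "cinner ?y ?y + cinner (op_apply T ?y) x = 0"
    by (rule eq)
  moreover have "\<i> * (cinner (op_apply T ?y) x - cinner ?y ?y) = 0"
    using eq [of "\<i> *\<^sub>C ?y"]
    by (simp add: op_apply_scaleC cinner_scaleC_left cinner_scaleC_right algebra_simps)
  ultimately have "cinner ?y ?y = 0"
    by simp
  then show "op_apply T x = op_apply 0 x"
    by (simp add: cinner_eq_zero_imp zero_bop.rep_eq)
qed

text \<open>On a complex space a positive operator is automatically self-adjoint, so for
  self-adjoint operators this is the usual order.\<close>

instantiation bop :: (complex_inner) order
begin

definition less_eq_bop :: "'a bop \<Rightarrow> 'a bop \<Rightarrow> bool"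
  where "less_eq_bop S T \<longleftrightarrow> positive_op (T - S)"

definition less_bop :: "'a bop \<Rightarrow> 'a bop \<Rightarrow> bool"
  where "less_bop S T \<longleftrightarrow> S \<le> T \<and> \<not> T \<le> S"

instance
proof
  fix S T U :: "'a bop"
  show "S < T \<longleftrightarrow> S \<le> T \<and> \<not> T \<le> S" by (rule less_bop_def)
  show "S \<le> S"
    by (simp add: less_eq_bop_def positive_op_def zero_bop.rep_eq cinner_self [of 0, simplified]
        cinner_diff_left [of 0 0, simplified])
  show "S \<le> U" if "S \<le> T" "T \<le> U"
  proof -
    have "cinner (op_apply (U - S) x) x
        = cinner (op_apply (T - S) x) x + cinner (op_apply (U - T) x) x" for x
      by (simp add: minus_bop.rep_eq cinner_diff_left)
    with that show ?thesis
      by (simp add: less_eq_bop_def positive_op_def nonneg_Reals_add_I)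
  qed
  show "S = T" if "S \<le> T" "T \<le> S"
  proof -
    have "cinner (op_apply (T - S) x) x = 0" for x
    proof -
      have "cinner (op_apply (S - T) x) x = - cinner (op_apply (T - S) x) x"
        by (simp add: minus_bop.rep_eq cinner_diff_left)
      moreover have "cinner (op_apply (T - S) x) x \<in> \<real>\<^sub>\<ge>\<^sub>0"
          "cinner (op_apply (S - T) x) x \<in> \<real>\<^sub>\<ge>\<^sub>0"
        using that by (simp_all add: less_eq_bop_def positive_op_def)
      ultimately show ?thesis
        by (auto simp: complex_nonneg_Reals_iff complex_eq_iff)
    qed
    then have "T - S = 0" by (rule quadratic_form_zero_imp)
    then show ?thesis by simp
  qed
qed

end


section \<open>Inverse, spectrum and continuous functional calculus\<close>

definition op_invertible :: "'a::complex_inner bop \<Rightarrow> bool"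
  where "op_invertible T \<longleftrightarrow> (\<exists>S. S * T = 1 \<and> T * S = 1)"

definition op_inverse :: "'a::complex_inner bop \<Rightarrow> 'a bop"
  where "op_inverse T = (THE S. S * T = 1 \<and> T * S = 1)"

definition spectrum :: "'a::complex_inner bop \<Rightarrow> complex set"
  where "spectrum T = {c. \<not> op_invertible (T - c *\<^sub>C 1)}"

definition poly_op :: "real poly \<Rightarrow> 'a::complex_inner bop \<Rightarrow> 'a bop"
  where "poly_op q T = (\<Sum>i\<le>degree q. coeff q i *\<^sub>R T ^ i)"

text \<open>For a self-adjoint operator \<open>T\<close>, whose spectrum is a compact subset of the real line, and
  for \<open>f\<close> continuous on the spectrum, \<open>f(T)\<close> is the common norm limit of \<open>q\<^sub>n(T)\<close> over all
  sequences of real polynomials \<open>q\<^sub>n\<close> that converge to \<open>f\<close> uniformly on the spectrum.\<close>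

definition fun_calc :: "(real \<Rightarrow> real) \<Rightarrow> 'a::complex_inner bop \<Rightarrow> 'a bop"
  where "fun_calc f T = (THE S. \<forall>q :: nat \<Rightarrow> real poly.
    uniform_limit {t. complex_of_real t \<in> spectrum T} (\<lambda>n. poly (q n)) f sequentially \<longrightarrow>
    (\<lambda>n. poly_op (q n) T) \<longlonglongrightarrow> S)"

text \<open>For \<open>s > 0\<close> and a positive operator, or any real \<open>s\<close> and a positive invertible operator.\<close>

definition op_powr :: "'a::complex_inner bop \<Rightarrow> real \<Rightarrow> 'a bop"
  where "op_powr T s = fun_calc (\<lambda>t. t powr s) T"


section \<open>Operator means, the Kantorovich constant and positive linear maps\<close>

definition arith_mean :: "real \<Rightarrow> 'a::complex_inner bop \<Rightarrow> 'a bop \<Rightarrow> 'a bop"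
  where "arith_mean \<nu> X Y = (1 - \<nu>) *\<^sub>R X + \<nu> *\<^sub>R Y"

definition geom_mean :: "real \<Rightarrow> 'a::complex_inner bop \<Rightarrow> 'a bop \<Rightarrow> 'a bop"
  where "geom_mean \<nu> X Y =
    op_powr X (1/2) * op_powr (op_powr X (-1/2) * Y * op_powr X (-1/2)) \<nu> * op_powr X (1/2)"

definition kantorovich :: "real \<Rightarrow> real"
  where "kantorovich t = (1 + t)\<^sup>2 / (4 * t)"

definition positive_map :: "('a::complex_inner bop \<Rightarrow> 'b::complex_inner bop) \<Rightarrow> bool"
  where "positive_map \<Phi> \<longleftrightarrow> (\<forall>X. positive_op X \<longrightarrow> positive_op (\<Phi> X))"

end

theory Submission
  imports Defs "HOL-Computational_Algebra.Fundamental_Theorem_Algebra"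
begin

text \<open>
  Write \<open>X\<close> for the operator on the left, \<open>P = \<Phi>(X)\<close>, and \<open>G\<close> for either of the two operators
  \<open>\<Phi>(A \<sharp>\<^sub>\<nu> B)\<close> and \<open>\<Phi>(A) \<sharp>\<^sub>\<nu> \<Phi>(B)\<close> on the right.

  The proof rests on one linear inequality, \<open>P + Mm G\<^bsup>-1\<^esup> \<le> M + m\<close>. An operator \<open>T\<close> with
  \<open>m \<le> T \<le> M\<close> satisfies \<open>T + Mm T\<^bsup>-1\<^esup> \<le> M + m\<close>; averaging over \<open>A\<close> and \<open>B\<close> and subtracting the refined
  Young inequality \<open>A\<^bsup>-1\<^esup> \<nabla>\<^sub>\<nu> B\<^bsup>-1\<^esup> \<ge> (A \<sharp>\<^sub>\<nu> B)\<^bsup>-1\<^esup> + 2r (A\<^bsup>-1\<^esup> \<nabla> B\<^bsup>-1\<^esup> - A\<^bsup>-1\<^esup> \<sharp> B\<^bsup>-1\<^esup>)\<close> gives the inequality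
  before \<open>\<Phi>\<close> is applied. The inequalities of Kadison, Choi and Ando carry it through \<open>\<Phi>\<close>
  (\<open>op_powr_means_le\<close>).

  To square it, put \<open>Q = Mm G\<^bsup>-1\<^esup>\<close> and \<open>R = M + m - P\<close>, so that \<open>Q \<le> R\<close>. Squaring costs the Kantorovich
  constant of the spectral interval of \<open>G\<close>. As \<open>A\<close> and \<open>B\<close> lie in the separated intervals \<open>[m, m']\<close> and
  \<open>[M', M]\<close>, that interval has ratio at most \<open>h / h'\<close>, and so
  \<open>P\<^sup>2 + Q\<^sup>2 \<le> K(h/h') (P\<^sup>2 + R\<^sup>2) \<le> K(h/h') (M\<^sup>2 + m\<^sup>2)\<close> (\<open>op_powr_le_if_sum_inverse_le\<close>). Here the
  factor \<open>K(h')\<^sup>r\<close> is gained, because \<open>K(h') K(h/h') \<le> K(h)\<close>. It cannot come from Young's inequality: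
  at \<open>\<nu> = 1/2\<close> the refined inequality above is an equality.

  Calling the last bound \<open>L\<close>, one has \<open>P\<^bsup>p/2\<^esup> + Q\<^bsup>p/2\<^esup> \<le> L\<^bsup>p/4\<^esup>\<close> for \<open>p \<ge> 4\<close>, and the norm inequality
  \<open>\<parallel>UV\<parallel> \<le> \<parallel>U + V\<parallel>\<^sup>2 / 4\<close> of Bhatia and Kittaneh for positive \<open>U\<close> and \<open>V\<close> (\<open>norm_mult_le_quarter\<close>) turns this
  into \<open>P\<^sup>p \<le> (L\<^sup>p / 16) Q\<^bsup>-p\<^esup>\<close> (\<open>op_powr_le_of_sum_squares\<close>), which is the claim.

  The functional calculus is defined through polynomials that converge on the spectrum, so all this needs
  \<open>\<parallel>q(T)\<parallel> \<le> sup |q|\<close> over the spectrum of a self-adjoint \<open>T\<close> (\<open>norm_poly_op_le_spectrum\<close>), which the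
  fundamental theorem of algebra gives. From there on only bounds \<open>a \<le> T \<le> b\<close> are used.
\<close>

section \<open>Self-adjoint operators and quadratic forms\<close>

definition selfadj :: "'a::complex_inner bop \<Rightarrow> bool"
  where "selfadj T \<longleftrightarrow> (\<forall>x y. cinner (op_apply T x) y = cinner x (op_apply T y))"

definition quad :: "'a::complex_inner bop \<Rightarrow> 'a \<Rightarrow> real"
  where "quad T x = Re (cinner (op_apply T x) x)"

lemma selfadjD: "selfadj T \<Longrightarrow> cinner (op_apply T x) y = cinner x (op_apply T y)"
  by (simp add: selfadj_def)

lemma cinner_diff_right: "cinner (x :: 'a::complex_inner) (y - z) = cinner x y - cinner x z"
  using cinner_add_right [of x "y - z" z] by simp

lemma cinner_scaleR_left: "cinner (a *\<^sub>R x :: 'a::complex_inner) y = of_real a * cinner x y"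
  by (simp add: scaleC_of_real [symmetric] cinner_scaleC_left)

lemma cinner_scaleR_right: "cinner (x :: 'a::complex_inner) (a *\<^sub>R y) = of_real a * cinner x y"
  by (simp add: scaleC_of_real [symmetric] cinner_scaleC_right)

lemma cinner_zero_left [simp]: "cinner (0 :: 'a::complex_inner) y = 0"
  using cinner_diff_left [of 0 0 y] by simp

lemma cinner_zero_right [simp]: "cinner (y :: 'a::complex_inner) 0 = 0"
  using cinner_diff_right [of y 0 0] by simp

lemma cinner_minus_left [simp]: "cinner (- x :: 'a::complex_inner) y = - cinner x y"
  using cinner_diff_left [of 0 x y] by simp

lemma op_apply_diff: "op_apply T (x - y) = op_apply T x - op_apply T y"
  by (rule linear_diff [OF bounded_linear.linear [OF bounded_linear_op_apply]])

lemma op_apply_scaleR: "op_apply T (a *\<^sub>R x) = a *\<^sub>R op_apply T x"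
  by (rule linear_scale [OF bounded_linear.linear [OF bounded_linear_op_apply]])

lemmas bop_apply_simps = plus_bop.rep_eq minus_bop.rep_eq uminus_bop.rep_eq scaleR_bop.rep_eq
  scaleC_bop.rep_eq one_bop.rep_eq zero_bop.rep_eq times_bop.rep_eq

lemmas cinner_simps = cinner_diff_left cinner_diff_right cinner_add_left cinner_add_right
  cinner_scaleR_left cinner_scaleR_right

lemma norm_op_apply_le: "norm (op_apply T x) \<le> norm T * norm x"
  using onorm [OF bounded_linear_op_apply] by (simp add: norm_bop.rep_eq)

lemma norm_bop_le:
  assumes "0 \<le> c" "\<And>x. norm (op_apply T x) \<le> c * norm x"
  shows "norm T \<le> c"
  unfolding norm_bop.rep_eq using assms by (intro onorm_bound)

lemma quad_one: "quad 1 x = (norm x)\<^sup>2"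
  by (simp add: quad_def bop_apply_simps cinner_self)

lemma quad_simps [simp]:
  "quad (S + T) x = quad S x + quad T x"
  "quad (S - T) x = quad S x - quad T x"
  "quad (- T) x = - quad T x"
  "quad (a *\<^sub>R T) x = a * quad T x"
  "quad 0 x = 0"
  by (simp_all add: quad_def bop_apply_simps cinner_simps)

lemma selfadj_intros [intro, simp]:
  "selfadj 0" "selfadj 1"
  "selfadj S \<Longrightarrow> selfadj T \<Longrightarrow> selfadj (S + T)"
  "selfadj S \<Longrightarrow> selfadj T \<Longrightarrow> selfadj (S - T)"
  "selfadj T \<Longrightarrow> selfadj (a *\<^sub>R T)"
  by (auto simp: selfadj_def bop_apply_simps cinner_simps)

lemma selfadj_congruence: "selfadj S \<Longrightarrow> selfadj T \<Longrightarrow> selfadj (S * T * S)"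
  by (simp add: selfadj_def bop_apply_simps)

lemma selfadj_mult_commute: "selfadj S \<Longrightarrow> selfadj T \<Longrightarrow> S * T = T * S \<Longrightarrow> selfadj (S * T)"
  by (metis (no_types, lifting) selfadj_def times_bop.rep_eq)

lemma selfadj_power: "selfadj T \<Longrightarrow> selfadj (T ^ n)"
  by (induction n) (auto intro: selfadj_mult_commute simp: power_commutes)

lemma selfadj_sum: "(\<And>i. i \<in> I \<Longrightarrow> selfadj (f i)) \<Longrightarrow> selfadj (sum f I)"
  by (induction I rule: infinite_finite_induct) auto

text \<open>Polarization: over the complex numbers the sesquilinear form is determined by its
  diagonal, so a real diagonal makes it hermitian.\<close>

lemma selfadj_if_real_diagonal:
  assumes "\<And>x. cinner (op_apply T x) x \<in> \<real>"
  shows "selfadj T"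
  unfolding selfadj_def
proof (intro allI)
  fix x y
  let ?s = "\<lambda>u v. cinner (op_apply T u) v"
  have im: "Im (?s u u) = 0" for u
    using assms complex_is_Real_iff by blast
  have "Im (?s x y) + Im (?s y x) = 0"
    using im [of "x + y"] by (simp add: op_apply_add cinner_simps im)
  moreover have "Re (?s x y) = Re (?s y x)"
    using im [of "x + \<i> *\<^sub>C y"]
    by (simp add: op_apply_add op_apply_scaleC cinner_simps cinner_scaleC_left cinner_scaleC_right im)
  ultimately have "?s x y = cnj (?s y x)"
    by (simp add: complex_eq_iff)
  then show "?s x y = cinner x (op_apply T y)"
    using cinner_commute by metis
qed

lemma positive_op_iff: "positive_op T \<longleftrightarrow> selfadj T \<and> (\<forall>x. 0 \<le> quad T x)"
proof
  assume pos: "positive_op T"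
  then show "selfadj T \<and> (\<forall>x. 0 \<le> quad T x)"
    by (auto simp: positive_op_def quad_def complex_nonneg_Reals_iff
        intro!: selfadj_if_real_diagonal) (metis complex_is_Real_iff)
next
  assume T: "selfadj T \<and> (\<forall>x. 0 \<le> quad T x)"
  have "Im (cinner (op_apply T x) x) = 0" for x
    using T cinner_commute [of "op_apply T x" x]
    by (simp add: selfadj_def complex_eq_iff)
  with T show "positive_op T"
    by (simp add: positive_op_def quad_def complex_nonneg_Reals_iff)
qed

lemma bop_le_iff: "S \<le> T \<longleftrightarrow> selfadj (T - S) \<and> (\<forall>x. quad S x \<le> quad T x)"
  for S T :: "'a::complex_inner bop"
  by (simp add: less_eq_bop_def positive_op_iff)

lemma bop_nonneg_iff: "0 \<le> T \<longleftrightarrow> selfadj T \<and> (\<forall>x. 0 \<le> quad T x)"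
  for T :: "'a::complex_inner bop"
  by (simp add: bop_le_iff)

lemma positive_op_nonneg: "positive_op T \<longleftrightarrow> 0 \<le> T"
  by (simp add: less_eq_bop_def)

text \<open>The library laws for ordered real vector spaces then apply to operator inequalities.\<close>

instance bop :: (complex_inner) ordered_real_vector
proof
  fix S T U :: "'a bop" and a b :: real
  show "S \<le> T \<Longrightarrow> U + S \<le> U + T"
    by (simp add: less_eq_bop_def)
  show "S \<le> T \<Longrightarrow> 0 \<le> a \<Longrightarrow> a *\<^sub>R S \<le> a *\<^sub>R T"
    by (simp add: bop_le_iff mult_left_mono flip: scaleR_diff_right)
  show "a \<le> b \<Longrightarrow> 0 \<le> S \<Longrightarrow> a *\<^sub>R S \<le> b *\<^sub>R S"
    by (simp add: bop_le_iff bop_nonneg_iff mult_right_mono flip: scaleR_diff_left)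
qed

lemma selfadj_nonneg: "0 \<le> T \<Longrightarrow> selfadj T" for T :: "'a::complex_inner bop"
  by (simp add: bop_nonneg_iff)

lemma bop_le_transfer: "selfadj S \<Longrightarrow> S \<le> T \<Longrightarrow> selfadj T" "selfadj T \<Longrightarrow> S \<le> T \<Longrightarrow> selfadj S"
  for S T :: "'a::complex_inner bop"
  using selfadj_intros(3) [of S "T - S"] selfadj_intros(4) [of T "T - S"]
  by (auto simp: bop_le_iff)

lemma one_nonneg_bop [simp]: "0 \<le> (1 :: 'a::complex_inner bop)"
  by (simp add: bop_nonneg_iff quad_one)

lemma scale_one_le_iff_quad: "selfadj T \<Longrightarrow> c *\<^sub>R 1 \<le> T \<longleftrightarrow> (\<forall>x. c * (norm x)\<^sup>2 \<le> quad T x)"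
  by (simp add: bop_le_iff quad_one)

lemma le_scale_one_iff_quad: "selfadj T \<Longrightarrow> T \<le> c *\<^sub>R 1 \<longleftrightarrow> (\<forall>x. quad T x \<le> c * (norm x)\<^sup>2)"
  by (simp add: bop_le_iff quad_one)

lemma scaleR_one_mono: "a \<le> b \<Longrightarrow> a *\<^sub>R 1 \<le> (b *\<^sub>R 1 :: 'a::complex_inner bop)"
  by (rule scaleR_right_mono) auto

lemma scaleR_one_le_iff:
  assumes "(1 :: 'a::complex_inner bop) \<noteq> 0"
  shows "a *\<^sub>R 1 \<le> (b *\<^sub>R 1 :: 'a bop) \<longleftrightarrow> a \<le> b"
proof
  obtain x :: 'a where "x \<noteq> 0"
    using assms by (metis bop_eqI bop_apply_simps(6,7))
  moreover assume "a *\<^sub>R 1 \<le> (b *\<^sub>R 1 :: 'a bop)"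
  ultimately show "a \<le> b"
    by (auto simp: bop_le_iff quad_one dest!: spec [of _ x])
qed (rule scaleR_one_mono)

lemma congruence_mono:
  fixes S T W :: "'a::complex_inner bop"
  assumes "selfadj W" "S \<le> T"
  shows "W * S * W \<le> W * T * W"
proof -
  have "selfadj (W * (T - S) * W)"
    using assms by (intro selfadj_congruence) (auto simp: bop_le_iff)
  moreover have "quad (W * U * W) x = quad U (op_apply W x)" for U x
    using assms(1) by (simp add: quad_def bop_apply_simps selfadj_def)
  ultimately show ?thesis
    using assms(2) by (simp add: bop_le_iff algebra_simps)
qed

lemma congruence_nonneg: "selfadj W \<Longrightarrow> 0 \<le> T \<Longrightarrow> 0 \<le> W * T * W"
  for T :: "'a::complex_inner bop"
  using congruence_mono [of W 0 T] by simp

lemma square_nonneg: "selfadj W \<Longrightarrow> 0 \<le> W * W" for W :: "'a::complex_inner bop"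
  using congruence_nonneg [of W 1] by simp

lemma quad_square: "selfadj W \<Longrightarrow> quad (W * W) x = (norm (op_apply W x))\<^sup>2"
  by (metis Re_complex_of_real cinner_self quad_def selfadjD times_bop.rep_eq)

section \<open>Cauchy--Schwarz and the operator norm\<close>

lemma quadratic_nonneg_imp_discriminant:
  fixes a b c :: real
  assumes "\<And>t. 0 \<le> a + 2 * t * b + t\<^sup>2 * c" "0 \<le> c"
  shows "b\<^sup>2 \<le> a * c"
proof (cases "c = 0")
  case True
  have "b = 0"
  proof (rule ccontr)
    assume "b \<noteq> 0"
    then show False
      using assms(1) [of "- (a + 1) / (2 * b)"] True by (simp add: field_simps)
  qed
  with True show ?thesis by simp
next
  case False
  then have "0 \<le> a - b\<^sup>2 / c"
    using assms(1) [of "- b / c"] by (simp add: power2_eq_square field_simps)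
  with False assms(2) show ?thesis
    by (simp add: field_simps)
qed

lemma positive_Cauchy_Schwarz_Re:
  fixes U :: "'a::complex_inner bop"
  assumes "0 \<le> U"
  shows "(Re (cinner (op_apply U x) y))\<^sup>2 \<le> quad U x * quad U y"
proof (rule quadratic_nonneg_imp_discriminant)
  fix t :: real
  have "cinner (op_apply U y) x = cnj (cinner (op_apply U x) y)"
    using assms by (metis bop_nonneg_iff cinner_commute selfadjD)
  then have "quad U (x + t *\<^sub>R y) = quad U x + 2 * t * Re (cinner (op_apply U x) y) + t\<^sup>2 * quad U y"
    by (simp add: quad_def op_apply_add op_apply_scaleR cinner_simps power2_eq_square algebra_simps)
  then show "0 \<le> quad U x + 2 * t * Re (cinner (op_apply U x) y) + t\<^sup>2 * quad U y"
    using assms by (metis bop_nonneg_iff)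
qed (use assms in \<open>auto simp: bop_nonneg_iff\<close>)

lemma Re_cinner_le: "Re (cinner x y) \<le> norm x * norm (y :: 'a::complex_inner)"
proof -
  have "(Re (cinner x y))\<^sup>2 \<le> (norm x * norm y)\<^sup>2"
    using positive_Cauchy_Schwarz_Re [of 1 x y] by (simp add: quad_one bop_apply_simps power_mult_distrib)
  then show ?thesis
    by (simp add: abs_le_square_iff [symmetric])
qed

text \<open>Bounding the real and the imaginary part separately costs the factor 2. The lemma serves to pass
  to limits in inner products.\<close>

lemma cmod_cinner_le: "cmod (cinner x y) \<le> 2 * norm x * norm (y :: 'a::complex_inner)"
proof -
  have re: "\<bar>Re (cinner u v)\<bar> \<le> norm u * norm v" for u v :: 'a
    using Re_cinner_le [of u v] Re_cinner_le [of "- u" v] by simp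
  have "Im (cinner x y) = Re (cinner ((- \<i>) *\<^sub>C x) y)"
    by (simp add: cinner_scaleC_left)
  then have "\<bar>Im (cinner x y)\<bar> \<le> norm x * norm y"
    using re [of "(- \<i>) *\<^sub>C x" y] by (simp add: norm_scaleC)
  then show ?thesis
    using re [of x y] cmod_le [of "cinner x y"] by linarith
qed

lemma selfadj_le_norm:
  assumes "selfadj T"
  shows "T \<le> norm T *\<^sub>R 1" "(- norm T) *\<^sub>R 1 \<le> T"
proof -
  have b: "norm (op_apply T x) * norm x \<le> norm T * (norm x)\<^sup>2" for x
    using mult_right_mono [OF norm_op_apply_le [of T x], of "norm x"] by (simp add: power2_eq_square)
  have "quad T x \<le> norm T * (norm x)\<^sup>2" for x
    using Re_cinner_le [of "op_apply T x" x] b [of x] by (simp add: quad_def)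
  then show "T \<le> norm T *\<^sub>R 1"
    using assms by (simp add: le_scale_one_iff_quad)
  have "- quad T x \<le> norm T * (norm x)\<^sup>2" for x
    using Re_cinner_le [of "- op_apply T x" x] b [of x] cinner_diff_left [of 0 "op_apply T x" x]
    by (simp add: quad_def)
  then have "(- norm T) * (norm x)\<^sup>2 \<le> quad T x" for x
    by (metis minus_le_iff mult_minus_left)
  then show "(- norm T) *\<^sub>R 1 \<le> T"
    using assms by (simp only: scale_one_le_iff_quad) blast
qed

text \<open>Polarization: \<open>4 Re \<langle>Tx,z\<rangle> = \<langle>T(x+z),x+z\<rangle> - \<langle>T(x-z),x-z\<rangle>\<close>, with \<open>z\<close> a multiple of \<open>Tx\<close> of the same norm
  as \<open>x\<close>, turns bounds on the quadratic form into a bound on \<open>\<parallel>Tx\<parallel>\<close>.\<close>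

lemma norm_le_if_between:
  fixes T :: "'a::complex_inner bop"
  assumes "(- c) *\<^sub>R 1 \<le> T" "T \<le> c *\<^sub>R 1" "0 \<le> c"
  shows "norm T \<le> c"
proof (rule norm_bop_le)
  fix x
  have sa: "selfadj T"
    using assms(2) by (rule bop_le_transfer(2) [rotated]) auto
  have up: "quad T z \<le> c * (norm z)\<^sup>2" and lo: "- (c * (norm z)\<^sup>2) \<le> quad T z" for z
    using assms(1,2) sa by (simp_all add: bop_le_iff quad_one)
  let ?y = "op_apply T x"
  show "norm ?y \<le> c * norm x"
  proof (cases "?y = 0 \<or> x = 0")
    case True
    then show ?thesis
      using assms(3) by (auto simp: linear_0 [OF bounded_linear.linear [OF bounded_linear_op_apply]])
  next
    case False
    define t where "t = norm x / norm ?y"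
    define z where "z = t *\<^sub>R ?y"
    have nz: "norm z = norm x"
      using False by (simp add: z_def t_def)
    have "cinner (op_apply T z) x = cnj (cinner (op_apply T x) z)"
      using sa by (metis cinner_commute selfadjD)
    then have "quad T (x + z) - quad T (x - z) = 4 * Re (cinner (op_apply T x) z)"
      by (simp add: quad_def op_apply_add op_apply_diff cinner_simps)
    moreover have "(norm (x + z))\<^sup>2 + (norm (x - z))\<^sup>2 = 2 * (norm x)\<^sup>2 + 2 * (norm z)\<^sup>2"
      unfolding quad_one [symmetric] by (simp add: quad_def bop_apply_simps cinner_simps)
    then have "c * (norm (x + z))\<^sup>2 + c * (norm (x - z))\<^sup>2 = 4 * c * (norm x)\<^sup>2"
      by (simp add: nz flip: distrib_left)
    ultimately have "Re (cinner ?y z) \<le> c * (norm x)\<^sup>2"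
      using up [of "x + z"] lo [of "x - z"] by simp
    also have "Re (cinner ?y z) = norm x * norm ?y"
      using False by (simp add: z_def t_def cinner_simps cinner_self power2_eq_square)
    finally have "norm x * norm ?y \<le> norm x * (c * norm x)"
      by (simp add: power2_eq_square algebra_simps)
    then show ?thesis
      using False by simp
  qed
qed fact

lemma nonneg_norm_le_iff:
  fixes T :: "'a::complex_inner bop"
  assumes "0 \<le> T" "0 \<le> c"
  shows "norm T \<le> c \<longleftrightarrow> T \<le> c *\<^sub>R 1"
proof
  assume "norm T \<le> c"
  then show "T \<le> c *\<^sub>R 1"
    using selfadj_le_norm(1) [OF selfadj_nonneg [OF assms(1)]] scaleR_one_mono order_trans by blast
next
  assume "T \<le> c *\<^sub>R 1"
  moreover have "(- c) *\<^sub>R 1 \<le> T"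
    using assms by (meson neg_le_0_iff_le one_nonneg_bop order_trans scaleR_nonpos_nonneg)
  ultimately show "norm T \<le> c"
    using assms(2) norm_le_if_between by blast
qed

text \<open>Cauchy--Schwarz for the semi-inner product \<open>\<langle>Tx,y\<rangle>\<close>, taken at \<open>y = Tx\<close>.\<close>

lemma positive_mult_self_le:
  fixes T :: "'a::complex_inner bop"
  assumes "0 \<le> T" 
  shows "(norm (op_apply T x))\<^sup>2 \<le> norm T * quad T x"
proof (cases "op_apply T x = 0")
  case False
  let ?y = "op_apply T x"
  have "((norm ?y)\<^sup>2)\<^sup>2 \<le> quad T x * quad T ?y"
    using positive_Cauchy_Schwarz_Re [OF assms, of x ?y] by (simp add: cinner_self)
  also have "\<dots> \<le> quad T x * (norm T * (norm ?y)\<^sup>2)"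
    using assms selfadj_le_norm(1) [OF selfadj_nonneg [OF assms]]
    by (intro mult_left_mono) (auto simp: bop_le_iff quad_one bop_nonneg_iff)
  finally have "(norm ?y)\<^sup>2 * (norm ?y)\<^sup>2 \<le> (norm T * quad T x) * (norm ?y)\<^sup>2"
    by (simp add: power2_eq_square algebra_simps)
  then show ?thesis
    by (rule mult_right_le_imp_le) (use False in simp)
next
  case True
  then show ?thesis using assms by (simp add: bop_nonneg_iff)
qed

lemma quad_tendsto:
  assumes "T \<longlonglongrightarrow> S"
  shows "(\<lambda>n. quad (T n) x) \<longlonglongrightarrow> quad S x"
proof (rule Lim_null_comparison [THEN LIM_zero_cancel])
  have "\<bar>quad (T n) x - quad S x\<bar> \<le> norm (T n - S) * (norm x)\<^sup>2" for n
  proof -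
    let ?D = "T n - S"
    have "\<bar>quad ?D x\<bar> \<le> norm (op_apply ?D x) * norm x"
      using Re_cinner_le [of "op_apply ?D x" x] Re_cinner_le [of "- op_apply ?D x" x]
        cinner_diff_left [of 0 "op_apply ?D x" x]
      by (simp add: quad_def abs_le_iff)
    also have "\<dots> \<le> norm ?D * norm x * norm x"
      by (intro mult_right_mono norm_op_apply_le) auto
    finally show ?thesis by (simp add: power2_eq_square mult.assoc)
  qed
  then show "\<forall>\<^sub>F n in sequentially. norm (quad (T n) x - quad S x) \<le> norm (T n - S) * (norm x)\<^sup>2"
    by simp
  show "(\<lambda>n. norm (T n - S) * (norm x)\<^sup>2) \<longlonglongrightarrow> 0"
    using assms by (auto intro!: tendsto_mult_left_zero simp: tendsto_norm_zero_iff LIM_zero)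
qed

lemma op_apply_tendsto:
  assumes "T \<longlonglongrightarrow> S"
  shows "(\<lambda>n. op_apply (T n) x) \<longlonglongrightarrow> op_apply S x"
proof (rule Lim_null_comparison [THEN LIM_zero_cancel])
  show "\<forall>\<^sub>F n in sequentially. norm (op_apply (T n) x - op_apply S x) \<le> norm (T n - S) * norm x"
    using norm_op_apply_le [of "T _ - S" x] by (simp add: bop_apply_simps)
  show "(\<lambda>n. norm (T n - S) * norm x) \<longlonglongrightarrow> 0"
    using assms by (auto intro!: tendsto_mult_left_zero simp: tendsto_norm_zero_iff LIM_zero)
qed

lemma nonneg_limit:
  fixes T :: "nat \<Rightarrow> 'a::complex_inner bop"
  assumes lim: "T \<longlonglongrightarrow> S" and pos: "\<And>n. 0 \<le> T n"
  shows "0 \<le> S"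
proof -
  have "selfadj S"
    unfolding selfadj_def
  proof (intro allI)
    fix x y
    have *: "(\<lambda>n. cinner (op_apply (T n) u) v) \<longlonglongrightarrow> cinner (op_apply S u) v" for u v :: 'a
    proof (rule Lim_null_comparison [THEN LIM_zero_cancel])
      show "\<forall>\<^sub>F n in sequentially. norm (cinner (op_apply (T n) u) v - cinner (op_apply S u) v)
          \<le> 2 * norm (op_apply (T n) u - op_apply S u) * norm v"
        by (simp add: cmod_cinner_le flip: cinner_diff_left)
      show "(\<lambda>n. 2 * norm (op_apply (T n) u - op_apply S u) * norm v) \<longlonglongrightarrow> 0"
        using op_apply_tendsto [OF lim, of u]
        by (auto intro!: tendsto_mult_left_zero tendsto_mult_right_zero simp: tendsto_norm_zero_iff LIM_zero)
    qed
    have "cnj (cinner (op_apply (T n) y) x) = cinner (op_apply (T n) x) y" for n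
      using pos [of n] by (metis bop_nonneg_iff cinner_commute selfadjD)
    then have "cnj (cinner (op_apply S y) x) = cinner (op_apply S x) y"
      using tendsto_cnj [OF * [of y x]] LIMSEQ_unique [OF _ * [of x y]] by simp
    then show "cinner (op_apply S x) y = cinner x (op_apply S y)"
      by (metis cinner_commute)
  qed
  moreover have "0 \<le> quad S x" for x
    using quad_tendsto [OF lim, of x] pos by (intro LIMSEQ_le_const) (auto simp: bop_nonneg_iff)
  ultimately show ?thesis
    by (simp add: bop_nonneg_iff)
qed

section \<open>Completeness and invertibility\<close>

instance complex_hilbert_space \<subseteq> banach ..

text \<open>A Cauchy sequence of operators converges pointwise, and the Cauchy estimates pass to the pointwise
  limit, which makes the convergence uniform on the unit ball. Completeness is what the Neumann series
  and the functional calculus rest on.\<close>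

instance bop :: (complex_hilbert_space) banach
proof
  fix X :: "nat \<Rightarrow> 'a bop"
  assume X: "Cauchy X"
  have pw: "Cauchy (\<lambda>n. op_apply (X n) x)" for x
  proof (rule CauchyI)
    fix e :: real assume "0 < e"
    then have "0 < e / (norm x + 1)" by (simp add: add_nonneg_pos)
    then obtain N where N: "\<And>i j. i \<ge> N \<Longrightarrow> j \<ge> N \<Longrightarrow> norm (X i - X j) < e / (norm x + 1)"
      using CauchyD [OF X, of "e / (norm x + 1)"] by blast
    show "\<exists>N. \<forall>i\<ge>N. \<forall>j\<ge>N. norm (op_apply (X i) x - op_apply (X j) x) < e"
    proof (intro exI allI impI)
      fix i j assume "i \<ge> N" "j \<ge> N"
      have "norm (op_apply (X i) x - op_apply (X j) x) \<le> norm (X i - X j) * norm x"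
        using norm_op_apply_le [of "X i - X j" x] by (simp add: bop_apply_simps)
      also have "\<dots> \<le> e / (norm x + 1) * norm x"
        using N [OF \<open>i \<ge> N\<close> \<open>j \<ge> N\<close>] by (intro mult_right_mono) auto
      also have "\<dots> < e"
      proof -
        have "norm x / (norm x + 1) < 1" by (simp add: add_nonneg_pos)
        from mult_strict_left_mono [OF this \<open>0 < e\<close>] show ?thesis by simp
      qed
      finally show "norm (op_apply (X i) x - op_apply (X j) x) < e" .
    qed
  qed
  define L where "L x = lim (\<lambda>n. op_apply (X n) x)" for x
  have L: "(\<lambda>n. op_apply (X n) x) \<longlonglongrightarrow> L x" for x
    unfolding L_def using pw Cauchy_convergent_iff convergent_LIMSEQ_iff by blast
  have add: "L (x + y) = L x + L y" for x y
    using tendsto_add [OF L [of x] L [of y]] LIMSEQ_unique [OF L [of "x + y"]]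
    by (simp add: op_apply_add)
  have scaleC_cont: "(\<lambda>n. c *\<^sub>C u n) \<longlonglongrightarrow> c *\<^sub>C l" if "u \<longlonglongrightarrow> l" for c and u :: "nat \<Rightarrow> 'a" and l
    using that by (rule bounded_linear.tendsto [OF bounded_linear_scaleC])
  have scC: "L (c *\<^sub>C x) = c *\<^sub>C L x" for c x
    using scaleC_cont [OF L [of x], of c] LIMSEQ_unique [OF L [of "c *\<^sub>C x"]]
    by (simp add: op_apply_scaleC)
  obtain B where B: "\<And>n. norm (X n) \<le> B"
    using Cauchy_Bseq [OF X] by (auto simp: Bseq_def)
  have bd: "norm (L x) \<le> norm x * B" for x
  proof (rule LIMSEQ_le_const2 [OF tendsto_norm [OF L [of x]]], intro exI allI impI)
    fix n
    have "norm (op_apply (X n) x) \<le> norm (X n) * norm x" by (rule norm_op_apply_le)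
    also have "\<dots> \<le> B * norm x" by (intro mult_right_mono B) auto
    finally show "norm (op_apply (X n) x) \<le> norm x * B" by (simp add: mult.commute)
  qed
  have "bounded_linear L"
    by (rule bounded_linear_intro [where K = B])
      (auto simp: add bd scC simp flip: scaleC_of_real)
  then obtain S where S: "op_apply S = L"
    using Bop_inverse [of L] scC by auto
  have "X \<longlonglongrightarrow> S"
  proof (rule metric_LIMSEQ_I)
    fix e :: real assume "0 < e"
    then obtain N where N: "\<And>i j. i \<ge> N \<Longrightarrow> j \<ge> N \<Longrightarrow> norm (X i - X j) < e / 2"
      using CauchyD [OF X, of "e / 2"] by (metis half_gt_zero)
    show "\<exists>N. \<forall>n\<ge>N. dist (X n) S < e"
    proof (intro exI allI impI)
      fix n assume n: "n \<ge> N"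
      have "norm (X n - S) \<le> e / 2"
      proof (rule norm_bop_le)
        fix x
        have "(\<lambda>k. norm (op_apply (X n) x - op_apply (X k) x)) \<longlonglongrightarrow> norm (op_apply (X n) x - L x)"
          by (intro tendsto_intros L)
        moreover have "norm (op_apply (X n) x - op_apply (X k) x) \<le> e / 2 * norm x" if "k \<ge> N" for k
        proof -
          have "norm (op_apply (X n) x - op_apply (X k) x) \<le> norm (X n - X k) * norm x"
            using norm_op_apply_le [of "X n - X k" x] by (simp add: bop_apply_simps)
          also have "\<dots> \<le> e / 2 * norm x"
            using N [OF n that] by (intro mult_right_mono) auto
          finally show ?thesis .
        qed
        ultimately have "norm (op_apply (X n) x - L x) \<le> e / 2 * norm x"
          by (meson LIMSEQ_le_const2)
        then show "norm (op_apply (X n - S) x) \<le> e / 2 * norm x"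
          by (simp add: bop_apply_simps S)
      qed (use \<open>0 < e\<close> in simp)
      then show "dist (X n) S < e"
        using \<open>0 < e\<close> by (simp add: dist_norm)
    qed
  qed
  then show "convergent X"
    by (rule convergentI)
qed

text \<open>Neumann series.\<close>

lemma one_minus_invertible:
  fixes R :: "'a::complex_hilbert_space bop"
  assumes "norm R < 1"
  shows "op_invertible (1 - R)"
proof -
  have npow: "norm (R ^ n) \<le> norm (1 :: 'a bop) * norm R ^ n" for n
  proof (induction n)
    case (Suc n)
    have "norm (R ^ Suc n) \<le> norm R * norm (R ^ n)"
      by (simp add: norm_mult_ineq)
    also have "\<dots> \<le> norm R * (norm (1 :: 'a bop) * norm R ^ n)"
      by (intro mult_left_mono Suc) auto
    finally show ?case by (simp add: algebra_simps)
  qed simp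
  have "summable (\<lambda>n. norm (1 :: 'a bop) * norm R ^ n)"
    using assms by (intro summable_mult summable_geometric) simp
  then have sm: "summable (\<lambda>n. R ^ n)"
    by (rule summable_comparison_test' [where N = 0]) (rule npow)
  define S where "S = (\<Sum>n. R ^ n)"
  have tail: "(\<Sum>n. R ^ Suc n) = S - 1"
    using suminf_split_head [OF sm] by (simp add: S_def)
  have "R * S = (\<Sum>n. R ^ Suc n)" "S * R = (\<Sum>n. R ^ Suc n)"
    unfolding S_def
     apply (subst suminf_mult [OF sm, symmetric], simp)
    apply (subst suminf_mult2 [OF sm], simp add: power_commutes)
    done
  then have "R * S = S - 1" "S * R = S - 1"
    unfolding tail by auto
  then have "S * (1 - R) = 1 \<and> (1 - R) * S = 1"
    by (simp add: algebra_simps)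
  then show ?thesis
    unfolding op_invertible_def by blast
qed

lemma op_invertible_scale:
  assumes "op_invertible T" "c \<noteq> 0"
  shows "op_invertible (c *\<^sub>R T)"
proof -
  obtain S where "S * T = 1" "T * S = 1"
    using assms(1) by (auto simp: op_invertible_def)
  then have "(inverse c *\<^sub>R S) * (c *\<^sub>R T) = 1 \<and> (c *\<^sub>R T) * (inverse c *\<^sub>R S) = 1"
    using assms(2) by simp
  then show ?thesis unfolding op_invertible_def by blast
qed

text \<open>For \<open>b\<close> at least \<open>\<parallel>T\<parallel>\<close> and \<open>c\<close>, the operator \<open>1 - T/b\<close> lies between \<open>0\<close> and \<open>1 - c/b < 1\<close>.\<close>

lemma bounded_below_invertible:
  fixes T :: "'a::complex_hilbert_space bop"
  assumes "c *\<^sub>R 1 \<le> T" "0 < c"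
  shows "op_invertible T"
proof -
  define b where "b = norm T + c"
  have sa: "selfadj T"
    using assms(1) by (rule bop_le_transfer(1) [rotated]) auto
  have b: "0 < b" "c \<le> b"
    using assms(2) by (auto simp: b_def add_nonneg_pos)
  have "T \<le> norm T *\<^sub>R 1" "norm T *\<^sub>R 1 \<le> (b *\<^sub>R 1 :: 'a bop)"
    using selfadj_le_norm [OF sa] assms(2) by (auto intro!: scaleR_one_mono simp: b_def)
  then have up: "T \<le> b *\<^sub>R 1" by (rule order_trans)
  have "norm (1 - (1 / b) *\<^sub>R T) \<le> 1 - c / b"
  proof (rule norm_le_if_between)
    show "1 - (1 / b) *\<^sub>R T \<le> (1 - c / b) *\<^sub>R 1"
      using scaleR_left_mono [OF assms(1), of "1 / b"] b by (simp add: algebra_simps)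
    have "0 \<le> 1 - (1 / b) *\<^sub>R T"
      using scaleR_left_mono [OF up, of "1 / b"] b by (simp add: algebra_simps)
    moreover have "(- (1 - c / b)) *\<^sub>R 1 \<le> (0 :: 'a bop)"
      using scaleR_one_mono [of "- (1 - c / b)" 0] b by simp
    ultimately show "(- (1 - c / b)) *\<^sub>R 1 \<le> 1 - (1 / b) *\<^sub>R T"
      by (rule order_trans [rotated])
  qed (use b in simp)
  also have "\<dots> < 1" using b assms(2) by simp
  finally have "op_invertible (1 - (1 - (1 / b) *\<^sub>R T))"
    by (rule one_minus_invertible)
  then have "op_invertible (b *\<^sub>R (1 / b) *\<^sub>R T)"
    using b by (subst op_invertible_scale) simp_all
  moreover have "b *\<^sub>R (1 / b) *\<^sub>R T = T"
    using b by simp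
  ultimately show ?thesis by simp
qed

lemma op_invertible_mult: "op_invertible S \<Longrightarrow> op_invertible T \<Longrightarrow> op_invertible (S * T)"
  unfolding op_invertible_def by (metis mult.assoc mult_1_left)

lemma op_invertible_commuting_factor:
  assumes "op_invertible (S * T)" "S * T = T * S"
  shows "op_invertible S"
proof -
  obtain U where U: "U * (S * T) = 1" "S * T * U = 1"
    using assms(1) by (auto simp: op_invertible_def)
  have r: "S * (T * U) = 1"
    using U(2) by (simp only: mult.assoc)
  have l: "(U * T) * S = 1"
    using U(1) by (simp only: mult.assoc assms(2))
  have "U * T = (U * T) * (S * (T * U))"
    by (simp only: r mult_1_right)
  also have "\<dots> = ((U * T) * S) * (T * U)"
    by (simp only: mult.assoc)
  finally have "U * T = T * U"
    by (simp only: l mult_1_left)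
  with l r show ?thesis
    unfolding op_invertible_def by metis
qed

lemma scaleC_mult_left: "(c *\<^sub>C S) * T = c *\<^sub>C (S * T)" for S T :: "'a::complex_inner bop"
  by (rule bop_eqI) (simp add: bop_apply_simps)

lemma scaleC_mult_right: "S * (c *\<^sub>C T) = c *\<^sub>C (S * T)" for S T :: "'a::complex_inner bop"
  by (rule bop_eqI) (simp add: bop_apply_simps op_apply_scaleC)

lemma scaleC_diff_left: "(c - d) *\<^sub>C (x :: 'a::complex_vector) = c *\<^sub>C x - d *\<^sub>C x"
  using scaleC_add_left [of "c - d" d x] by simp

lemma scaleC_zero_left [simp]: "0 *\<^sub>C (x :: 'a::complex_vector) = 0"
  using scaleC_add_left [of 0 0 x] by simp

text \<open>For \<open>z = x + iy\<close> with \<open>y \<noteq> 0\<close> the product \<open>(T - z)(T - cnj z) = (T - x)\<^sup>2 + y\<^sup>2\<close> is bounded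
  below by \<open>y\<^sup>2\<close>; for real \<open>z\<close> outside the interval \<open>T - z\<close> or \<open>z - T\<close> is bounded below.\<close>

lemma spectrum_between:
  fixes T :: "'a::complex_hilbert_space bop"
  assumes T: "a *\<^sub>R 1 \<le> T" "T \<le> b *\<^sub>R 1" and z: "z \<in> spectrum T"
  shows "z \<in> \<real>" "a \<le> Re z" "Re z \<le> b"
proof -
  have sa: "selfadj T"
    using T(1) by (rule bop_le_transfer(1) [rotated]) auto
  have ninv: "\<not> op_invertible (T - z *\<^sub>C 1)"
    using z by (simp add: spectrum_def)
  show real: "z \<in> \<real>"
  proof (rule ccontr)
    assume "z \<notin> \<real>"
    then have y: "Im z \<noteq> 0" by (simp add: complex_is_Real_iff)
    define D where "D = T - Re z *\<^sub>R 1"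
    have D: "selfadj D" using sa by (simp add: D_def)
    let ?I = "Im z *\<^sub>R 1 :: 'a bop" and ?J = "(\<i> * Im z) *\<^sub>C 1 :: 'a bop"
    have zs: "w *\<^sub>C (1 :: 'a bop) = Re w *\<^sub>R 1 + (\<i> * Im w) *\<^sub>C 1" for w
    proof -
      have "w *\<^sub>C (1 :: 'a bop) = complex_of_real (Re w) *\<^sub>C 1 + (\<i> * Im w) *\<^sub>C 1"
        unfolding scaleC_add_left [symmetric] complex_eq [symmetric] ..
      then show ?thesis by (simp only: scaleC_of_real)
    qed
    have fac: "T - z *\<^sub>C 1 = D - ?J" "T - cnj z *\<^sub>C 1 = D + ?J"
      by (simp_all add: zs [of z] zs [of "cnj z"] D_def scaleC_diff_left [of 0, simplified])
    have JJ: "?J * ?J = - ((Im z)\<^sup>2 *\<^sub>R 1)"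
    proof -
      have "(\<i> * complex_of_real (Im z)) * (\<i> * complex_of_real (Im z)) = complex_of_real (- (Im z)\<^sup>2)"
        by (simp add: complex_eq_iff power2_eq_square)
      then have "?J * ?J = complex_of_real (- (Im z)\<^sup>2) *\<^sub>C 1"
        by (simp only: scaleC_mult_left scaleC_mult_right scaleC_scaleC mult_1_left)
      then show ?thesis by (simp only: scaleC_of_real) simp
    qed
    have DJ: "D * ?J = ?J * D"
      by (simp add: scaleC_mult_left scaleC_mult_right)
    have prod: "(T - z *\<^sub>C 1) * (T - cnj z *\<^sub>C 1) = D * D + (Im z)\<^sup>2 *\<^sub>R 1"
      unfolding fac by (simp add: algebra_simps JJ DJ)
    have comm: "(T - z *\<^sub>C 1) * (T - cnj z *\<^sub>C 1) = (T - cnj z *\<^sub>C 1) * (T - z *\<^sub>C 1)"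
      unfolding fac by (simp add: algebra_simps DJ)
    have "(Im z)\<^sup>2 *\<^sub>R 1 \<le> (T - z *\<^sub>C 1) * (T - cnj z *\<^sub>C 1)"
      unfolding prod using square_nonneg [OF D] by simp
    then have "op_invertible ((T - z *\<^sub>C 1) * (T - cnj z *\<^sub>C 1))"
      using y by (intro bounded_below_invertible) auto
    then show False
      using ninv comm op_invertible_commuting_factor by blast
  qed
  then have zr: "z *\<^sub>C (1 :: 'a bop) = Re z *\<^sub>R 1"
    by (metis of_real_Re scaleC_of_real)
  show "a \<le> Re z"
  proof (rule ccontr)
    assume "\<not> a \<le> Re z"
    then have "op_invertible (T - Re z *\<^sub>R 1)"
      using T(1) by (intro bounded_below_invertible [of "a - Re z"]) (auto simp: algebra_simps)
    then show False using ninv zr by simp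
  qed
  show "Re z \<le> b"
  proof (rule ccontr)
    assume "\<not> Re z \<le> b"
    then have "op_invertible (Re z *\<^sub>R 1 - T)"
      using T(2) by (intro bounded_below_invertible [of "Re z - b"]) (auto simp: algebra_simps)
    then have "op_invertible ((- 1) *\<^sub>R (Re z *\<^sub>R 1 - T))"
      by (rule op_invertible_scale) simp
    then show False using ninv zr by simp
  qed
qed

section \<open>Polynomials of an operator\<close>

text \<open>Complex coefficients allow the polynomial to be split into linear factors; the Horner form makes
  the induction over the coefficients immediate.\<close>

definition cpoly_op :: "complex poly \<Rightarrow> 'a::complex_inner bop \<Rightarrow> 'a bop"
  where "cpoly_op q T = fold_coeffs (\<lambda>c S. c *\<^sub>C 1 + T * S) q 0"

lemma cpoly_op_0 [simp]: "cpoly_op 0 T = 0"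
  by (simp add: cpoly_op_def)

lemma cpoly_op_pCons: "cpoly_op (pCons c q) T = c *\<^sub>C 1 + T * cpoly_op q T"
  by (cases "pCons c q = 0") (auto simp: cpoly_op_def fold_coeffs_pCons_not_0_0_eq)

lemma cpoly_op_add: "cpoly_op (p + q) T = cpoly_op p T + cpoly_op q T"
  by (induction p q rule: poly_induct2) (simp_all add: cpoly_op_pCons scaleC_add_left algebra_simps)

lemma cpoly_op_smult: "cpoly_op (smult c q) T = c *\<^sub>C cpoly_op q T"
  by (induction q) (simp_all add: cpoly_op_pCons scaleC_add_right scaleC_scaleC scaleC_mult_right scaleC_zero_right)

lemma cpoly_op_linear_mult: "cpoly_op ([:- z, 1:] * q) T = (T - z *\<^sub>C 1) * cpoly_op q T"
proof -
  have "[:- z, 1:] * q = smult (- z) q + pCons 0 q" by simp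
  then have "cpoly_op ([:- z, 1:] * q) T = (- z) *\<^sub>C cpoly_op q T + T * cpoly_op q T"
    by (simp only: cpoly_op_add cpoly_op_smult cpoly_op_pCons scaleC_zero_left add_0_left)
  then show ?thesis
    by (simp add: left_diff_distrib scaleC_mult_left scaleC_diff_left [of 0 z, simplified])
qed

lemma poly_op_pCons: "poly_op (pCons c q) T = c *\<^sub>R 1 + T * poly_op q T"
proof (cases "q = 0")
  case True
  then show ?thesis by (cases "c = 0") (simp_all add: poly_op_def)
next
  case False
  then show ?thesis
    by (simp add: poly_op_def degree_pCons_eq sum.atMost_Suc_shift sum_distrib_left del: sum.atMost_Suc)
qed

lemma poly_op_0 [simp]: "poly_op 0 T = 0"
  by (simp add: poly_op_def)

lemma poly_op_add: "poly_op (p + q) T = poly_op p T + poly_op q T"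
  by (induction p q rule: poly_induct2) (simp_all add: poly_op_pCons algebra_simps)

lemma poly_op_smult: "poly_op (smult c q) T = c *\<^sub>R poly_op q T"
  by (induction q) (simp_all add: poly_op_pCons algebra_simps)

lemma poly_op_diff: "poly_op (p - q) T = poly_op p T - poly_op q T"
  using poly_op_add [of "p - q" q T] by simp

lemma poly_op_mult: "poly_op (p * q) T = poly_op p T * poly_op q T"
  by (induction p) (simp_all add: poly_op_add poly_op_smult poly_op_pCons algebra_simps)

lemma poly_op_const: "poly_op [:c:] T = c *\<^sub>R 1"
  by (simp add: poly_op_pCons)

lemma poly_op_id: "poly_op [:0, 1:] T = T"
  by (simp add: poly_op_pCons)

lemma selfadj_poly_op: "selfadj T \<Longrightarrow> selfadj (poly_op q T)"
  by (auto simp: poly_op_def intro!: selfadj_sum selfadj_power)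

lemma cpoly_op_of_real: "cpoly_op (map_poly of_real q) T = poly_op q T"
  by (induction q) (simp_all add: map_poly_pCons cpoly_op_pCons poly_op_pCons scaleC_of_real)

text \<open>One half of the spectral mapping theorem: split off linear factors by the fundamental theorem of
  algebra; each factor \<open>T - z\<close> is invertible.\<close>

lemma cpoly_op_invertible:
  assumes "q \<noteq> 0" "\<And>z. poly q z = 0 \<Longrightarrow> z \<notin> spectrum T"
  shows "op_invertible (cpoly_op q T)"
  using assms
proof (induction "degree q" arbitrary: q)
  case 0
  then obtain c where c: "q = [:c:]" "c \<noteq> 0"
    by (metis degree_eq_zeroE pCons_0_0)
  have "(inverse c *\<^sub>C 1) * cpoly_op q T = 1" "cpoly_op q T * (inverse c *\<^sub>C 1) = 1"
    using c scaleC_of_real [of 1 "1 :: 'a bop"]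
    by (simp_all add: cpoly_op_pCons scaleC_mult_left scaleC_mult_right scaleC_scaleC)
  then show ?case unfolding op_invertible_def by blast
next
  case (Suc n)
  have "\<not> constant (poly q)"
    using Suc.hyps(2) by (simp add: constant_degree)
  then obtain z where z: "poly q z = 0"
    using fundamental_theorem_of_algebra by blast
  then obtain w where w: "q = [:- z, 1:] * w"
    by (auto simp: poly_eq_0_iff_dvd)
  have w0: "w \<noteq> 0" using w Suc.prems(1) by auto
  have "degree q = Suc (degree w)"
    unfolding w using w0 by (subst degree_mult_eq) auto
  then have "op_invertible (cpoly_op w T)"
    using Suc.hyps w0 Suc.prems(2) by (intro Suc.hyps) (auto simp: w)
  moreover have "op_invertible (T - z *\<^sub>C 1)"
    using Suc.prems(2) [OF z] by (simp add: spectrum_def)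
  ultimately show ?case
    unfolding w cpoly_op_linear_mult by (intro op_invertible_mult)
qed

text \<open>The norm of a self-adjoint operator is attained on its spectrum: if \<open>\<parallel>S\<parallel>\<^sup>2 - S\<^sup>2\<close> were invertible
  it would be bounded below by some \<open>\<delta> > 0\<close>, and then \<open>\<parallel>S\<parallel>\<^sup>2 \<le> \<parallel>S\<parallel>\<^sup>2 - \<delta>\<close>.\<close>

lemma norm_square_minus_square_not_invertible:
  fixes S :: "'a::complex_inner bop"
  assumes sa: "selfadj S" and nontriv: "(1 :: 'a bop) \<noteq> 0"
  shows "\<not> op_invertible ((norm S)\<^sup>2 *\<^sub>R 1 - S * S)"
proof
  define \<mu> where "\<mu> = norm S"
  define D where "D = \<mu>\<^sup>2 *\<^sub>R 1 - S * S"
  assume "op_invertible ((norm S)\<^sup>2 *\<^sub>R 1 - S * S)"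
  then obtain R where R: "R * D = 1"
    by (auto simp: op_invertible_def D_def \<mu>_def)
  have saSS: "selfadj (S * S)" using sa by (intro selfadj_mult_commute) auto
  have qD: "quad D x = \<mu>\<^sup>2 * (norm x)\<^sup>2 - (norm (op_apply S x))\<^sup>2" for x
    by (simp add: D_def quad_one quad_square [OF sa])
  have D: "0 \<le> D"
    unfolding bop_nonneg_iff
  proof (intro conjI allI)
    show "selfadj D" using saSS by (simp add: D_def)
    show "0 \<le> quad D x" for x
      using power_mono [OF norm_op_apply_le [of S x], of 2] by (simp add: qD \<mu>_def power_mult_distrib)
  qed
  have nR: "norm R \<noteq> 0" "norm D \<noteq> 0" using R nontriv by auto
  define \<delta> where "\<delta> = 1 / ((norm R)\<^sup>2 * norm D)"
  have \<delta>: "0 < \<delta>" using nR by (simp add: \<delta>_def)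
  have low: "\<delta> * (norm x)\<^sup>2 \<le> quad D x" for x
  proof -
    have "x = op_apply R (op_apply D x)"
      using R by (metis one_bop.rep_eq times_bop.rep_eq)
    then have "norm x \<le> norm R * norm (op_apply D x)"
      using norm_op_apply_le by metis
    then have "(norm x)\<^sup>2 \<le> (norm R)\<^sup>2 * (norm (op_apply D x))\<^sup>2"
      using power_mono [of "norm x" "norm R * norm (op_apply D x)" 2] by (simp add: power_mult_distrib)
    also have "\<dots> \<le> (norm R)\<^sup>2 * (norm D * quad D x)"
      by (intro mult_left_mono positive_mult_self_le D) auto
    finally show ?thesis
      using nR by (simp add: \<delta>_def field_simps)
  qed
  have up: "(norm (op_apply S x))\<^sup>2 \<le> (\<mu>\<^sup>2 - \<delta>) * (norm x)\<^sup>2" for x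
    using low [of x] by (simp add: qD algebra_simps)
  obtain x :: 'a where x: "x \<noteq> 0"
    using nontriv by (metis bop_eqI bop_apply_simps(6,7))
  have nn: "0 \<le> \<mu>\<^sup>2 - \<delta>"
    using up [of x] x by (smt (verit) zero_le_power2 mult_neg_pos zero_less_norm_iff zero_less_power)
  have "norm S \<le> sqrt (\<mu>\<^sup>2 - \<delta>)"
  proof (rule norm_bop_le)
    show "norm (op_apply S x) \<le> sqrt (\<mu>\<^sup>2 - \<delta>) * norm x" for x
      using up [of x] nn by (metis norm_ge_zero real_le_rsqrt real_sqrt_mult real_sqrt_unique)
  qed (use nn in simp)
  then have "\<mu>\<^sup>2 \<le> \<mu>\<^sup>2 - \<delta>"
    using nn by (simp add: \<mu>_def power2_le_iff_abs_le real_le_rsqrt sqrt_ge_absD)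
  with \<delta> show False by simp
qed

text \<open>If the spectrum were empty, every nonzero polynomial of \<open>T\<close> would be invertible, in particular
  \<open>\<parallel>T\<parallel>\<^sup>2 - T\<^sup>2\<close>.\<close>

lemma spectrum_nonempty_selfadj:
  fixes T :: "'a::complex_hilbert_space bop"
  assumes "selfadj T" "(1 :: 'a bop) \<noteq> 0"
  shows "spectrum T \<noteq> {}"
proof
  assume "spectrum T = {}"
  define u where "u = [:(norm T)\<^sup>2, 0, - 1:]"
  have "op_invertible (cpoly_op (map_poly of_real u) T)"
    using \<open>spectrum T = {}\<close> by (intro cpoly_op_invertible) (auto simp: u_def map_poly_pCons)
  moreover have "cpoly_op (map_poly of_real u) T = (norm T)\<^sup>2 *\<^sub>R 1 - T * T"
    by (simp add: cpoly_op_of_real u_def poly_op_pCons)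
  ultimately show False
    using norm_square_minus_square_not_invertible [OF assms] by simp
qed

lemma poly_map_poly_of_real: "poly (map_poly of_real q) (of_real t :: complex) = of_real (poly q t)"
  by (induction q) (simp_all add: map_poly_pCons)

text \<open>The norm bound that makes the functional calculus well defined. With \<open>\<mu> = \<parallel>q(T)\<parallel>\<close>, the
  polynomial \<open>\<mu>\<^sup>2 - q\<^sup>2\<close> must vanish somewhere on the spectrum.\<close>

lemma norm_poly_op_le_spectrum:
  fixes T :: "'a::complex_hilbert_space bop"
  assumes sa: "selfadj T" and \<epsilon>: "0 \<le> \<epsilon>"
    and bd: "\<And>t. complex_of_real t \<in> spectrum T \<Longrightarrow> \<bar>poly q t\<bar> \<le> \<epsilon>"
  shows "norm (poly_op q T) \<le> \<epsilon>"
proof (cases "(1 :: 'a bop) = 0")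
  case True
  then have "poly_op q T = 0" by (metis mult_1_left mult_zero_left)
  then show ?thesis using \<epsilon> by simp
next
  case False
  let ?\<mu> = "norm (poly_op q T)"
  define u where "u = [:?\<mu>\<^sup>2:] - q * q"
  have real: "z \<in> \<real>" if "z \<in> spectrum T" for z
    using spectrum_between(1) [OF _ _ that] selfadj_le_norm [OF sa] by blast
  have "poly_op u T = ?\<mu>\<^sup>2 *\<^sub>R 1 - poly_op q T * poly_op q T"
    by (simp add: u_def poly_op_diff poly_op_mult poly_op_const)
  then have ninv: "\<not> op_invertible (cpoly_op (map_poly of_real u) T)"
    using norm_square_minus_square_not_invertible [OF selfadj_poly_op [OF sa] False]
    by (simp add: cpoly_op_of_real)
  obtain t where t: "complex_of_real t \<in> spectrum T" "poly u t = 0"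
  proof (cases "map_poly complex_of_real u = 0")
    case True
    obtain z where "z \<in> spectrum T" using spectrum_nonempty_selfadj [OF sa False] by blast
    moreover from this obtain t where "z = of_real t" using real by (auto elim: Reals_cases)
    ultimately show ?thesis
      using that [of t] poly_map_poly_of_real [of u t] True by simp
  next
    case False
    then obtain z where z: "poly (map_poly of_real u) z = 0" "z \<in> spectrum T"
      using cpoly_op_invertible ninv by blast
    then obtain t where "z = of_real t" using real by (auto elim: Reals_cases)
    with z show ?thesis
      using that [of t] poly_map_poly_of_real [of u t] by simp
  qed
  then have "(poly q t)\<^sup>2 = ?\<mu>\<^sup>2" by (simp add: u_def power2_eq_square)
  then have "\<bar>poly q t\<bar> = ?\<mu>" by (metis abs_norm_cancel power2_eq_iff_nonneg abs_ge_zero power2_abs norm_ge_zero)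
  then show ?thesis using bd [OF t(1)] by simp
qed

section \<open>The continuous functional calculus\<close>

text \<open>The order form of the statement that \<open>T\<close> is self-adjoint with spectrum in \<open>[a, b]\<close>. Everything below is
  said in terms of such intervals, which positive unital maps preserve; the spectrum itself they do not.\<close>

definition op_between :: "real \<Rightarrow> real \<Rightarrow> 'a::complex_inner bop \<Rightarrow> bool"
  where "op_between a b T \<longleftrightarrow> a *\<^sub>R 1 \<le> T \<and> T \<le> b *\<^sub>R 1"

lemma op_between_selfadj: "op_between a b T \<Longrightarrow> selfadj T"
  unfolding op_between_def using bop_le_transfer(1) by blast

lemma real_polynomial_limit:
  fixes f :: "real \<Rightarrow> real"
  assumes "continuous_on {a..b} f"
  obtains q :: "nat \<Rightarrow> real poly" where "uniform_limit {a..b} (\<lambda>n. poly (q n)) f sequentially"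
proof -
  have "\<exists>p. \<forall>t\<in>{a..b}. \<bar>f t - poly p t\<bar> < 1 / Suc n" for n
  proof -
    obtain g where g: "real_polynomial_function g" "\<And>t. t \<in> {a..b} \<Longrightarrow> \<bar>f t - g t\<bar> < 1 / Suc n"
      using Stone_Weierstrass_real_polynomial_function [OF compact_Icc assms, of "1 / Suc n"] by auto
    then obtain c N where "g = (\<lambda>t. \<Sum>i\<le>N. c i * t ^ i)"
      using real_polynomial_function_iff_sum by blast
    then have "g t = poly (\<Sum>i\<le>N. monom (c i) i) t" for t
      by (simp add: poly_sum poly_monom)
    with g(2) show ?thesis by metis
  qed
  then obtain q where q: "\<And>n t. t \<in> {a..b} \<Longrightarrow> \<bar>f t - poly (q n) t\<bar> < 1 / Suc n"
    by metis
  have "uniform_limit {a..b} (\<lambda>n. poly (q n)) f sequentially"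
  proof (rule uniform_limitI)
    fix e :: real assume "0 < e"
    have "\<forall>\<^sub>F n in sequentially. 1 / Suc n < e"
      using order_tendstoD(2) [OF LIMSEQ_inverse_real_of_nat \<open>0 < e\<close>] by (simp add: inverse_eq_divide)
    then show "\<forall>\<^sub>F n in sequentially. \<forall>t\<in>{a..b}. dist (poly (q n) t) (f t) < e"
    proof eventually_elim
      case (elim n)
      show ?case
      proof
        fix t assume "t \<in> {a..b}"
        from q [OF this, of n] elim show "dist (poly (q n) t) (f t) < e"
          by (simp add: dist_real_def abs_minus_commute)
      qed
    qed
  qed
  with that show ?thesis .
qed

lemma real_spectrum_between:
  fixes T :: "'a::complex_hilbert_space bop"
  assumes "op_between a b T"
  shows "{t. complex_of_real t \<in> spectrum T} \<subseteq> {a..b}"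
  using spectrum_between [of a T b] assms by (fastforce simp: op_between_def)

text \<open>By the bound on \<open>\<parallel>q(T)\<parallel>\<close>, polynomials that approach \<open>f\<close> uniformly on the spectrum give operators that
  form a Cauchy sequence, with one limit for all such sequences. Uniform convergence on \<open>[a, b]\<close> is a
  special case, and Weierstrass provides a sequence of that kind.\<close>

lemma fun_calc_limit:
  fixes T :: "'a::complex_hilbert_space bop"
  assumes T: "op_between a b T" and f: "continuous_on {a..b} f"
    and q: "uniform_limit {a..b} (\<lambda>n. poly (q n)) f sequentially"
  shows "(\<lambda>n. poly_op (q n) T) \<longlonglongrightarrow> fun_calc f T"
proof -
  let ?\<Sigma> = "{t. complex_of_real t \<in> spectrum T}"
  have sa: "selfadj T" using T by (rule op_between_selfadj)
  have q\<Sigma>: "uniform_limit ?\<Sigma> (\<lambda>n. poly (q n)) f sequentially"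
    using real_spectrum_between [OF T] q by (meson uniform_limit_on_subset)
  have close: "\<exists>N. \<forall>i\<ge>N. \<forall>j\<ge>N. norm (poly_op (u i) T - poly_op (v j) T) < e"
    if u: "uniform_limit ?\<Sigma> (\<lambda>n. poly (u n)) f sequentially"
      and v: "uniform_limit ?\<Sigma> (\<lambda>n. poly (v n)) f sequentially" and e: "0 < e"
    for u v :: "nat \<Rightarrow> real poly" and e :: real
  proof -
    have e4: "0 < e / 4" using e by simp
    have "\<forall>\<^sub>F n in sequentially. (\<forall>t\<in>?\<Sigma>. dist (poly (u n) t) (f t) < e / 4)
        \<and> (\<forall>t\<in>?\<Sigma>. dist (poly (v n) t) (f t) < e / 4)"
      using uniform_limitD [OF u e4] uniform_limitD [OF v e4] by eventually_elim simp
    then obtain N where N: "\<And>n t. n \<ge> N \<Longrightarrow> t \<in> ?\<Sigma> \<Longrightarrow> \<bar>poly (u n) t - f t\<bar> < e / 4"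
        "\<And>n t. n \<ge> N \<Longrightarrow> t \<in> ?\<Sigma> \<Longrightarrow> \<bar>poly (v n) t - f t\<bar> < e / 4"
      by (auto simp: eventually_sequentially dist_real_def)
    have "norm (poly_op (u i) T - poly_op (v j) T) < e" if "i \<ge> N" "j \<ge> N" for i j
    proof -
      have "norm (poly_op (u i - v j) T) \<le> e / 2"
      proof (rule norm_poly_op_le_spectrum [OF sa])
        fix t assume "complex_of_real t \<in> spectrum T"
        then have "\<bar>poly (u i) t - f t\<bar> < e / 4" "\<bar>poly (v j) t - f t\<bar> < e / 4"
          using N(1) [OF that(1)] N(2) [OF that(2)] by blast+
        then show "\<bar>poly (u i - v j) t\<bar> \<le> e / 2"
          unfolding poly_diff by linarith
      qed (use e in simp)
      then show ?thesis using e by (simp add: poly_op_diff)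
    qed
    then show ?thesis by blast
  qed
  have "Cauchy (\<lambda>n. poly_op (q n) T)"
    by (rule CauchyI) (use close [OF q\<Sigma> q\<Sigma>] in auto)
  then obtain S where S: "(\<lambda>n. poly_op (q n) T) \<longlonglongrightarrow> S"
    using Cauchy_convergent_iff convergent_def by blast
  have all: "(\<lambda>n. poly_op (u n) T) \<longlonglongrightarrow> S"
    if u: "uniform_limit ?\<Sigma> (\<lambda>n. poly (u n)) f sequentially" for u :: "nat \<Rightarrow> real poly"
  proof -
    have "(\<lambda>n. poly_op (u n) T - poly_op (q n) T) \<longlonglongrightarrow> 0"
    proof (rule LIMSEQ_I)
      fix e :: real assume "0 < e"
      then show "\<exists>N. \<forall>n\<ge>N. norm (poly_op (u n) T - poly_op (q n) T - 0) < e"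
        using close [OF u q\<Sigma>] by (metis diff_zero)
    qed
    from tendsto_add [OF this S] show ?thesis by simp
  qed
  have "fun_calc f T = S"
    unfolding fun_calc_def
  proof (rule the_equality)
    show "R = S" if "\<forall>u. uniform_limit ?\<Sigma> (\<lambda>n. poly (u n)) f sequentially \<longrightarrow>
        (\<lambda>n. poly_op (u n) T) \<longlonglongrightarrow> R" for R
      using that q\<Sigma> LIMSEQ_unique [OF _ S] by blast
  qed (use all in blast)
  with S show ?thesis by simp
qed

lemma fun_calc_poly:
  fixes T :: "'a::complex_hilbert_space bop"
  assumes T: "op_between a b T" and f: "\<And>t. t \<in> {a..b} \<Longrightarrow> f t = poly q t"
  shows "fun_calc f T = poly_op q T"
proof -
  have "continuous_on {a..b} f"
    using f by (subst continuous_on_cong [OF refl, of _ f "poly q"]) (auto intro: continuous_intros)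
  moreover have "uniform_limit {a..b} (\<lambda>n. poly q) f sequentially"
    using f by (intro uniform_limitI) auto
  ultimately have "(\<lambda>n. poly_op q T) \<longlonglongrightarrow> fun_calc f T"
    by (rule fun_calc_limit [OF T])
  then show ?thesis by (simp add: LIMSEQ_const_iff)
qed

context
  fixes T :: "'a::complex_hilbert_space bop" and a b :: real
  assumes T: "op_between a b T"
begin

lemma fun_calc_const: "fun_calc (\<lambda>t. c) T = c *\<^sub>R 1"
  using fun_calc_poly [OF T, of "\<lambda>t. c" "[:c:]"] by (simp add: poly_op_const)

lemma fun_calc_id: "fun_calc (\<lambda>t. t) T = T"
  using fun_calc_poly [OF T, of "\<lambda>t. t" "[:0, 1:]"] by (simp add: poly_op_id)

lemma fun_calc_cong:
  assumes f: "continuous_on {a..b} f" and eq: "\<And>t. t \<in> {a..b} \<Longrightarrow> f t = g t"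
  shows "fun_calc f T = fun_calc g T"
proof -
  obtain q where q: "uniform_limit {a..b} (\<lambda>n. poly (q n)) f sequentially"
    using real_polynomial_limit [OF f] .
  moreover have "continuous_on {a..b} g"
    using f eq by (metis continuous_on_cong)
  moreover have "uniform_limit {a..b} (\<lambda>n. poly (q n)) g sequentially"
    using q uniform_limit_cong' [of "{a..b}" "\<lambda>n. poly (q n)" "\<lambda>n. poly (q n)" f g] eq by auto
  ultimately show ?thesis
    using fun_calc_limit [OF T] f LIMSEQ_unique by blast
qed

lemma fun_calc_add:
  assumes f: "continuous_on {a..b} f" and g: "continuous_on {a..b} g"
  shows "fun_calc (\<lambda>t. f t + g t) T = fun_calc f T + fun_calc g T"
proof -
  obtain p q where p: "uniform_limit {a..b} (\<lambda>n. poly (p n)) f sequentially"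
    and q: "uniform_limit {a..b} (\<lambda>n. poly (q n)) g sequentially"
    using real_polynomial_limit f g by metis
  have "uniform_limit {a..b} (\<lambda>n. poly (p n + q n)) (\<lambda>t. f t + g t) sequentially"
    unfolding poly_add using p q by (rule uniform_limit_add)
  then have "(\<lambda>n. poly_op (p n + q n) T) \<longlonglongrightarrow> fun_calc (\<lambda>t. f t + g t) T"
    using f g by (intro fun_calc_limit [OF T]) (auto intro: continuous_intros)
  moreover have "(\<lambda>n. poly_op (p n + q n) T) \<longlonglongrightarrow> fun_calc f T + fun_calc g T"
    unfolding poly_op_add by (intro tendsto_add fun_calc_limit [OF T] f g p q)
  ultimately show ?thesis by (rule LIMSEQ_unique)
qed

lemma fun_calc_mult:
  assumes f: "continuous_on {a..b} f" and g: "continuous_on {a..b} g"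
  shows "fun_calc (\<lambda>t. f t * g t) T = fun_calc f T * fun_calc g T"
proof -
  obtain p q where p: "uniform_limit {a..b} (\<lambda>n. poly (p n)) f sequentially"
    and q: "uniform_limit {a..b} (\<lambda>n. poly (q n)) g sequentially"
    using real_polynomial_limit f g by metis
  have "bounded (f ` {a..b})" "bounded (g ` {a..b})"
    using f g by (auto intro!: compact_imp_bounded compact_continuous_image)
  then have "uniform_limit {a..b} (\<lambda>n. poly (p n * q n)) (\<lambda>t. f t * g t) sequentially"
    unfolding poly_mult using p q by (intro uniform_lim_mult)
  then have "(\<lambda>n. poly_op (p n * q n) T) \<longlonglongrightarrow> fun_calc (\<lambda>t. f t * g t) T"
    using f g by (intro fun_calc_limit [OF T]) (auto intro: continuous_intros)
  moreover have "(\<lambda>n. poly_op (p n * q n) T) \<longlonglongrightarrow> fun_calc f T * fun_calc g T"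
    unfolding poly_op_mult by (intro tendsto_mult fun_calc_limit [OF T] f g p q)
  ultimately show ?thesis by (rule LIMSEQ_unique)
qed

lemma fun_calc_scale:
  assumes f: "continuous_on {a..b} f"
  shows "fun_calc (\<lambda>t. c * f t) T = c *\<^sub>R fun_calc f T"
  using fun_calc_mult [of "\<lambda>t. c" f] f by (simp add: fun_calc_const)

lemma fun_calc_diff:
  assumes f: "continuous_on {a..b} f" and g: "continuous_on {a..b} g"
  shows "fun_calc (\<lambda>t. f t - g t) T = fun_calc f T - fun_calc g T"
  using fun_calc_add [of f "\<lambda>t. (- 1) * g t"] fun_calc_scale [of g "- 1"] f g
  by (simp add: continuous_on_minus)

text \<open>\<open>g - f\<close> is the square of a real function \<open>s\<close>, so \<open>g(T) - f(T)\<close> is a limit of squares of self-adjoint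
  operators.\<close>

lemma fun_calc_mono:
  assumes f: "continuous_on {a..b} f" and g: "continuous_on {a..b} g"
    and le: "\<And>t. t \<in> {a..b} \<Longrightarrow> f t \<le> g t"
  shows "fun_calc f T \<le> fun_calc g T"
proof -
  define s where "s t = sqrt (g t - f t)" for t
  have s: "continuous_on {a..b} s"
    unfolding s_def using f g by (intro continuous_intros)
  obtain q where q: "uniform_limit {a..b} (\<lambda>n. poly (q n)) s sequentially"
    using real_polynomial_limit [OF s] .
  note lim = fun_calc_limit [OF T s q]
  have "0 \<le> poly_op (q n) T * poly_op (q n) T" for n
    using op_between_selfadj [OF T] by (intro square_nonneg selfadj_poly_op)
  then have "0 \<le> fun_calc s T * fun_calc s T"
    using tendsto_mult [OF lim lim] by (rule nonneg_limit [rotated])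
  also have "fun_calc s T * fun_calc s T = fun_calc (\<lambda>t. s t * s t) T"
    by (simp add: fun_calc_mult s)
  also have "\<dots> = fun_calc (\<lambda>t. g t - f t) T"
    using le by (intro fun_calc_cong continuous_intros s) (auto simp: s_def)
  also have "\<dots> = fun_calc g T - fun_calc f T"
    by (rule fun_calc_diff [OF g f])
  finally show ?thesis by simp
qed

lemma fun_calc_between:
  assumes f: "continuous_on {a..b} f" and "\<And>t. t \<in> {a..b} \<Longrightarrow> c \<le> f t" "\<And>t. t \<in> {a..b} \<Longrightarrow> f t \<le> d"
  shows "op_between c d (fun_calc f T)"
  using fun_calc_mono [of "\<lambda>t. c" f] fun_calc_mono [of f "\<lambda>t. d"] assms
  by (simp add: op_between_def fun_calc_const)

lemma fun_calc_norm_le: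
  assumes f: "continuous_on {a..b} f" and "\<And>t. t \<in> {a..b} \<Longrightarrow> \<bar>f t\<bar> \<le> c" and "0 \<le> c"
  shows "norm (fun_calc f T) \<le> c"
proof -
  have "op_between (- c) c (fun_calc f T)"
    using f by (rule fun_calc_between) (use assms(2) in \<open>auto simp: abs_le_iff minus_le_iff\<close>)
  then show ?thesis
    using assms(3) norm_le_if_between by (auto simp: op_between_def)
qed

lemma poly_op_fun_calc:
  assumes g: "continuous_on {a..b} g"
  shows "poly_op q (fun_calc g T) = fun_calc (\<lambda>t. poly q (g t)) T"
proof (induction q)
  case 0
  then show ?case by (simp add: fun_calc_const)
next
  case (pCons c q)
  have "continuous_on {a..b} (\<lambda>t. poly q (g t))"
    using g by (intro continuous_intros)
  then show ?case
    using g by (simp add: poly_op_pCons pCons.IH fun_calc_add fun_calc_mult fun_calc_const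
        continuous_on_mult)
qed

text \<open>For a polynomial \<open>f\<close> this is the homomorphism property; the general case follows by approximating \<open>f\<close>.\<close>

lemma fun_calc_compose:
  assumes g: "continuous_on {a..b} g" and gcd: "\<And>t. t \<in> {a..b} \<Longrightarrow> g t \<in> {c..d}"
    and f: "continuous_on {c..d} f"
  shows "fun_calc f (fun_calc g T) = fun_calc (\<lambda>t. f (g t)) T"
proof -
  obtain q where q: "uniform_limit {c..d} (\<lambda>n. poly (q n)) f sequentially"
    using real_polynomial_limit [OF f] .
  have bt: "op_between c d (fun_calc g T)"
    using g by (rule fun_calc_between) (use gcd in auto)
  have fg: "continuous_on {a..b} (\<lambda>t. f (g t))"
    using f g by (rule continuous_on_compose2) (use gcd in auto)
  have lim: "(\<lambda>n. poly_op (q n) (fun_calc g T)) \<longlonglongrightarrow> fun_calc f (fun_calc g T)"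
    using bt f q by (rule fun_calc_limit)
  moreover have "(\<lambda>n. poly_op (q n) (fun_calc g T)) \<longlonglongrightarrow> fun_calc (\<lambda>t. f (g t)) T"
  proof (rule LIMSEQ_I)
    fix e :: real assume e: "0 < e"
    then have "\<forall>\<^sub>F n in sequentially. \<forall>t\<in>{c..d}. dist (poly (q n) t) (f t) < e / 2"
      by (intro uniform_limitD [OF q]) simp
    then obtain N where N: "\<And>n t. n \<ge> N \<Longrightarrow> t \<in> {c..d} \<Longrightarrow> \<bar>poly (q n) t - f t\<bar> < e / 2"
      unfolding eventually_sequentially dist_real_def by blast
    have "norm (poly_op (q n) (fun_calc g T) - fun_calc (\<lambda>t. f (g t)) T) < e" if n: "n \<ge> N" for n
    proof -
      have c: "continuous_on {a..b} (\<lambda>t. poly (q n) (g t))"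
        using g by (intro continuous_intros)
      have "norm (fun_calc (\<lambda>t. poly (q n) (g t) - f (g t)) T) \<le> e / 2"
      proof (rule fun_calc_norm_le)
        show "continuous_on {a..b} (\<lambda>t. poly (q n) (g t) - f (g t))"
          using c fg by (rule continuous_on_diff)
        show "\<bar>poly (q n) (g t) - f (g t)\<bar> \<le> e / 2" if "t \<in> {a..b}" for t
          using N [OF n gcd [OF that]] by simp
      qed (use e in simp)
      then show ?thesis
        using e by (simp add: fun_calc_diff c fg poly_op_fun_calc [OF g])
    qed
    then show "\<exists>N. \<forall>n\<ge>N. norm (poly_op (q n) (fun_calc g T) - fun_calc (\<lambda>t. f (g t)) T) < e"
      by blast
  qed
  ultimately show ?thesis by (rule LIMSEQ_unique)
qed

end

section \<open>Real powers of strictly positive operators\<close>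

text \<open>Strictly positive, that is, positive and invertible. The scalar lower bound is the form that
  congruences and unital positive maps preserve.\<close>

definition spos :: "'a::complex_inner bop \<Rightarrow> bool"
  where "spos T \<longleftrightarrow> (\<exists>c>0. c *\<^sub>R 1 \<le> T)"

lemma spos_between:
  assumes "spos T"
  obtains a b where "0 < a" "a \<le> b" "op_between a b T"
proof -
  obtain c where c: "0 < c" "c *\<^sub>R 1 \<le> T"
    using assms by (auto simp: spos_def)
  have "selfadj T"
    using c(2) by (rule bop_le_transfer(1) [rotated]) auto
  then have "T \<le> max c (norm T) *\<^sub>R 1"
    using selfadj_le_norm(1) scaleR_one_mono [of "norm T" "max c (norm T)"] order_trans by fastforce
  with c show ?thesis
    by (intro that [of c "max c (norm T)"]) (auto simp: op_between_def)
qed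

lemma spos_selfadj: "spos T \<Longrightarrow> selfadj T"
  using spos_between op_between_selfadj by metis

lemma spos_nonneg: "spos T \<Longrightarrow> 0 \<le> T"
  unfolding spos_def by (metis less_imp_le one_nonneg_bop order_trans scaleR_nonneg_nonneg)

lemma spos_le: "spos S \<Longrightarrow> S \<le> T \<Longrightarrow> spos T"
  unfolding spos_def using order_trans by blast

lemma op_between_spos: "0 < a \<Longrightarrow> op_between a b T \<Longrightarrow> spos T"
  by (auto simp: op_between_def spos_def)

lemma spos_scale: "spos T \<Longrightarrow> 0 < c \<Longrightarrow> spos (c *\<^sub>R T)"
  unfolding spos_def
  by (metis less_imp_le mult_pos_pos scaleR_left_mono scaleR_scaleR)

lemma continuous_on_powr_pos: "0 < a \<Longrightarrow> continuous_on {a..b} (\<lambda>t :: real. t powr s)"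
  by (intro continuous_intros) auto

lemma op_powr_fun_calc: "op_powr T s = fun_calc (\<lambda>t. t powr s) T"
  by (simp add: op_powr_def)

lemma op_powr_between:
  fixes T :: "'a::complex_hilbert_space bop"
  assumes "0 < a" "op_between a b T" "0 \<le> s"
  shows "op_between (a powr s) (b powr s) (op_powr T s)"
  unfolding op_powr_fun_calc using assms
  by (intro fun_calc_between [OF assms(2)] continuous_on_powr_pos) (auto intro!: powr_mono2)

lemma op_powr_between_neg:
  fixes T :: "'a::complex_hilbert_space bop"
  assumes "0 < a" "op_between a b T" "s \<le> 0"
  shows "op_between (b powr s) (a powr s) (op_powr T s)"
  unfolding op_powr_fun_calc using assms
  by (intro fun_calc_between [OF assms(2)] continuous_on_powr_pos) (auto intro!: powr_mono2')

context
  fixes T :: "'a::complex_hilbert_space bop"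
  assumes T: "spos T"
begin

lemma op_powr_spos: "spos (op_powr T s)"
proof -
  obtain a b where ab: "0 < a" "a \<le> b" "op_between a b T" using spos_between [OF T] .
  show ?thesis
  proof (cases "0 \<le> s")
    case True
    then show ?thesis
      using op_powr_between [OF ab(1,3), of s] ab by (intro op_between_spos [of "a powr s"]) auto
  next
    case False
    then show ?thesis
      using op_powr_between_neg [OF ab(1,3), of s] ab by (intro op_between_spos [of "b powr s"]) auto
  qed
qed

lemma op_powr_selfadj: "selfadj (op_powr T s)"
  by (rule spos_selfadj [OF op_powr_spos])

lemma op_powr_mult: "op_powr T s * op_powr T u = op_powr T (s + u)"
proof -
  obtain a b where ab: "0 < a" "a \<le> b" "op_between a b T" using spos_between [OF T] .
  show ?thesis
    unfolding op_powr_fun_calc powr_add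
    using ab by (simp add: fun_calc_mult [OF ab(3)] continuous_on_powr_pos)
qed

lemma op_powr_0: "op_powr T 0 = 1"
proof -
  obtain a b where ab: "0 < a" "a \<le> b" "op_between a b T" using spos_between [OF T] .
  have "fun_calc (\<lambda>t. t powr 0) T = fun_calc (\<lambda>t. 1) T"
    using ab by (intro fun_calc_cong [OF ab(3)] continuous_on_powr_pos) auto
  then show ?thesis
    by (simp add: op_powr_fun_calc fun_calc_const [OF ab(3)])
qed

lemma op_powr_1: "op_powr T 1 = T"
proof -
  obtain a b where ab: "0 < a" "a \<le> b" "op_between a b T" using spos_between [OF T] .
  have "fun_calc (\<lambda>t. t powr 1) T = fun_calc (\<lambda>t. t) T"
    using ab by (intro fun_calc_cong [OF ab(3)] continuous_on_powr_pos) auto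
  then show ?thesis
    by (simp add: op_powr_fun_calc fun_calc_id [OF ab(3)])
qed

lemma op_powr_2: "op_powr T 2 = T * T"
  using op_powr_mult [of 1 1] by (simp add: op_powr_1)

lemma op_powr_powr: "op_powr (op_powr T s) u = op_powr T (s * u)"
proof -
  obtain a b where ab: "0 < a" "a \<le> b" "op_between a b T" using spos_between [OF T] .
  define c d where "c = min (a powr s) (b powr s)" and "d = max (a powr s) (b powr s)"
  have c: "0 < c" using ab by (auto simp: c_def)
  have "fun_calc (\<lambda>t. t powr u) (fun_calc (\<lambda>t. t powr s) T) = fun_calc (\<lambda>t. (t powr s) powr u) T"
  proof (rule fun_calc_compose [OF ab(3) continuous_on_powr_pos])
    show "continuous_on {c..d} (\<lambda>t. t powr u)" by (rule continuous_on_powr_pos [OF c])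
    fix t assume t: "t \<in> {a..b}"
    show "t powr s \<in> {c..d}"
    proof (cases "0 \<le> s")
      case True
      then have "a powr s \<le> t powr s" "t powr s \<le> b powr s" using t ab by (auto intro!: powr_mono2)
      then show ?thesis by (auto simp: c_def d_def)
    next
      case False
      then have "t powr s \<le> a powr s" "b powr s \<le> t powr s" using t ab by (auto intro!: powr_mono2')
      then show ?thesis by (auto simp: c_def d_def)
    qed
  qed (use ab in simp)
  then show ?thesis
    by (simp add: op_powr_fun_calc powr_powr)
qed

lemma op_powr_scale:
  assumes c: "0 < c"
  shows "op_powr (c *\<^sub>R T) s = (c powr s) *\<^sub>R op_powr T s"
proof -
  obtain a b where ab: "0 < a" "a \<le> b" "op_between a b T" using spos_between [OF T] .
  have cT: "c *\<^sub>R T = fun_calc (\<lambda>t. c * t) T"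
    by (simp add: fun_calc_scale [OF ab(3)] fun_calc_id [OF ab(3)] continuous_intros)
  have "op_powr (c *\<^sub>R T) s = fun_calc (\<lambda>t. (c * t) powr s) T"
    unfolding op_powr_fun_calc cT
  proof (rule fun_calc_compose [OF ab(3)])
    show "continuous_on {c * a..c * b} (\<lambda>t. t powr s)"
      using c ab by (intro continuous_on_powr_pos) auto
  qed (use c in \<open>auto intro!: continuous_intros\<close>)
  also have "\<dots> = fun_calc (\<lambda>t. c powr s * t powr s) T"
    using c ab by (intro fun_calc_cong [OF ab(3)] continuous_intros) (auto simp: powr_mult)
  also have "\<dots> = (c powr s) *\<^sub>R op_powr T s"
    using ab by (simp add: fun_calc_scale [OF ab(3)] continuous_on_powr_pos op_powr_fun_calc)
  finally show ?thesis .
qed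

lemma op_powr_inverse: "op_powr T s * op_powr T (- s) = 1" "op_powr T (- s) * op_powr T s = 1"
  by (simp_all add: op_powr_mult op_powr_0)

lemma op_inverse_eq_powr: "op_inverse T = op_powr T (- 1)"
  unfolding op_inverse_def
proof (rule the_equality)
  show inv: "op_powr T (- 1) * T = 1 \<and> T * op_powr T (- 1) = 1"
    using op_powr_inverse [of 1] by (simp add: op_powr_1)
  show "S = op_powr T (- 1)" if "S * T = 1 \<and> T * S = 1" for S
    using that inv by (metis mult.assoc mult_1_left mult_1_right)
qed

lemma op_powr_minus_1_unique: "S * T = 1 \<Longrightarrow> op_powr T (- 1) = S"
  using op_powr_inverse [of 1] by (metis op_powr_1 mult.assoc mult_1_left mult_1_right)

end

section \<open>The arithmetic-geometric mean inequality for the norm of a product\<close>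

lemma Re_cinner_commute: "Re (cinner x y) = Re (cinner y (x :: 'a::complex_inner))"
  by (subst cinner_commute) simp

text \<open>Let \<open>\<mu> = \<parallel>UV\<parallel>\<close>, let \<open>x\<close> be arbitrary and \<open>\<mu> v = UVx\<close>. If \<open>x\<close> were a right singular vector,
  that is \<open>VUv = \<mu>x\<close>, then with \<open>s = \<langle>Uv,v\<rangle> + \<langle>Vx,x\<rangle>\<close>
    \<open>\<mu> s = Re \<langle>Uv, (U + V) Vx\<rangle> \<le> \<langle>(U + V)(Uv + Vx), Uv + Vx\<rangle> / 4 \<le> c\<^sup>2 s / 4\<close>
  by polarization and Cauchy--Schwarz. In general the error \<open>e = VUv - \<mu>x\<close> satisfies
  \<open>\<parallel>e\<parallel>\<^sup>2 \<le> \<mu>\<^sup>2\<parallel>x\<parallel>\<^sup>2 - \<parallel>UVx\<parallel>\<^sup>2\<close>, so \<open>\<mu> > c\<^sup>2/4\<close> would bound \<open>\<parallel>UVx\<parallel> / \<parallel>x\<parallel>\<close> away from its supremum \<open>\<mu>\<close>.\<close>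

lemma norm_mult_le_quarter:
  fixes U V :: "'a::complex_inner bop"
  assumes U: "0 \<le> U" and V: "0 \<le> V" and c: "0 \<le> c" and UV: "U + V \<le> c *\<^sub>R 1"
  shows "norm (U * V) \<le> c\<^sup>2 / 4"
proof (rule ccontr)
  define \<mu> where "\<mu> = norm (U * V)"
  define \<kappa> where "\<kappa> = \<mu> - c\<^sup>2 / 4"
  define D where "D = norm U * norm V"
  assume "\<not> norm (U * V) \<le> c\<^sup>2 / 4"
  then have \<kappa>: "0 < \<kappa>" by (simp add: \<kappa>_def \<mu>_def)
  then have \<mu>: "0 < \<mu>" by (simp add: \<kappa>_def) (smt (verit) zero_le_power2)
  have saU: "selfadj U" and saV: "selfadj V"
    using U V by (auto simp: bop_nonneg_iff)
  have N: "quad U z + quad V z \<le> c * (norm z)\<^sup>2" for z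
    using UV by (simp add: bop_le_iff quad_one)
  have key: "\<kappa>\<^sup>2 * (norm (op_apply (U * V) x))\<^sup>2 \<le> D\<^sup>2 * (\<mu>\<^sup>2 * (norm x)\<^sup>2 - (norm (op_apply (U * V) x))\<^sup>2)"
    for x
  proof -
    define v where "v = (1 / \<mu>) *\<^sub>R op_apply U (op_apply V x)"
    have v: "op_apply U (op_apply V x) = \<mu> *\<^sub>R v"
      using \<mu> by (simp add: v_def)
    define y1 y2 where "y1 = op_apply U v" and "y2 = op_apply V x"
    define e where "e = op_apply V y1 - \<mu> *\<^sub>R x"
    define s where "s = quad U v + quad V x"
    have nonneg: "0 \<le> quad U z" "0 \<le> quad V z" for z
      using U V by (auto simp: bop_nonneg_iff)
    have nUV: "norm (op_apply (U * V) x) = \<mu> * norm v"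
      using \<mu> by (simp add: bop_apply_simps v)
    \<comment> \<open>The adjoint \<open>VU\<close> has the same norm as \<open>UV\<close>.\<close>
    have nVU: "norm (op_apply V y1) \<le> \<mu> * norm v"
    proof (cases "op_apply V y1 = 0")
      case False
      let ?w = "op_apply V y1"
      have "(norm ?w)\<^sup>2 = Re (cinner ?w ?w)" by (simp add: cinner_self)
      also have "\<dots> = Re (cinner v (op_apply (U * V) ?w))"
        by (simp add: y1_def bop_apply_simps selfadjD [OF saU] selfadjD [OF saV])
      also have "\<dots> \<le> norm v * (\<mu> * norm ?w)"
        using Re_cinner_le [of v "op_apply (U * V) ?w"] norm_op_apply_le [of "U * V" ?w]
        by (smt (verit) \<mu>_def mult_left_mono norm_ge_zero)
      finally have "norm ?w * norm ?w \<le> (\<mu> * norm v) * norm ?w"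
        by (simp add: power2_eq_square algebra_simps)
      then show ?thesis using False by simp
    qed (use \<mu> in simp)
    have e: "(norm e)\<^sup>2 \<le> \<mu>\<^sup>2 * (norm x)\<^sup>2 - \<mu>\<^sup>2 * (norm v)\<^sup>2"
    proof -
      have "Re (cinner (op_apply V y1) x) = \<mu> * (norm v)\<^sup>2"
        by (simp add: y1_def selfadjD [OF saU] selfadjD [OF saV] v cinner_simps cinner_self)
      moreover have "Re (cinner x (op_apply V y1)) = Re (cinner (op_apply V y1) x)"
        by (rule Re_cinner_commute)
      moreover have "Re (cinner e e) = Re (cinner (op_apply V y1) (op_apply V y1))
          - \<mu> * Re (cinner (op_apply V y1) x) - \<mu> * Re (cinner x (op_apply V y1)) + \<mu>\<^sup>2 * Re (cinner x x)"
        unfolding e_def by (simp add: cinner_simps power2_eq_square algebra_simps)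
      ultimately have "(norm e)\<^sup>2 = (norm (op_apply V y1))\<^sup>2 - 2 * \<mu>\<^sup>2 * (norm v)\<^sup>2 + \<mu>\<^sup>2 * (norm x)\<^sup>2"
        by (simp add: cinner_self power2_eq_square)
      moreover have "(norm (op_apply V y1))\<^sup>2 \<le> \<mu>\<^sup>2 * (norm v)\<^sup>2"
        using power_mono [OF nVU, of 2] by (simp add: power_mult_distrib)
      ultimately show ?thesis by simp
    qed
    have ident: "Re (cinner y1 (op_apply (U + V) y2)) = \<mu> * s + Re (cinner e y2)"
    proof -
      have "Re (cinner y1 (op_apply U y2)) = \<mu> * quad U v"
        by (simp add: y1_def y2_def v cinner_simps quad_def)
      moreover have "Re (cinner y1 (op_apply V y2)) = \<mu> * quad V x + Re (cinner e y2)"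
      proof -
        have "Re (cinner y1 (op_apply V y2)) = Re (cinner (op_apply V y1) y2)"
          by (simp add: selfadjD [OF saV])
        also have "op_apply V y1 = \<mu> *\<^sub>R x + e" by (simp add: e_def)
        also have "Re (cinner (\<mu> *\<^sub>R x + e) y2) = \<mu> * Re (cinner y2 x) + Re (cinner e y2)"
          using Re_cinner_commute [of x y2] by (simp add: cinner_simps)
        finally show ?thesis by (simp add: quad_def y2_def)
      qed
      ultimately show ?thesis
        by (simp add: bop_apply_simps cinner_simps s_def distrib_left)
    qed
    have "4 * Re (cinner y1 (op_apply (U + V) y2))
        = quad (U + V) (y1 + y2) - quad (U + V) (y1 - y2)"
    proof -
      have "selfadj (U + V)" using saU saV by blast
      then have "Re (cinner (op_apply (U + V) y2) y1) = Re (cinner y1 (op_apply (U + V) y2))"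
        and "Re (cinner (op_apply (U + V) y1) y2) = Re (cinner y1 (op_apply (U + V) y2))"
        by - (rule Re_cinner_commute, simp only: selfadjD)
      then show ?thesis
        unfolding quad_def by (simp add: op_apply_add op_apply_diff cinner_simps)
    qed
    also have "\<dots> \<le> c * (norm (y1 + y2))\<^sup>2"
      using N [of "y1 + y2"] nonneg [of "y1 - y2"] by simp
    also have "\<dots> \<le> c * (c * s)"
    proof (rule mult_left_mono [OF _ c])
      let ?z = "y1 + y2"
      show "(norm ?z)\<^sup>2 \<le> c * s"
      proof (cases "?z = 0")
        case True
        then show ?thesis using nonneg c by (simp add: s_def)
      next
        case False
        define p q where "p = Re (cinner y1 ?z)" and "q = Re (cinner y2 ?z)"
        have p: "p\<^sup>2 \<le> quad U v * quad U ?z" and q: "q\<^sup>2 \<le> quad V x * quad V ?z"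
          unfolding p_def q_def y1_def y2_def
          by (rule positive_Cauchy_Schwarz_Re [OF U], rule positive_Cauchy_Schwarz_Re [OF V])
        have pq: "(norm ?z)\<^sup>2 = p + q"
        proof -
          have "(norm ?z)\<^sup>2 = Re (cinner ?z ?z)" by (simp only: cinner_self Re_complex_of_real)
          also have "\<dots> = p + q" by (simp only: p_def q_def cinner_add_left plus_complex.simps)
          finally show ?thesis .
        qed
        have "p * q \<le> sqrt (quad U v * quad U ?z) * sqrt (quad V x * quad V ?z)"
        proof -
          have "\<bar>p\<bar> \<le> sqrt (quad U v * quad U ?z)" "\<bar>q\<bar> \<le> sqrt (quad V x * quad V ?z)"
            using p q by (auto intro: real_le_rsqrt)
          then have "\<bar>p\<bar> * \<bar>q\<bar> \<le> sqrt (quad U v * quad U ?z) * sqrt (quad V x * quad V ?z)"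
            using nonneg by (intro mult_mono) auto
          then show ?thesis by (simp flip: abs_mult)
        qed
        also have "\<dots> = sqrt (quad U v * quad V ?z) * sqrt (quad V x * quad U ?z)"
          by (simp add: real_sqrt_mult)
        also have "2 * \<dots> \<le> quad U v * quad V ?z + quad V x * quad U ?z"
          using sum_squares_bound [of "sqrt (quad U v * quad V ?z)" "sqrt (quad V x * quad U ?z)"] nonneg
          by (simp add: mult.assoc)
        finally have "2 * (p * q) \<le> quad U v * quad V ?z + quad V x * quad U ?z" by simp
        then have "(p + q)\<^sup>2 \<le> s * (quad U ?z + quad V ?z)"
          using p q by (simp add: power2_sum s_def algebra_simps)
        also have "\<dots> \<le> s * (c * (norm ?z)\<^sup>2)"
          using N nonneg by (intro mult_left_mono) (auto simp: s_def)
        finally have "(norm ?z)\<^sup>2 * (norm ?z)\<^sup>2 \<le> (c * s) * (norm ?z)\<^sup>2"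
          unfolding pq [symmetric] by (simp add: power2_eq_square algebra_simps)
        then show ?thesis
          by (rule mult_right_le_imp_le) (use False in simp)
      qed
    qed
    finally have "\<kappa> * s \<le> - Re (cinner e y2)"
      unfolding ident by (simp add: \<kappa>_def power2_eq_square algebra_simps)
    also have "\<dots> \<le> norm e * norm y2"
      using Re_cinner_le [of "- e" y2] by simp
    finally have 1: "\<kappa> * s \<le> norm e * norm y2" .
    have "(norm y2)\<^sup>2 \<le> norm V * s"
      using positive_mult_self_le [OF V, of x] nonneg
      by (smt (verit) mult_left_mono norm_ge_zero s_def y2_def)
    then have "\<kappa> * (norm y2)\<^sup>2 \<le> norm V * (\<kappa> * s)"
      using \<kappa> by (metis less_imp_le mult.left_commute mult_left_mono)
    also have "\<dots> \<le> norm V * (norm e * norm y2)"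
      using 1 by (intro mult_left_mono) auto
    finally have "(\<kappa> * norm y2) * norm y2 \<le> (norm V * norm e) * norm y2"
      by (simp add: power2_eq_square algebra_simps)
    then have 2: "\<kappa> * norm y2 \<le> norm V * norm e"
      by (cases "norm y2 = 0") auto
    have "\<kappa> * norm (op_apply (U * V) x) \<le> \<kappa> * (norm U * norm y2)"
      using \<kappa> norm_op_apply_le [of U y2] by (simp add: bop_apply_simps y2_def)
    also have "\<dots> \<le> norm U * (norm V * norm e)"
      using mult_left_mono [OF 2, of "norm U"] by (simp add: algebra_simps)
    finally have "\<kappa> * norm (op_apply (U * V) x) \<le> D * norm e"
      by (simp add: D_def)
    then have "(\<kappa> * norm (op_apply (U * V) x))\<^sup>2 \<le> (D * norm e)\<^sup>2"
      using \<kappa> by (intro power_mono) auto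
    also have "\<dots> \<le> D\<^sup>2 * (\<mu>\<^sup>2 * (norm x)\<^sup>2 - \<mu>\<^sup>2 * (norm v)\<^sup>2)"
      unfolding power_mult_distrib by (intro mult_left_mono e) auto
    finally show ?thesis
      by (simp add: nUV power_mult_distrib)
  qed
  define \<rho> where "\<rho> = D\<^sup>2 / (\<kappa>\<^sup>2 + D\<^sup>2)"
  have pos: "0 < \<kappa>\<^sup>2 + D\<^sup>2" using \<kappa> by (simp add: add_pos_nonneg)
  have \<rho>: "0 \<le> \<rho>" "\<rho> < 1"
    using \<kappa> pos by (auto simp: \<rho>_def)
  have "norm (U * V) \<le> sqrt \<rho> * \<mu>"
  proof (rule norm_bop_le)
    fix x
    have "(norm (op_apply (U * V) x))\<^sup>2 * (\<kappa>\<^sup>2 + D\<^sup>2) \<le> D\<^sup>2 * (\<mu>\<^sup>2 * (norm x)\<^sup>2)"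
      using key [of x] by (simp add: algebra_simps)
    then have "(norm (op_apply (U * V) x))\<^sup>2 \<le> \<rho> * (\<mu>\<^sup>2 * (norm x)\<^sup>2)"
      using pos by (simp add: \<rho>_def field_simps)
    also have "\<dots> = (sqrt \<rho> * \<mu> * norm x)\<^sup>2"
      using \<rho> by (simp add: power_mult_distrib)
    finally show "norm (op_apply (U * V) x) \<le> sqrt \<rho> * \<mu> * norm x"
      by (rule power2_le_imp_le) (use \<rho> \<mu> in simp)
  qed (use \<rho> \<mu> in simp)
  moreover have "sqrt \<rho> < 1" using \<rho> by (simp add: real_sqrt_lt_1_iff)
  ultimately show False
    using \<mu> by (simp add: \<mu>_def [symmetric])
qed

lemma product_square_le:
  fixes U V :: "'a::complex_inner bop"
  assumes "0 \<le> U" "0 \<le> V" "0 \<le> c" "U + V \<le> c *\<^sub>R 1"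
  shows "V * (U * U) * V \<le> (c ^ 4 / 16) *\<^sub>R 1"
proof -
  have sa: "selfadj U" "selfadj V" using assms by (auto simp: bop_nonneg_iff)
  have saUU: "selfadj (U * U)" using sa by (intro selfadj_mult_commute) auto
  have "quad (V * (U * U) * V) x \<le> c ^ 4 / 16 * (norm x)\<^sup>2" for x
  proof -
    have "quad (V * (U * U) * V) x = (norm (op_apply (U * V) x))\<^sup>2"
      unfolding quad_def
      by (simp add: bop_apply_simps selfadjD [OF sa(2)])
        (simp add: selfadjD [OF sa(1)] cinner_self flip: selfadjD [OF sa(1), of "op_apply U _"] )
    also have "\<dots> \<le> (c\<^sup>2 / 4 * norm x)\<^sup>2"
      using order_trans [OF norm_op_apply_le mult_right_mono [OF norm_mult_le_quarter [OF assms]]]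
      by (intro power_mono) auto
    finally show ?thesis
      by (simp add: power_mult_distrib power_divide flip: power_mult)
  qed
  then show ?thesis
    using sa saUU by (simp add: le_scale_one_iff_quad selfadj_congruence)
qed

section \<open>Order properties of powers\<close>

lemma op_powr_le:
  fixes T :: "'a::complex_hilbert_space bop"
  assumes "spos T" "T \<le> c *\<^sub>R 1" "0 \<le> s" "0 < c"
  shows "op_powr T s \<le> (c powr s) *\<^sub>R 1"
proof -
  obtain a b where ab: "0 < a" "a \<le> b" "op_between a b T" using spos_between [OF assms(1)] .
  have "op_between (min a c) c T"
    using ab(3) assms(2) scaleR_one_mono [of "min a c" a] order_trans
    by (fastforce simp: op_between_def)
  then show ?thesis
    using op_powr_between [of "min a c" c T s] assms ab(1) by (auto simp: op_between_def)
qed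

lemma op_powr_of_nat:
  fixes T :: "'a::complex_hilbert_space bop"
  assumes "spos T"
  shows "op_powr T (real n) = T ^ n"
proof (induction n)
  case (Suc n)
  have "op_powr T (real (Suc n)) = op_powr T 1 * op_powr T (real n)"
    using assms by (simp add: op_powr_mult)
  then show ?case using assms by (simp add: Suc op_powr_1)
qed (simp add: assms op_powr_0)

lemma spos_congruence_powr:
  fixes S T :: "'a::complex_hilbert_space bop"
  assumes S: "spos S" and T: "spos T"
  shows "spos (op_powr S s * T * op_powr S s)"
proof -
  obtain c where c: "0 < c" "c *\<^sub>R 1 \<le> T" using T by (auto simp: spos_def)
  have "c *\<^sub>R op_powr S (s + s) \<le> op_powr S s * T * op_powr S s"
    using congruence_mono [OF op_powr_selfadj [OF S, of s] c(2)] by (simp add: op_powr_mult [OF S])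
  then show ?thesis
    using spos_le spos_scale [OF op_powr_spos [OF S] c(1)] by blast
qed

text \<open>Stated for right-associated products, so that the simplifier can cancel inside longer ones.\<close>

lemma op_powr_cancel:
  fixes T :: "'a::complex_hilbert_space bop"
  assumes "spos T"
  shows "op_powr T s * (op_powr T (- s) * X) = X" "op_powr T (- s) * (op_powr T s * X) = X"
  using op_powr_inverse [OF assms, of s] by (metis mult.assoc mult_1_left)+

text \<open>After congruence with \<open>F\<^bsup>-1/2\<^esup>\<close> the claim is that \<open>R \<le> 1\<close> implies \<open>R\<^bsup>-1\<^esup> \<ge> 1\<close>, which the functional
  calculus of the single operator \<open>R\<close> gives.\<close>

lemma inverse_antimono:
  fixes E F :: "'a::complex_hilbert_space bop"
  assumes E: "spos E" and EF: "E \<le> F"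
  shows "op_powr F (- 1) \<le> op_powr E (- 1)"
proof -
  have F: "spos F" using E EF by (rule spos_le)
  define R where "R = op_powr F (- (1/2)) * E * op_powr F (- (1/2))"
  have "R \<le> op_powr F (- (1/2)) * F * op_powr F (- (1/2))"
    unfolding R_def by (rule congruence_mono [OF op_powr_selfadj [OF F] EF])
  also have "\<dots> = op_powr F (- (1/2)) * op_powr F 1 * op_powr F (- (1/2))"
    by (simp add: op_powr_1 [OF F])
  also have "\<dots> = 1" by (simp add: op_powr_mult [OF F] op_powr_0 [OF F])
  finally have R1: "R \<le> 1" .
  have R: "spos R" unfolding R_def by (rule spos_congruence_powr [OF F E])
  obtain a b where ab: "0 < a" "a \<le> b" "op_between a b R" using spos_between [OF R] .
  have "op_between (min a 1) 1 R"
    using ab(3) R1 scaleR_one_mono [of "min a 1" a] order_trans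
    by (fastforce simp: op_between_def)
  then have 1: "1 \<le> op_powr R (- 1)"
    using op_powr_between_neg [of "min a 1" 1 R "- 1"] ab(1) by (simp add: op_between_def)
  have Ei: "op_powr E (- 1) * (E * X) = X" for X
    using op_powr_cancel(2) [OF E, of 1 X] by (simp add: op_powr_1 [OF E])
  have "op_powr R (- 1) = op_powr F (1/2) * op_powr E (- 1) * op_powr F (1/2)"
    by (rule op_powr_minus_1_unique [OF R])
      (use op_powr_cancel [OF F, of "1/2"] op_powr_inverse [OF F, of "1/2"] in
        \<open>simp add: R_def mult.assoc Ei\<close>)
  then have "op_powr F (- (1/2)) * 1 * op_powr F (- (1/2))
      \<le> op_powr F (- (1/2)) * (op_powr F (1/2) * op_powr E (- 1) * op_powr F (1/2)) * op_powr F (- (1/2))"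
    using congruence_mono [OF op_powr_selfadj [OF F] 1] by simp
  then show ?thesis
    using op_powr_cancel [OF F, of "1/2"] op_powr_inverse [OF F, of "1/2"]
    by (simp add: mult.assoc op_powr_mult [OF F])
qed

text \<open>With \<open>R = F\<^bsup>-1/2\<^esup> E F\<^bsup>-1/2\<^esup>\<close> the hypothesis says \<open>R F R \<le> F\<close>. Iterating gives \<open>R\<^sup>n F R\<^sup>n \<le> F\<close>, so the
  powers of \<open>R\<close> stay bounded, which forces \<open>R \<le> 1\<close>.\<close>

lemma square_root_mono:
  fixes E F :: "'a::complex_hilbert_space bop"
  assumes E: "spos E" and F: "spos F" and EF: "E * E \<le> F * F"
  shows "E \<le> F"
proof -
  define R where "R = op_powr F (- (1/2)) * E * op_powr F (- (1/2))"
  have R: "spos R" unfolding R_def by (rule spos_congruence_powr [OF F E])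
  have FF: "op_powr F (1/2) * op_powr F (1/2) = F" "op_powr F 1 = F"
    by (simp_all add: op_powr_mult [OF F] op_powr_1 [OF F])
  have c: "op_powr F (1/2) * (op_powr F (- (1/2)) * X) = X" "op_powr F (- (1/2)) * (op_powr F (1/2) * X) = X" 
    "op_powr F (1/2) * op_powr F (- (1/2)) = 1" "op_powr F (- (1/2)) * op_powr F (1/2) = 1" for X
    using op_powr_cancel [OF F, of "1/2"] op_powr_inverse [OF F, of "1/2"] by simp_all
  have ER: "E = op_powr F (1/2) * R * op_powr F (1/2)"
    by (simp add: R_def mult.assoc c)
  have RFR: "R * F * R \<le> F"
  proof -
    have "op_powr F (- (1/2)) * (E * E) * op_powr F (- (1/2))
        \<le> op_powr F (- (1/2)) * (F * F) * op_powr F (- (1/2))"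
      by (rule congruence_mono [OF op_powr_selfadj [OF F] EF])
    also have "op_powr F (- (1/2)) * (F * F) * op_powr F (- (1/2)) = F"
      by (simp add: op_powr_2 [OF F, symmetric] op_powr_mult [OF F] FF)
    also have "op_powr F (- (1/2)) * (E * E) * op_powr F (- (1/2)) = R * F * R"
    proof -
      have "E * E = op_powr F (1/2) * (R * (op_powr F (1/2) * op_powr F (1/2)) * R) * op_powr F (1/2)"
        by (subst (1 2) ER) (simp only: mult.assoc)
      then show ?thesis by (simp add: FF mult.assoc c)
    qed
    finally show ?thesis .
  qed
  have iter: "R ^ n * F * R ^ n \<le> F" for n
  proof (induction n)
    case (Suc n)
    have "R ^ Suc n * F * R ^ Suc n = R * (R ^ n * F * R ^ n) * R"
      by (simp add: mult.assoc power_commutes)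
    also have "\<dots> \<le> R * F * R"
      by (rule congruence_mono [OF spos_selfadj [OF R] Suc])
    finally show ?case using RFR by simp
  qed simp
  obtain a b where ab: "0 < a" "a \<le> b" "op_between a b F" using spos_between [OF F] .
  define k where "k = b / a"
  have k: "0 < k" using ab by (simp add: k_def)
  have "R \<le> (k powr (1 / real (2 * Suc n))) *\<^sub>R 1" for n
  proof -
    let ?n = "Suc n"
    have "R ^ ?n * (a *\<^sub>R 1) * R ^ ?n \<le> R ^ ?n * F * R ^ ?n"
      using ab(3) by (intro congruence_mono selfadj_power spos_selfadj [OF R]) (simp add: op_between_def)
    also have "\<dots> \<le> F" by (rule iter)
    also have "\<dots> \<le> b *\<^sub>R 1" using ab(3) by (simp add: op_between_def)
    finally have "a *\<^sub>R R ^ (?n + ?n) \<le> b *\<^sub>R 1"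
      by (simp only: power_add mult_scaleR_right mult_scaleR_left mult_1_right)
    from scaleR_left_mono [OF this, of "1 / a"] have "R ^ (?n + ?n) \<le> k *\<^sub>R 1"
      using ab by (simp add: k_def)
    then have "op_powr R (real (2 * ?n)) \<le> k *\<^sub>R 1"
      by (simp only: op_powr_of_nat [OF R] mult_2)
    then have "op_powr (op_powr R (real (2 * ?n))) (1 / real (2 * ?n)) \<le> (k powr (1 / real (2 * ?n))) *\<^sub>R 1"
      using k by (intro op_powr_le op_powr_spos R) auto
    then show ?thesis
      unfolding op_powr_powr [OF R] by (simp add: op_powr_1 [OF R] del: of_nat_Suc)
  qed
  then have "0 \<le> (k powr (1 / real (2 * Suc n))) *\<^sub>R 1 - R" for n by simp
  moreover have "(\<lambda>n. (k powr (1 / real (2 * Suc n))) *\<^sub>R 1 - R) \<longlonglongrightarrow> (k powr 0) *\<^sub>R 1 - R"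
  proof (intro tendsto_intros)
    have "(\<lambda>n. 1 / 2 * inverse (real (Suc n))) \<longlonglongrightarrow> 1 / 2 * 0"
      by (intro tendsto_mult tendsto_const LIMSEQ_inverse_real_of_nat)
    then show "(\<lambda>n. 1 / real (2 * Suc n)) \<longlonglongrightarrow> 0"
      by (simp add: field_simps)
  qed (use k in auto)
  ultimately have "0 \<le> (k powr 0) *\<^sub>R 1 - R" by (rule nonneg_limit [rotated])
  then have "R \<le> 1" using k by simp
  from congruence_mono [OF op_powr_selfadj [OF F, of "1/2"] this]
  show ?thesis by (simp add: ER [symmetric] FF)
qed

text \<open>\<open>(t - a)(b - t) \<ge> 0\<close> on \<open>[a, b]\<close>.\<close>

lemma square_le_chord:
  fixes Q :: "'a::complex_hilbert_space bop"
  assumes Q: "op_between a b Q"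
  shows "Q * Q \<le> (a + b) *\<^sub>R Q - (a * b) *\<^sub>R 1"
proof -
  have "fun_calc (\<lambda>t. t * t) Q \<le> fun_calc (\<lambda>t. (a + b) * t - a * b) Q"
  proof (rule fun_calc_mono [OF Q])
    fix t assume "t \<in> {a..b}"
    then have "0 \<le> (t - a) * (b - t)" by simp
    then show "t * t \<le> (a + b) * t - a * b" by (simp add: algebra_simps)
  qed (intro continuous_intros)+
  then show ?thesis
    by (simp add: fun_calc_mult [OF Q] fun_calc_diff [OF Q] fun_calc_scale [OF Q] fun_calc_id [OF Q]
        fun_calc_const [OF Q] continuous_intros)
qed

text \<open>Squaring is not monotone; the Kantorovich constant of the spectral interval of the smaller
  operator measures the loss. On \<open>[a, b]\<close> the parabola \<open>t\<^sup>2\<close> lies below its chord, and the chord is a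
  tangent of the larger parabola \<open>K t\<^sup>2\<close>; \<open>R\<close> may replace \<open>Q\<close> in the chord, which is increasing.\<close>

lemma square_mono_kantorovich:
  fixes Q R :: "'a::complex_hilbert_space bop"
  assumes a: "0 < a" "a \<le> b" and Q: "op_between a b Q" and QR: "Q \<le> R"
  shows "Q * Q \<le> kantorovich (b / a) *\<^sub>R (R * R)"
proof -
  have R: "selfadj R"
    using op_between_selfadj [OF Q] QR by (rule bop_le_transfer(1))
  define \<alpha> where "\<alpha> = sqrt (a * b)"
  define \<beta> where "\<beta> = (a + b) / (2 * \<alpha>)"
  have \<alpha>: "0 < \<alpha>" "\<alpha> * \<alpha> = a * b" using a by (auto simp: \<alpha>_def)
  have \<beta>: "2 * (\<alpha> * \<beta>) = a + b" using \<alpha> by (simp add: \<beta>_def)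
  have "\<beta> * \<beta> = (a + b)\<^sup>2 / (4 * (\<alpha> * \<alpha>))"
    by (simp add: \<beta>_def power2_eq_square field_simps)
  also have "\<dots> = kantorovich (b / a)"
    using a by (simp add: \<alpha>(2) kantorovich_def power2_eq_square field_simps)
  finally have \<beta>2: "\<beta> * \<beta> = kantorovich (b / a)" .
  have "0 \<le> (\<alpha> *\<^sub>R 1 - \<beta> *\<^sub>R R) * (\<alpha> *\<^sub>R 1 - \<beta> *\<^sub>R R)"
    by (intro square_nonneg) (use R in auto)
  also have "\<dots> = (a * b) *\<^sub>R 1 - (a + b) *\<^sub>R R + kantorovich (b / a) *\<^sub>R (R * R)"
  proof -
    have "(\<alpha> *\<^sub>R 1 - \<beta> *\<^sub>R R) * (\<alpha> *\<^sub>R 1 - \<beta> *\<^sub>R R)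
        = (\<alpha> * \<alpha>) *\<^sub>R 1 - ((\<alpha> * \<beta>) *\<^sub>R R + (\<alpha> * \<beta>) *\<^sub>R R) + (\<beta> * \<beta>) *\<^sub>R (R * R)"
      by (simp add: algebra_simps)
    then show ?thesis
      by (simp only: \<alpha>(2) \<beta> [symmetric] \<beta>2 mult_2 scaleR_add_left)
  qed
  finally have "(a + b) *\<^sub>R R - (a * b) *\<^sub>R 1 \<le> kantorovich (b / a) *\<^sub>R (R * R)"
    by (simp add: algebra_simps)
  moreover have "(a + b) *\<^sub>R Q - (a * b) *\<^sub>R 1 \<le> (a + b) *\<^sub>R R - (a * b) *\<^sub>R 1"
    using QR a by (intro diff_right_mono scaleR_left_mono) auto
  ultimately show ?thesis
    using square_le_chord [OF Q] by (meson order_trans)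
qed

text \<open>On \<open>(0, \<surd>L]\<close> the quotient \<open>t\<^sup>s / t\<^sup>2\<close> is increasing and ends at \<open>L\<^bsup>s/2-1\<^esup>\<close>.\<close>

lemma op_powr_le_square:
  fixes P :: "'a::complex_hilbert_space bop"
  assumes m: "0 < m" and P: "op_between m M P" and L: "M\<^sup>2 \<le> L" and s: "2 \<le> s"
  shows "op_powr P s \<le> (L powr (s / 2 - 1)) *\<^sub>R (P * P)"
proof -
  have "fun_calc (\<lambda>t. t powr s) P \<le> fun_calc (\<lambda>t. L powr (s / 2 - 1) * (t * t)) P"
  proof (rule fun_calc_mono [OF P continuous_on_powr_pos [OF m]])
    fix t assume t: "t \<in> {m..M}"
    then have t0: "0 < t" using m by simp
    have "t\<^sup>2 \<le> M\<^sup>2" using t t0 by (intro power_mono) auto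
    then have "t\<^sup>2 \<le> L" using L by simp
    have "t powr s = t powr (2 * (s / 2 - 1)) * t powr 2"
      by (simp flip: powr_add)
    also have "t powr (2 * (s / 2 - 1)) = (t powr 2) powr (s / 2 - 1)"
      by (simp only: powr_powr)
    also have "t powr 2 = t\<^sup>2"
      using t0 by simp
    also have "(t\<^sup>2) powr (s / 2 - 1) * t\<^sup>2 = (t\<^sup>2) powr (s / 2 - 1) * (t * t)"
      by (simp add: power2_eq_square)
    also have "\<dots> \<le> L powr (s / 2 - 1) * (t * t)"
      using t0 s \<open>t\<^sup>2 \<le> L\<close> by (intro mult_right_mono powr_mono2) auto
    finally show "t powr s \<le> L powr (s / 2 - 1) * (t * t)" .
  qed (intro continuous_intros)
  then show ?thesis
    by (simp add: op_powr_fun_calc fun_calc_scale [OF P] fun_calc_mult [OF P] fun_calc_id [OF P] continuous_intros)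
qed

text \<open>Put \<open>U = P\<^bsup>p/2\<^esup>\<close> and \<open>V = Q\<^bsup>p/2\<^esup>\<close>. Since \<open>p/2 \<ge> 2\<close>, comparison with squares gives \<open>U + V \<le> L\<^bsup>p/4\<^esup>\<close>, hence
  \<open>\<parallel>UV\<parallel> \<le> L\<^bsup>p/2\<^esup>/4\<close>, that is \<open>V U\<^sup>2 V \<le> L\<^sup>p/16\<close>; it remains to remove \<open>V\<close> on both sides.\<close>

lemma op_powr_le_of_sum_squares:
  fixes P Q :: "'a::complex_hilbert_space bop"
  assumes m: "0 < m" and P: "op_between m M P" and Q: "op_between m M Q"
    and L: "0 < L" "M\<^sup>2 \<le> L" and PQ: "P * P + Q * Q \<le> L *\<^sub>R 1" and p: "4 \<le> p"
  shows "op_powr P p \<le> (L powr p / 16) *\<^sub>R op_powr Q (- p)"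
proof -
  have sp: "spos P" "spos Q" using op_between_spos m P Q by blast+
  define U V where "U = op_powr P (p / 2)" and "V = op_powr Q (p / 2)"
  define c where "c = L powr (p / 4)"
  have "U + V \<le> (L powr (p / 4 - 1)) *\<^sub>R (P * P + Q * Q)"
    using op_powr_le_square [OF m P L(2), of "p / 2"] op_powr_le_square [OF m Q L(2), of "p / 2"] p
    by (simp add: U_def V_def scaleR_add_right add_mono)
  also have "\<dots> \<le> (L powr (p / 4 - 1)) *\<^sub>R (L *\<^sub>R 1)"
    by (intro scaleR_left_mono PQ) simp
  also have "\<dots> = c *\<^sub>R 1"
    using L(1) by (simp add: c_def powr_diff)
  finally have "V * (U * U) * V \<le> (c ^ 4 / 16) *\<^sub>R 1"
    by (intro product_square_le) (auto simp: U_def V_def c_def intro!: spos_nonneg op_powr_spos sp)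
  also have "c ^ 4 = L powr p"
    using L(1) by (simp add: c_def powr_power)
  also have "U * U = op_powr P p" by (simp add: U_def op_powr_mult [OF sp(1)])
  finally have "op_powr Q (- (p / 2)) * (V * op_powr P p * V) * op_powr Q (- (p / 2))
      \<le> op_powr Q (- (p / 2)) * ((L powr p / 16) *\<^sub>R 1) * op_powr Q (- (p / 2))"
    by (rule congruence_mono [OF op_powr_selfadj [OF sp(2)]])
  then show ?thesis
    using op_powr_inverse [OF sp(2), of "p / 2"] 
    by (simp add: V_def mult.assoc op_powr_cancel [OF sp(2)] op_powr_mult [OF sp(2)])
qed

section \<open>Unital positive linear maps\<close>

definition unital_positive :: "('a::complex_inner bop \<Rightarrow> 'b::complex_inner bop) \<Rightarrow> bool"
  where "unital_positive \<Phi> \<longleftrightarrow> linear \<Phi> \<and> (\<forall>X. 0 \<le> X \<longrightarrow> 0 \<le> \<Phi> X) \<and> \<Phi> 1 = 1"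

lemma unital_positiveD:
  assumes "unital_positive \<Phi>"
  shows "linear \<Phi>" "0 \<le> X \<Longrightarrow> 0 \<le> \<Phi> X" "\<Phi> 1 = 1"
    "\<Phi> (X + Y) = \<Phi> X + \<Phi> Y" "\<Phi> (X - Y) = \<Phi> X - \<Phi> Y" "\<Phi> (c *\<^sub>R X) = c *\<^sub>R \<Phi> X" "\<Phi> 0 = 0"
  using assms by (auto simp: unital_positive_def linear_add linear_diff linear_scale linear_0)

lemma unital_positive_mono: "unital_positive \<Phi> \<Longrightarrow> X \<le> Y \<Longrightarrow> \<Phi> X \<le> \<Phi> Y"
  using unital_positiveD(2) [of \<Phi> "Y - X"] by (simp add: unital_positiveD(5))

lemma unital_positive_between: "unital_positive \<Phi> \<Longrightarrow> op_between a b X \<Longrightarrow> op_between a b (\<Phi> X)"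
  using unital_positive_mono [of \<Phi> "a *\<^sub>R 1" X] unital_positive_mono [of \<Phi> X "b *\<^sub>R 1"]
  by (simp add: op_between_def unital_positiveD)

lemma unital_positive_spos: "unital_positive \<Phi> \<Longrightarrow> spos X \<Longrightarrow> spos (\<Phi> X)"
  using unital_positive_mono [of \<Phi> "_ *\<^sub>R 1" X] by (auto simp: spos_def unital_positiveD(3,6))

lemma fun_calc_sum:
  fixes T :: "'a::complex_hilbert_space bop"
  assumes T: "op_between a b T" and f: "\<And>i. i \<in> I \<Longrightarrow> continuous_on {a..b} (f i)" and "finite I"
  shows "fun_calc (\<lambda>t. \<Sum>i\<in>I. f i t) T = (\<Sum>i\<in>I. fun_calc (f i) T)"
  using assms(3) f
proof (induction I rule: finite_induct)
  case empty
  then show ?case by (simp add: fun_calc_const [OF T])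
next
  case (insert i I)
  then show ?case
    by (simp add: fun_calc_add [OF T] continuous_on_sum)
qed

text \<open>Kadison's inequality. The Bernstein polynomials of \<open>Z\<close> are positive operators \<open>F\<^sub>k\<close> with
  \<open>\<Sum> F\<^sub>k = 1\<close>, \<open>\<Sum> (k/n) F\<^sub>k = Z\<close> and \<open>\<Sum> (k/n)\<^sup>2 F\<^sub>k = Z\<^sup>2 + (Z - Z\<^sup>2)/n\<close>; they replace the spectral
  resolution of \<open>Z\<close>. Expanding \<open>\<Sum> (k/n - \<Phi> Z) \<Phi> F\<^sub>k (k/n - \<Phi> Z) \<ge> 0\<close> gives the claim up to \<open>1/n\<close>.\<close>

lemma Kadison_unit_interval:
  fixes Z :: "'a::complex_hilbert_space bop" and \<Phi> :: "'a bop \<Rightarrow> 'b::complex_hilbert_space bop"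
  assumes \<Phi>: "unital_positive \<Phi>" and Z: "op_between 0 1 Z"
  shows "\<Phi> Z * \<Phi> Z \<le> \<Phi> (Z * Z)"
proof -
  define T where "T = \<Phi> Z"
  have "0 \<le> Z" using Z by (simp add: op_between_def)
  then have T: "selfadj T" unfolding T_def by (intro selfadj_nonneg unital_positiveD(2) [OF \<Phi>])
  have step: "0 \<le> \<Phi> (Z * Z) + (1 / real (Suc n)) *\<^sub>R \<Phi> (Z - Z * Z) - T * T" for n
  proof -
    define N where "N = Suc n"
    have N: "0 < real N" by (simp add: N_def)
    define F where "F k = fun_calc (Bernstein N k) Z" for k
    have cont: "continuous_on {0..1} (Bernstein N k)" for k
      unfolding Bernstein_def by (intro continuous_intros)
    have mom: "(\<Sum>k\<le>N. c k *\<^sub>R F k) = fun_calc (\<lambda>t. \<Sum>k\<le>N. c k * Bernstein N k t) Z" for c :: "nat \<Rightarrow> real"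
      by (simp add: F_def fun_calc_sum [OF Z] fun_calc_scale [OF Z] cont continuous_on_mult_left)
    have m0: "(\<Sum>k\<le>N. F k) = 1"
      using mom [of "\<lambda>k. 1"] by (simp add: fun_calc_const [OF Z])
    have m1: "(\<Sum>k\<le>N. (real k / real N) *\<^sub>R F k) = Z"
    proof -
      have "(\<lambda>t. \<Sum>k\<le>N. real k / real N * Bernstein N k t) = (\<lambda>t. t)"
        using N sum_k_Bernstein [of N] by (simp add: sum_divide_distrib [symmetric])
      then show ?thesis by (simp add: mom fun_calc_id [OF Z])
    qed
    have m2: "(\<Sum>k\<le>N. (real k / real N)\<^sup>2 *\<^sub>R F k) = Z * Z + (1 / real N) *\<^sub>R (Z - Z * Z)"
    proof -
      have "(\<Sum>k\<le>N. (real k / real N)\<^sup>2 * Bernstein N k t) = t * t + 1 / real N * (t - t * t)" for t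
      proof -
        have "(\<Sum>k\<le>N. (real k)\<^sup>2 * Bernstein N k t)
            = (\<Sum>k\<le>N. real k * (real k - 1) * Bernstein N k t) + (\<Sum>k\<le>N. real k * Bernstein N k t)"
          unfolding sum.distrib [symmetric]
          by (rule sum.cong) (simp_all add: power2_eq_square algebra_simps)
        also have "\<dots> = real N * (real N - 1) * t\<^sup>2 + real N * t"
          by (simp only: sum_kk_Bernstein sum_k_Bernstein)
        finally show ?thesis
          using N by (simp add: power_divide sum_divide_distrib [symmetric]) (simp add: field_simps power2_eq_square)
      qed
      then show ?thesis
        by (simp add: mom fun_calc_add [OF Z] fun_calc_scale [OF Z, of "\<lambda>t. t - t * t"] fun_calc_mult [OF Z] fun_calc_diff [OF Z] fun_calc_id [OF Z]
            continuous_intros del: times_divide_eq_left times_divide_eq_right)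
    qed
    have \<Phi>sum: "\<Phi> (\<Sum>k\<le>N. c k *\<^sub>R F k) = (\<Sum>k\<le>N. c k *\<^sub>R \<Phi> (F k))" for c :: "nat \<Rightarrow> real"
      by (simp add: linear_sum [OF unital_positiveD(1) [OF \<Phi>]] unital_positiveD [OF \<Phi>])
    have F: "0 \<le> \<Phi> (F k)" if "k \<le> N" for k
    proof -
      have "fun_calc (\<lambda>t. 0) Z \<le> F k"
        unfolding F_def by (intro fun_calc_mono [OF Z] cont Bernstein_nonneg) auto
      then show ?thesis
        by (simp add: fun_calc_const [OF Z] unital_positiveD [OF \<Phi>])
    qed
    have "0 \<le> (\<Sum>k\<le>N. ((real k / real N) *\<^sub>R 1 - T) * \<Phi> (F k) * ((real k / real N) *\<^sub>R 1 - T))"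
      using T F by (intro sum_nonneg congruence_nonneg) auto
    also have "\<dots> = (\<Sum>k\<le>N. (real k / real N)\<^sup>2 *\<^sub>R \<Phi> (F k)) - T * (\<Sum>k\<le>N. (real k / real N) *\<^sub>R \<Phi> (F k))
        - (\<Sum>k\<le>N. (real k / real N) *\<^sub>R \<Phi> (F k)) * T + T * (\<Sum>k\<le>N. 1 *\<^sub>R \<Phi> (F k)) * T"
      by (simp add: sum_distrib_left sum_distrib_right sum_subtractf [symmetric] sum.distrib [symmetric]
          left_diff_distrib right_diff_distrib power2_eq_square mult.assoc scaleR_diff_right diff_diff_eq2 
          del: times_divide_eq_left times_divide_eq_right times_divide_times_eq) (simp add: algebra_simps)
    also have "\<dots> = \<Phi> (Z * Z) + (1 / real N) *\<^sub>R \<Phi> (Z - Z * Z) - T * T"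
      unfolding \<Phi>sum [symmetric] m1 m2 
      by (simp add: m0 unital_positiveD [OF \<Phi>] T_def [symmetric])
    finally show ?thesis unfolding N_def .
  qed
  have "(\<lambda>n. \<Phi> (Z * Z) + inverse (real (Suc n)) *\<^sub>R \<Phi> (Z - Z * Z) - T * T)
      \<longlonglongrightarrow> \<Phi> (Z * Z) + 0 *\<^sub>R \<Phi> (Z - Z * Z) - T * T"
    by (intro tendsto_intros LIMSEQ_inverse_real_of_nat)
  then have "0 \<le> \<Phi> (Z * Z) + 0 *\<^sub>R \<Phi> (Z - Z * Z) - T * T"
    by (rule nonneg_limit) (use step in \<open>simp add: inverse_eq_divide\<close>)
  then show ?thesis by (simp add: T_def)
qed

lemma Kadison:
  fixes Z :: "'a::complex_hilbert_space bop" and \<Phi> :: "'a bop \<Rightarrow> 'b::complex_hilbert_space bop"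
  assumes \<Phi>: "unital_positive \<Phi>" and Z: "0 \<le> Z"
  shows "\<Phi> Z * \<Phi> Z \<le> \<Phi> (Z * Z)"
proof -
  define c where "c = norm Z + 1"
  have c: "0 < c" by (simp add: c_def add_nonneg_pos)
  have "Z \<le> c *\<^sub>R 1"
    using nonneg_norm_le_iff [OF Z, of c] c by (simp add: c_def)
  then have "(1 / c) *\<^sub>R Z \<le> (1 / c) *\<^sub>R c *\<^sub>R 1"
    using c by (intro scaleR_left_mono) auto
  then have "op_between 0 1 ((1 / c) *\<^sub>R Z)"
    using c Z by (simp add: op_between_def scaleR_nonneg_nonneg)
  from Kadison_unit_interval [OF \<Phi> this]
  have "(1 / c * (1 / c)) *\<^sub>R (\<Phi> Z * \<Phi> Z) \<le> (1 / c * (1 / c)) *\<^sub>R \<Phi> (Z * Z)"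
    by (simp add: unital_positiveD [OF \<Phi>])
  from scaleR_left_mono [OF this, of "c * c"] show ?thesis
    using c by simp
qed

text \<open>The Schwarz inequality for positive maps is Kadison's inequality for the unital map
  \<open>X \<mapsto> \<Phi>(H)\<^bsup>-1/2\<^esup> \<Phi>(H\<^bsup>1/2\<^esup> X H\<^bsup>1/2\<^esup>) \<Phi>(H)\<^bsup>-1/2\<^esup>\<close> at \<open>Z = H\<^bsup>-1/2\<^esup> Y H\<^bsup>-1/2\<^esup>\<close>.\<close>

lemma positive_map_Schwarz:
  fixes H Y :: "'a::complex_hilbert_space bop" and \<Phi> :: "'a bop \<Rightarrow> 'b::complex_hilbert_space bop"
  assumes \<Phi>: "unital_positive \<Phi>" and H: "spos H" and Y: "0 \<le> Y"
  shows "\<Phi> Y * op_powr (\<Phi> H) (- 1) * \<Phi> Y \<le> \<Phi> (Y * op_powr H (- 1) * Y)"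
proof -
  define h hi where "h = op_powr H (1/2)" and "hi = op_powr H (- (1/2))"
  define g gi where "g = op_powr (\<Phi> H) (1/2)" and "gi = op_powr (\<Phi> H) (- (1/2))"
  have \<Phi>H: "spos (\<Phi> H)" by (rule unital_positive_spos [OF \<Phi> H])
  have h: "h * h = H" "hi * hi = op_powr H (- 1)" "h * (hi * X) = X" "hi * (h * X) = X" "h * hi = 1" "hi * h = 1" for X
    using op_powr_cancel [OF H, of "1/2"] op_powr_inverse [OF H, of "1/2"]
    by (simp_all add: h_def hi_def op_powr_mult [OF H] op_powr_1 [OF H])
  have g: "g * g = \<Phi> H" "gi * gi = op_powr (\<Phi> H) (- 1)" "g * (gi * X) = X" "gi * (g * X) = X"
    "g * gi = 1" "gi * g = 1" for X
    using op_powr_cancel [OF \<Phi>H, of "1/2"] op_powr_inverse [OF \<Phi>H, of "1/2"]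
    by (simp_all add: g_def gi_def op_powr_mult [OF \<Phi>H] op_powr_1 [OF \<Phi>H])
  have sa: "selfadj h" "selfadj hi" "selfadj g" "selfadj gi"
    by (simp_all add: h_def hi_def g_def gi_def op_powr_selfadj H \<Phi>H)
  define \<Psi> where "\<Psi> X = gi * \<Phi> (h * X * h) * gi" for X
  have \<Psi>: "unital_positive \<Psi>"
    unfolding unital_positive_def
  proof (intro conjI allI impI)
    show "linear \<Psi>"
      by (rule linearI) (simp_all add: \<Psi>_def unital_positiveD [OF \<Phi>] algebra_simps)
    show "0 \<le> \<Psi> X" if "0 \<le> X" for X
      unfolding \<Psi>_def using that sa by (intro congruence_nonneg unital_positiveD(2) [OF \<Phi>])
    show "\<Psi> 1 = 1"
      using g by (simp add: \<Psi>_def h(1) g(1) [symmetric] mult.assoc)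
  qed
  define Z where "Z = hi * Y * hi"
  have "0 \<le> Z" unfolding Z_def by (intro congruence_nonneg sa Y)
  from Kadison [OF \<Psi> this] have "\<Psi> Z * \<Psi> Z \<le> \<Psi> (Z * Z)" .
  moreover have "\<Psi> Z = gi * \<Phi> Y * gi"
    by (simp add: \<Psi>_def Z_def mult.assoc h)
  moreover have "h * (Z * Z) * h = Y * (hi * hi) * Y"
    by (simp add: Z_def mult.assoc h(3-6))
  ultimately have "gi * \<Phi> Y * gi * (gi * \<Phi> Y * gi) \<le> gi * \<Phi> (Y * op_powr H (- 1) * Y) * gi"
    by (simp add: \<Psi>_def h(2))
  from congruence_mono [OF sa(3) this] show ?thesis
    by (simp add: mult.assoc g(3-6) g(2) [symmetric])
qed

text \<open>Choi's inequality is the Schwarz inequality at \<open>Y = 1\<close>.\<close>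

lemma Choi_inverse:
  fixes H :: "'a::complex_hilbert_space bop" and \<Phi> :: "'a bop \<Rightarrow> 'b::complex_hilbert_space bop"
  assumes \<Phi>: "unital_positive \<Phi>" and H: "spos H"
  shows "op_powr (\<Phi> H) (- 1) \<le> \<Phi> (op_powr H (- 1))"
  using positive_map_Schwarz [OF \<Phi> H one_nonneg_bop] by (simp add: unital_positiveD [OF \<Phi>])

section \<open>Weighted geometric means\<close>

text \<open>Every operator built from \<open>A\<close> and \<open>B\<close> below has the form \<open>A\<^bsup>1/2\<^esup> f(C) A\<^bsup>1/2\<^esup>\<close> or, for inverses,
  \<open>A\<^bsup>-1/2\<^esup> f(C) A\<^bsup>-1/2\<^esup>\<close> with the relative operator \<open>C\<close>. Congruence preserves the order, so inequalities
  between means reduce to inequalities between functions of one positive variable.\<close>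

definition relative_op :: "'a::complex_inner bop \<Rightarrow> 'a bop \<Rightarrow> 'a bop"
  where "relative_op A B = op_powr A (- (1/2)) * B * op_powr A (- (1/2))"

lemma geom_mean_relative:
  "geom_mean \<nu> A B = op_powr A (1/2) * op_powr (relative_op A B) \<nu> * op_powr A (1/2)"
  by (simp add: geom_mean_def relative_op_def)

lemma op_powr_combination:
  fixes C :: "'a::complex_hilbert_space bop"
  assumes C: "spos C"
    and le: "\<And>t. 0 < t \<Longrightarrow> t powr u \<le> x * t powr s1 + y * t powr s2 + z * t powr s3"
  shows "op_powr C u \<le> x *\<^sub>R op_powr C s1 + y *\<^sub>R op_powr C s2 + z *\<^sub>R op_powr C s3"
proof -
  obtain a b where ab: "0 < a" "a \<le> b" "op_between a b C" using spos_between [OF C] .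
  have cont: "continuous_on {a..b} (\<lambda>t. t powr s)" for s
    by (rule continuous_on_powr_pos [OF ab(1)])
  have "fun_calc (\<lambda>t. t powr u) C \<le> fun_calc (\<lambda>t. x * t powr s1 + y * t powr s2 + z * t powr s3) C"
    using ab(1) by (intro fun_calc_mono [OF ab(3)] cont le continuous_on_add continuous_on_mult_left) auto
  then show ?thesis
    by (simp add: op_powr_fun_calc fun_calc_add [OF ab(3)] fun_calc_scale [OF ab(3)]
        cont continuous_on_add continuous_on_mult_left)
qed

context
  fixes A B :: "'a::complex_hilbert_space bop"
  assumes A: "spos A" and B: "spos B"
begin

lemma relative_op_spos: "spos (relative_op A B)"
  unfolding relative_op_def by (rule spos_congruence_powr [OF A B])

lemma relative_op_undo:
  "op_powr A (1/2) * relative_op A B * op_powr A (1/2) = B"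
  using op_powr_cancel [OF A, of "1/2"] op_powr_inverse [OF A, of "1/2"]
  by (simp add: relative_op_def mult.assoc)

lemma geom_mean_spos: "spos (geom_mean \<nu> A B)"
  unfolding geom_mean_relative
  by (rule spos_congruence_powr [OF A op_powr_spos [OF relative_op_spos]])

lemma inverse_geom_mean:
  "op_powr (geom_mean \<nu> A B) (- 1)
    = op_powr A (- (1/2)) * op_powr (relative_op A B) (- \<nu>) * op_powr A (- (1/2))"
  using op_powr_cancel [OF A, of "1/2"] op_powr_inverse [OF A, of "1/2"]
    op_powr_cancel [OF relative_op_spos, of \<nu>]
  by (intro op_powr_minus_1_unique geom_mean_spos) (simp add: geom_mean_relative mult.assoc)

lemma inverse_first: "op_powr A (- 1)
    = op_powr A (- (1/2)) * op_powr (relative_op A B) 0 * op_powr A (- (1/2))"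
  by (simp add: op_powr_0 [OF relative_op_spos] op_powr_mult [OF A])

lemma inverse_second: "op_powr B (- 1)
    = op_powr A (- (1/2)) * op_powr (relative_op A B) (- 1) * op_powr A (- (1/2))"
proof -
  have "geom_mean 1 A B = B"
    by (simp add: geom_mean_relative op_powr_1 [OF relative_op_spos] relative_op_undo)
  then show ?thesis using inverse_geom_mean [of 1] by simp
qed

lemma geom_mean_combination:
  assumes "\<And>t. 0 < t \<Longrightarrow> t powr \<nu> \<le> x + y * t"
  shows "geom_mean \<nu> A B \<le> x *\<^sub>R A + y *\<^sub>R B"
proof -
  let ?C = "relative_op A B" and ?a = "op_powr A (1/2)"
  have "op_powr ?C \<nu> \<le> x *\<^sub>R op_powr ?C 0 + y *\<^sub>R op_powr ?C 1 + 0 *\<^sub>R op_powr ?C 0"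
    using assms by (intro op_powr_combination relative_op_spos) simp
  then have "geom_mean \<nu> A B \<le> ?a * (x *\<^sub>R 1 + y *\<^sub>R ?C) * ?a"
    unfolding geom_mean_relative
    by (intro congruence_mono op_powr_selfadj A) (simp add: op_powr_0 op_powr_1 relative_op_spos)
  also have "\<dots> = x *\<^sub>R (?a * ?a) + y *\<^sub>R (?a * ?C * ?a)"
    by (simp add: algebra_simps)
  also have "\<dots> = x *\<^sub>R A + y *\<^sub>R B"
    by (simp add: relative_op_undo op_powr_mult [OF A] op_powr_1 [OF A])
  finally show ?thesis .
qed

lemma inverse_geom_mean_combination:
  assumes "\<And>t. 0 < t \<Longrightarrow> t powr (- \<nu>) \<le> x * t powr 0 + y * t powr (- 1) + z * t powr (- \<mu>)"
  shows "op_powr (geom_mean \<nu> A B) (- 1)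
    \<le> x *\<^sub>R op_powr A (- 1) + y *\<^sub>R op_powr B (- 1) + z *\<^sub>R op_powr (geom_mean \<mu> A B) (- 1)"
proof -
  let ?C = "relative_op A B" and ?a = "op_powr A (- (1/2))"
  have "op_powr (geom_mean \<nu> A B) (- 1)
      \<le> ?a * (x *\<^sub>R op_powr ?C 0 + y *\<^sub>R op_powr ?C (- 1) + z *\<^sub>R op_powr ?C (- \<mu>)) * ?a"
    unfolding inverse_geom_mean
    by (intro congruence_mono op_powr_selfadj A op_powr_combination relative_op_spos assms)
  also have "\<dots> = x *\<^sub>R (?a * op_powr ?C 0 * ?a) + y *\<^sub>R (?a * op_powr ?C (- 1) * ?a)
      + z *\<^sub>R (?a * op_powr ?C (- \<mu>) * ?a)"
    by (simp add: algebra_simps)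
  finally show ?thesis
    by (simp only: inverse_first inverse_second inverse_geom_mean)
qed

end

lemma tangent_powr:
  fixes t l \<nu> :: real
  assumes "0 < t" "0 < l" "0 \<le> \<nu>" "\<nu> \<le> 1"
  shows "t powr \<nu> \<le> (1 - \<nu>) * l powr \<nu> + \<nu> * l powr (\<nu> - 1) * t"
proof -
  have "t powr \<nu> * l powr (1 - \<nu>) \<le> \<nu> * t + (1 - \<nu>) * l"
    using assms by (intro Youngs_inequality_0) auto
  then have "t powr \<nu> * l powr (1 - \<nu>) * l powr (\<nu> - 1) \<le> (\<nu> * t + (1 - \<nu>) * l) * l powr (\<nu> - 1)"
    by (rule mult_right_mono) simp
  moreover have "l powr (1 - \<nu>) * l powr (\<nu> - 1) = 1"
    using assms by (simp flip: powr_add)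
  moreover have "l * l powr (\<nu> - 1) = l powr \<nu>"
    using assms by (simp add: powr_diff)
  ultimately show ?thesis
    by (simp add: algebra_simps)
qed

text \<open>With \<open>x = 1/t\<close> this is \<open>x\<^sup>\<nu> + r (1 - \<surd>x)\<^sup>2 \<le> 1 - \<nu> + \<nu>x\<close>, the refinement of Young's inequality by a
  square. It is Young's inequality between \<open>1\<close> and \<open>\<surd>x\<close> if \<open>\<nu> \<le> 1/2\<close>, and between \<open>\<surd>x\<close> and \<open>x\<close> otherwise.\<close>

lemma refined_Young_powr:
  fixes t \<nu> :: real
  assumes t: "0 < t" and \<nu>: "0 \<le> \<nu>" "\<nu> \<le> 1" and r: "r = min \<nu> (1 - \<nu>)"
  shows "t powr (- \<nu>) \<le> (1 - \<nu> - r) * t powr 0 + (\<nu> - r) * t powr (- 1) + 2 * r * t powr (- (1/2))"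
proof (cases "\<nu> \<le> 1/2")
  case True
  then have "r = \<nu>" using r by simp
  have "1 powr (1 - 2 * \<nu>) * (t powr (- (1/2))) powr (2 * \<nu>) \<le> (1 - 2 * \<nu>) * 1 + 2 * \<nu> * t powr (- (1/2))"
    using True t \<nu> by (intro Youngs_inequality_0) auto
  then show ?thesis using \<open>r = \<nu>\<close> t by (simp add: powr_powr)
next
  case False
  then have "r = 1 - \<nu>" using r by simp
  have "(t powr (- 1)) powr (2 * \<nu> - 1) * (t powr (- (1/2))) powr (2 * (1 - \<nu>))
      \<le> (2 * \<nu> - 1) * t powr (- 1) + 2 * (1 - \<nu>) * t powr (- (1/2))"
    using False t \<nu> by (intro Youngs_inequality_0) auto
  moreover have "(t powr (- 1)) powr (2 * \<nu> - 1) * (t powr (- (1/2))) powr (2 * (1 - \<nu>)) = t powr (- \<nu>)"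
    unfolding powr_powr powr_add [symmetric] by (rule arg_cong) (simp add: algebra_simps)
  moreover have "1 - \<nu> - r = 0" "\<nu> - r = 2 * \<nu> - 1" "2 * r = 2 * (1 - \<nu>)"
    using \<open>r = 1 - \<nu>\<close> by simp_all
  ultimately show ?thesis
    by (simp only: mult_zero_left add_0_left)
qed

text \<open>Tangent lines of \<open>t\<^sup>\<nu>\<close> bound the mean and its inverse by weighted arithmetic means of \<open>A\<close>, \<open>B\<close> and of
  their inverses, and there the scalar bounds can be inserted.\<close>

lemma geom_mean_between:
  fixes A B :: "'a::complex_hilbert_space bop"
  assumes a: "0 < a1" "a1 \<le> a2" "op_between a1 a2 A" and b: "0 < b1" "b1 \<le> b2" "op_between b1 b2 B"
    and \<nu>: "0 \<le> \<nu>" "\<nu> \<le> 1"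
  shows "op_between (a1 powr (1 - \<nu>) * b1 powr \<nu>) (a2 powr (1 - \<nu>) * b2 powr \<nu>) (geom_mean \<nu> A B)"
proof -
  have A: "spos A" and B: "spos B" using a b op_between_spos by blast+
  let ?G = "geom_mean \<nu> A B"
  \<comment> \<open>The tangent at the ratio of the two bounds makes both summands combine to the mean of the bounds.\<close>
  have weight: "(1 - \<nu>) * (y / x) powr \<nu> * x + \<nu> * (y / x) powr (\<nu> - 1) * y = x powr (1 - \<nu>) * y powr \<nu>"
    if "0 < x" "0 < y" for x y :: real
  proof -
    have "(y / x) powr (\<nu> - 1) * y = (y / x) powr \<nu> * x"
      using that by (simp add: powr_diff)
    moreover have "(y / x) powr \<nu> * x = x powr (1 - \<nu>) * y powr \<nu>"
      using that by (simp add: powr_divide powr_diff)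
    ultimately show ?thesis by (simp add: algebra_simps)
  qed
  have "?G \<le> ((1 - \<nu>) * (b2 / a2) powr \<nu>) *\<^sub>R A + (\<nu> * (b2 / a2) powr (\<nu> - 1)) *\<^sub>R B"
    using a b \<nu> by (intro geom_mean_combination A B tangent_powr) auto
  also have "\<dots> \<le> ((1 - \<nu>) * (b2 / a2) powr \<nu>) *\<^sub>R (a2 *\<^sub>R 1) + (\<nu> * (b2 / a2) powr (\<nu> - 1)) *\<^sub>R (b2 *\<^sub>R 1)"
    using a(3) b(3) \<nu> by (intro add_mono scaleR_left_mono) (auto simp: op_between_def)
  also have "\<dots> = (a2 powr (1 - \<nu>) * b2 powr \<nu>) *\<^sub>R 1"
    using weight [of a2 b2] a b by (simp flip: scaleR_add_left)
  finally have up: "?G \<le> (a2 powr (1 - \<nu>) * b2 powr \<nu>) *\<^sub>R 1" .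
  define k where "k = (1 / a1) powr (1 - \<nu>) * (1 / b1) powr \<nu>"
  have k: "0 < k" using a b by (simp add: k_def)
  let ?l = "(1 / b1) / (1 / a1)"
  have "op_powr ?G (- 1) \<le> ((1 - \<nu>) * ?l powr \<nu>) *\<^sub>R op_powr A (- 1) + (\<nu> * ?l powr (\<nu> - 1)) *\<^sub>R op_powr B (- 1)
      + 0 *\<^sub>R op_powr (geom_mean 0 A B) (- 1)"
  proof (rule inverse_geom_mean_combination [OF A B])
    fix t :: real assume t: "0 < t"
    have "(1 / t) powr \<nu> \<le> (1 - \<nu>) * ?l powr \<nu> + \<nu> * ?l powr (\<nu> - 1) * (1 / t)"
      using t a b \<nu> by (intro tangent_powr) auto
    moreover have "(1 / t) powr \<nu> = t powr (- \<nu>)" "t powr (- 1) = 1 / t" "t powr 0 = 1"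
      using t by (simp_all add: powr_divide powr_minus_divide)
    ultimately show "t powr - \<nu> \<le> (1 - \<nu>) * ?l powr \<nu> * t powr 0 + \<nu> * ?l powr (\<nu> - 1) * t powr - 1 + 0 * t powr - 0"
      by (simp only: mult_zero_left add_0_right mult_1_right)
  qed
  also have "\<dots> \<le> ((1 - \<nu>) * ?l powr \<nu>) *\<^sub>R ((1 / a1) *\<^sub>R 1) + (\<nu> * ?l powr (\<nu> - 1)) *\<^sub>R ((1 / b1) *\<^sub>R 1) + 0 *\<^sub>R op_powr (geom_mean 0 A B) (- 1)"
    using op_powr_between_neg [OF a(1,3), of "- 1"] op_powr_between_neg [OF b(1,3), of "- 1"] \<nu> a b
    by (intro add_mono scaleR_left_mono) (auto simp: op_between_def powr_minus inverse_eq_divide)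
  also have "\<dots> = k *\<^sub>R 1"
    using weight [of "1 / a1" "1 / b1"] a b by (simp add: k_def flip: scaleR_add_left)
  finally have "op_powr ?G (- 1) \<le> k *\<^sub>R 1" .
  then have "op_powr (k *\<^sub>R 1) (- 1) \<le> op_powr (op_powr ?G (- 1)) (- 1)"
    by (intro inverse_antimono op_powr_spos geom_mean_spos A B)
  also have "op_powr (op_powr ?G (- 1)) (- 1) = ?G"
    using geom_mean_spos [OF A B] by (simp add: op_powr_powr op_powr_1)
  also have "op_powr (k *\<^sub>R 1 :: 'a bop) (- 1) = (1 / k) *\<^sub>R 1"
    using k by (intro op_powr_minus_1_unique) (auto simp: spos_def)
  also have "1 / k = a1 powr (1 - \<nu>) * b1 powr \<nu>"
    using a b by (simp add: k_def powr_divide)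
  finally show ?thesis using up by (simp add: op_between_def)
qed

lemma geom_mean_Riccati:
  fixes A B :: "'a::complex_hilbert_space bop"
  assumes A: "spos A" and B: "spos B"
  shows "geom_mean (1/2) A B * op_powr A (- 1) * geom_mean (1/2) A B = B"
proof -
  let ?C = "relative_op A B" and ?a = "op_powr A (1/2)"
  have C: "spos ?C" by (rule relative_op_spos [OF A B])
  have "geom_mean (1/2) A B * op_powr A (- 1) * geom_mean (1/2) A B
      = ?a * op_powr ?C (1/2) * (?a * op_powr A (- 1) * ?a) * op_powr ?C (1/2) * ?a"
    by (simp add: geom_mean_relative mult.assoc)
  also have "?a * op_powr A (- 1) * ?a = 1"
    by (simp add: op_powr_mult [OF A] op_powr_0 [OF A])
  also have "?a * op_powr ?C (1/2) * 1 * op_powr ?C (1/2) * ?a = ?a * (op_powr ?C (1/2) * op_powr ?C (1/2)) * ?a"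
    by (simp add: mult.assoc)
  also have "\<dots> = B"
    by (simp add: op_powr_mult [OF C] op_powr_1 [OF C] relative_op_undo [OF A B])
  finally show ?thesis .
qed

text \<open>Ando's inequality for the geometric mean of exponent \<open>1/2\<close>: apply the Schwarz inequality to the
  Riccati equation of the mean and take square roots.\<close>

lemma Ando_geom_mean_half:
  fixes A B :: "'a::complex_hilbert_space bop" and \<Phi> :: "'a bop \<Rightarrow> 'b::complex_hilbert_space bop"
  assumes \<Phi>: "unital_positive \<Phi>" and A: "spos A" and B: "spos B"
  shows "\<Phi> (geom_mean (1/2) A B) \<le> geom_mean (1/2) (\<Phi> A) (\<Phi> B)"
proof -
  have a: "spos (\<Phi> A)" and b: "spos (\<Phi> B)" by (rule unital_positive_spos [OF \<Phi> A], rule unital_positive_spos [OF \<Phi> B])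
  define y where "y = \<Phi> (geom_mean (1/2) A B)"
  have y: "spos y" unfolding y_def by (rule unital_positive_spos [OF \<Phi> geom_mean_spos [OF A B]])
  let ?s = "op_powr (\<Phi> A) (1/2)" and ?i = "op_powr (\<Phi> A) (- (1/2))"
  let ?C = "relative_op (\<Phi> A) (\<Phi> B)"
  have C: "spos ?C" by (rule relative_op_spos [OF a b])
  have "y * op_powr (\<Phi> A) (- 1) * y \<le> \<Phi> B"
    using positive_map_Schwarz [OF \<Phi> A spos_nonneg [OF geom_mean_spos [OF A B]], of "1/2"]
    by (simp add: geom_mean_Riccati [OF A B] y_def)
  then have "?i * (y * op_powr (\<Phi> A) (- 1) * y) * ?i \<le> ?C"
    unfolding relative_op_def by (rule congruence_mono [OF op_powr_selfadj [OF a]])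
  also have "?C = op_powr ?C (1/2) * op_powr ?C (1/2)"
    by (simp add: op_powr_mult [OF C] op_powr_1 [OF C])
  also have "op_powr (\<Phi> A) (- 1) = ?i * ?i"
    by (simp add: op_powr_mult [OF a])
  finally have "(?i * y * ?i) * (?i * y * ?i) \<le> op_powr ?C (1/2) * op_powr ?C (1/2)"
    by (simp only: mult.assoc)
  then have "?i * y * ?i \<le> op_powr ?C (1/2)"
    by (rule square_root_mono [OF spos_congruence_powr [OF a y] op_powr_spos [OF C]])
  from congruence_mono [OF op_powr_selfadj [OF a, of "1/2"] this]
  have "?s * (?i * y * ?i) * ?s \<le> geom_mean (1/2) (\<Phi> A) (\<Phi> B)"
    by (simp add: geom_mean_relative)
  then show ?thesis
    using op_powr_cancel [OF a, of "1/2"] op_powr_inverse [OF a, of "1/2"]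
    by (simp add: mult.assoc y_def)
qed

section \<open>The Kantorovich constant\<close>

lemma kantorovich_ge_1: "0 < x \<Longrightarrow> 1 \<le> kantorovich x"
  using zero_le_power2 [of "1 - x"] by (simp add: kantorovich_def power2_eq_square field_simps)

lemma kantorovich_mono:
  assumes "1 \<le> x" "x \<le> y"
  shows "kantorovich x \<le> kantorovich y"
proof -
  have "0 \<le> (y - x) * (x * y - 1)"
    using assms mult_mono [of 1 x 1 y] by simp
  then show ?thesis
    using assms by (simp add: kantorovich_def power2_eq_square field_simps)
qed

text \<open>Before squaring this is \<open>(1 + x)(1 + y) \<le> 2(1 + xy)\<close>, that is \<open>(x - 1)(y - 1) \<ge> 0\<close>.\<close>

lemma kantorovich_mult_le:
  assumes "1 \<le> x" "1 \<le> y"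
  shows "kantorovich x * kantorovich y \<le> kantorovich (x * y)"
proof -
  have "0 \<le> (x - 1) * (y - 1)" using assms by simp
  then have "(1 + x) * (1 + y) \<le> 2 * (1 + x * y)" by (simp add: algebra_simps)
  then have "((1 + x) * (1 + y))\<^sup>2 \<le> (2 * (1 + x * y))\<^sup>2"
    using assms by (intro power_mono) auto
  then have "(1 + x)\<^sup>2 * (1 + y)\<^sup>2 \<le> 4 * (1 + x * y)\<^sup>2"
    unfolding power_mult_distrib by simp
  then show ?thesis
    using assms by (simp add: kantorovich_def divide_simps mult.commute)
qed

section \<open>The power inequality\<close>

text \<open>The analytic core. With \<open>Q = Mm G\<^bsup>-1\<^esup>\<close> and \<open>R = M + m - P\<close> the hypothesis reads \<open>Q \<le> R\<close>, so
  \<open>Q\<^sup>2 \<le> K R\<^sup>2\<close> where \<open>K\<close> is the Kantorovich constant of the spectral interval of \<open>G\<close>, and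
  \<open>P\<^sup>2 + Q\<^sup>2 \<le> K (P\<^sup>2 + R\<^sup>2) \<le> K (M\<^sup>2 + m\<^sup>2)\<close>, the last step because \<open>P\<close> has its spectrum in \<open>[m, M]\<close>.\<close>

lemma op_powr_le_if_sum_inverse_le:
  fixes P G :: "'b::complex_hilbert_space bop"
  assumes m: "0 < m" "m \<le> M" and P: "m *\<^sub>R 1 \<le> P"
    and g: "m \<le> g1" "g1 \<le> g2" "g2 \<le> M" "op_between g1 g2 G" and y: "g2 / g1 \<le> y"
    and PG: "P + (M * m) *\<^sub>R op_powr G (- 1) \<le> (M + m) *\<^sub>R 1" and p: "4 \<le> p"
  shows "op_powr P p \<le> ((kantorovich y * (M\<^sup>2 + m\<^sup>2) / (M * m)) powr p / 16) *\<^sub>R op_powr G p"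
proof -
  have pos: "0 < M" "0 < g1" "0 < g2" "0 < M * m" using m g by auto
  have G: "spos G" using op_between_spos [OF pos(2) g(4)] .
  define Q where "Q = (M * m) *\<^sub>R op_powr G (- 1)"
  define R where "R = (M + m) *\<^sub>R 1 - P"
  define K where "K = kantorovich y"
  have ratio: "1 \<le> g2 / g1" using pos g by simp
  have K: "kantorovich (g2 / g1) \<le> K" "1 \<le> K"
    using kantorovich_mono [OF ratio y] kantorovich_ge_1 [of y] ratio y by (auto simp: K_def)
  have "op_between (1 / g2) (1 / g1) (op_powr G (- 1))"
    using op_powr_between_neg [OF pos(2) g(4), of "- 1"] pos by (simp add: powr_minus inverse_eq_divide)
  then have Qg: "op_between (M * m / g2) (M * m / g1) Q"
    using pos(4) scaleR_left_mono [of "(1 / g2) *\<^sub>R 1" "op_powr G (- 1)" "M * m"]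
      scaleR_left_mono [of "op_powr G (- 1)" "(1 / g1) *\<^sub>R 1" "M * m"]
    by (simp add: op_between_def Q_def)
  have "m \<le> M * m / g2" "M * m / g1 \<le> M"
    using pos g m by (simp_all add: field_simps)
  then have QmM: "op_between m M Q"
    using Qg scaleR_one_mono order_trans unfolding op_between_def by blast
  have QR: "Q \<le> R" using PG by (simp add: Q_def R_def algebra_simps)
  have "P \<le> (M + m) *\<^sub>R 1 - Q" using PG by (simp add: Q_def algebra_simps)
  also have "\<dots> \<le> (M + m) *\<^sub>R 1 - m *\<^sub>R 1"
    using QmM by (intro diff_left_mono) (simp add: op_between_def)
  finally have PmM: "op_between m M P"
    using P by (simp add: op_between_def algebra_simps)
  have R: "selfadj R" using op_between_selfadj [OF PmM] by (simp add: R_def)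
  have "Q * Q \<le> kantorovich ((M * m / g1) / (M * m / g2)) *\<^sub>R (R * R)"
    using pos g by (intro square_mono_kantorovich Qg QR divide_left_mono) auto
  also have "(M * m / g1) / (M * m / g2) = g2 / g1"
    using pos m by simp
  also have "kantorovich (g2 / g1) *\<^sub>R (R * R) \<le> K *\<^sub>R (R * R)"
    by (intro scaleR_right_mono K square_nonneg R)
  finally have QQ: "Q * Q \<le> K *\<^sub>R (R * R)" .
  define S where "S = (M + m) *\<^sub>R P"
  have "R * R = (M + m)\<^sup>2 *\<^sub>R 1 - (S + S) + P * P"
    by (simp add: R_def S_def left_diff_distrib right_diff_distrib scaleR_diff_right power2_eq_square)
  then have "P * P + R * R = (M + m)\<^sup>2 *\<^sub>R 1 - (S + S) + (P * P + P * P)"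
    by simp
  also have "\<dots> \<le> (M + m)\<^sup>2 *\<^sub>R 1 - (S + S) + ((S - (m * M) *\<^sub>R 1) + (S - (m * M) *\<^sub>R 1))"
    using square_le_chord [OF PmM] by (intro add_left_mono add_mono) (simp_all add: S_def add.commute)
  also have "\<dots> = ((M + m)\<^sup>2 - (m * M + m * M)) *\<^sub>R 1"
    unfolding scaleR_diff_left scaleR_add_left by simp
  also have "\<dots> = (M\<^sup>2 + m\<^sup>2) *\<^sub>R 1"
    by (simp add: power2_sum)
  finally have PR: "P * P + R * R \<le> (M\<^sup>2 + m\<^sup>2) *\<^sub>R 1" .
  define L where "L = K * (M\<^sup>2 + m\<^sup>2)"
  have "M\<^sup>2 + m\<^sup>2 \<le> L" using K mult_right_mono [of 1 K "M\<^sup>2 + m\<^sup>2"] by (simp add: L_def)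
  then have L: "0 < L" "M\<^sup>2 \<le> L"
    using pos zero_le_power2 [of m] zero_less_power [of M 2] by linarith+
  have "P * P \<le> K *\<^sub>R (P * P)"
    using scaleR_right_mono [OF K(2) square_nonneg [OF op_between_selfadj [OF PmM]]] by simp
  then have "P * P + Q * Q \<le> K *\<^sub>R (P * P + R * R)"
    using QQ by (simp add: scaleR_add_right add_mono)
  also have "\<dots> \<le> L *\<^sub>R 1"
    using scaleR_left_mono [OF PR, of K] K by (simp add: L_def)
  finally have "op_powr P p \<le> (L powr p / 16) *\<^sub>R op_powr Q (- p)"
    using L p by (intro op_powr_le_of_sum_squares [OF m(1) PmM QmM])
  also have "op_powr Q (- p) = ((M * m) powr (- p)) *\<^sub>R op_powr G p"
    by (simp add: Q_def op_powr_scale [OF op_powr_spos [OF G] pos(4)] op_powr_powr [OF G])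
  also have "(L powr p / 16) *\<^sub>R ((M * m) powr (- p)) *\<^sub>R op_powr G p
      = ((L / (M * m)) powr p / 16) *\<^sub>R op_powr G p"
  proof -
    have "L powr p / 16 * (M * m) powr (- p) = (L / (M * m)) powr p / 16"
      unfolding powr_divide powr_minus_divide by simp
    then show ?thesis by (simp only: scaleR_scaleR)
  qed
  finally show ?thesis by (simp only: L_def K_def)
qed

section \<open>Means of operators and of their images\<close>

lemma geom_mean_of_inverses:
  fixes A B :: "'a::complex_hilbert_space bop"
  assumes A: "spos A" and B: "spos B"
  shows "geom_mean \<nu> (op_powr A (- 1)) (op_powr B (- 1)) = op_powr (geom_mean \<nu> A B) (- 1)"
proof -
  have "relative_op (op_powr A (- 1)) (op_powr B (- 1)) = op_powr (relative_op A B) (- 1)"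
    unfolding relative_op_def [of "op_powr A (- 1)"] inverse_second [OF A B]
    using op_powr_cancel [OF A, of "1/2"] op_powr_inverse [OF A, of "1/2"]
    by (simp add: op_powr_powr [OF A] mult.assoc)
  then show ?thesis
    by (simp add: geom_mean_relative [of \<nu> "op_powr A (- 1)"] inverse_geom_mean [OF A B]
        op_powr_powr [OF A] op_powr_powr [OF relative_op_spos [OF A B]])
qed

text \<open>\<open>(t - m)(M - t) \<ge> 0\<close>, divided by \<open>t\<close>.\<close>

lemma add_scaled_inverse_le:
  fixes T :: "'a::complex_hilbert_space bop"
  assumes m: "0 < m" and T: "op_between m M T"
  shows "T + (M * m) *\<^sub>R op_powr T (- 1) \<le> (M + m) *\<^sub>R 1"
proof -
  have cont: "continuous_on {m..M} (\<lambda>t. t powr (- 1))" by (rule continuous_on_powr_pos [OF m])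
  have "fun_calc (\<lambda>t. t + (M * m) * t powr (- 1)) T \<le> fun_calc (\<lambda>t. M + m) T"
  proof (rule fun_calc_mono [OF T])
    fix t assume t: "t \<in> {m..M}"
    then have "0 \<le> (t - m) * (M - t)" by simp
    then show "t + (M * m) * t powr (- 1) \<le> M + m"
      using t m by (simp add: powr_minus field_simps)
  qed (intro continuous_on_add continuous_on_mult_left cont continuous_on_id continuous_on_const)+
  moreover have "fun_calc (\<lambda>t. t + (M * m) * t powr (- 1)) T
      = fun_calc (\<lambda>t. t) T + fun_calc (\<lambda>t. (M * m) * t powr (- 1)) T"
    by (intro fun_calc_add [OF T] continuous_on_id continuous_on_mult_left cont)
  moreover have "fun_calc (\<lambda>t. (M * m) * t powr (- 1)) T = (M * m) *\<^sub>R op_powr T (- 1)"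
    by (simp only: fun_calc_scale [OF T cont] op_powr_fun_calc)
  ultimately show ?thesis
    by (simp only: fun_calc_id [OF T] fun_calc_const [OF T])
qed

lemma weighted_powr_le_mult:
  fixes x z \<nu> :: real
  assumes "1 \<le> x" "1 \<le> z" "0 \<le> \<nu>" "\<nu> \<le> 1"
  shows "x powr (1 - \<nu>) * z powr \<nu> \<le> x * z"
proof -
  have "x powr (1 - \<nu>) \<le> x powr 1" "z powr \<nu> \<le> z powr 1"
    using assms powr_mono [of "1 - \<nu>" 1 x] powr_mono [of \<nu> 1 z] by auto
  then show ?thesis using assms by (intro mult_mono) auto
qed

lemma weighted_powr_bounds:
  fixes a b c \<nu> :: real
  assumes "0 < a" "0 < b" "0 < c" "0 \<le> \<nu>" "\<nu> \<le> 1"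
  shows "c \<le> a \<Longrightarrow> c \<le> b \<Longrightarrow> c \<le> a powr (1 - \<nu>) * b powr \<nu>"
    and "a \<le> c \<Longrightarrow> b \<le> c \<Longrightarrow> a powr (1 - \<nu>) * b powr \<nu> \<le> c"
proof -
  have c: "c powr (1 - \<nu>) * c powr \<nu> = c" using assms by (simp flip: powr_add)
  show "c \<le> a powr (1 - \<nu>) * b powr \<nu>" if "c \<le> a" "c \<le> b"
    using mult_mono [of "c powr (1 - \<nu>)" "a powr (1 - \<nu>)" "c powr \<nu>" "b powr \<nu>"]
      powr_mono2 [of "1 - \<nu>" c a] powr_mono2 [of \<nu> c b] that assms c by auto
  show "a powr (1 - \<nu>) * b powr \<nu> \<le> c" if "a \<le> c" "b \<le> c"
    using mult_mono [of "a powr (1 - \<nu>)" "c powr (1 - \<nu>)" "b powr \<nu>" "c powr \<nu>"]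
      powr_mono2 [of "1 - \<nu>" a c] powr_mono2 [of \<nu> b c] that assms c by auto
qed

text \<open>The two orders of \<open>A\<close> and \<open>B\<close> in the theorem are instances of this form, in which each operator has
  an interval of its own inside \<open>[m, M]\<close>; all means \<open>A \<sharp>\<^sub>\<nu> B\<close> then lie in an interval whose ratio is at most the
  product of the two ratios. The operator \<open>W\<close> in the proof is chosen so that \<open>X + Mm W\<close> is the weighted
  mean of \<open>A + Mm A\<^bsup>-1\<^esup>\<close> and \<open>B + Mm B\<^bsup>-1\<^esup>\<close>, both of which are at most \<open>M + m\<close>; by the refined Young
  inequality \<open>W\<close> dominates \<open>(A \<sharp>\<^sub>\<nu> B)\<^bsup>-1\<^esup>\<close>. Both claims need only that \<open>\<Phi>(W)\<close> dominates the inverse of the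
  operator on the right. For \<open>\<Phi>(A) \<sharp>\<^sub>\<nu> \<Phi>(B)\<close> the same Young inequality is applied on the side of the images,
  so that Ando's inequality enters with exponent \<open>1/2\<close> alone.\<close>

lemma op_powr_means_le:
  fixes A B :: "'a::complex_hilbert_space bop" and \<Phi> :: "'a bop \<Rightarrow> 'b::complex_hilbert_space bop"
  assumes \<Phi>: "unital_positive \<Phi>" and m: "0 < m" "m \<le> M"
    and A: "op_between a1 a2 A" and a: "m \<le> a1" "a1 \<le> a2" "a2 \<le> M"
    and B: "op_between b1 b2 B" and b: "m \<le> b1" "b1 \<le> b2" "b2 \<le> M"
    and \<nu>: "0 \<le> \<nu>" "\<nu> \<le> 1" and r: "r = min \<nu> (1 - \<nu>)" and p: "4 \<le> p"
  defines "X \<equiv> arith_mean \<nu> A B + (2 * r * M * m) *\<^sub>R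
      (arith_mean (1/2) (op_inverse A) (op_inverse B) - geom_mean (1/2) (op_inverse A) (op_inverse B))"
    and "c \<equiv> (kantorovich ((a2 / a1) * (b2 / b1)) * (M\<^sup>2 + m\<^sup>2) / (M * m)) powr p / 16"
  shows "op_powr (\<Phi> X) p \<le> c *\<^sub>R op_powr (\<Phi> (geom_mean \<nu> A B)) p"
    and "op_powr (\<Phi> X) p \<le> c *\<^sub>R op_powr (geom_mean \<nu> (\<Phi> A) (\<Phi> B)) p"
proof -
  have pos: "0 < a1" "0 < b1" "0 < a2" "0 < b2" "0 < M" using m a b by auto
  have sA: "spos A" and sB: "spos B" using op_between_spos pos A B by blast+
  have sa: "spos (\<Phi> A)" and sb: "spos (\<Phi> B)"
    by (rule unital_positive_spos [OF \<Phi> sA], rule unital_positive_spos [OF \<Phi> sB])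
  have AmM: "op_between m M A" and BmM: "op_between m M B"
    using A B a b scaleR_one_mono order_trans unfolding op_between_def by blast+
  have r0: "0 \<le> r" "r \<le> \<nu>" "r \<le> 1 - \<nu>" using r \<nu> by auto
  let ?A = "op_powr A (- 1)" and ?B = "op_powr B (- 1)"
  let ?G = "geom_mean \<nu> A B" and ?H = "op_powr (geom_mean (1/2) A B) (- 1)"
  define W where "W = (1 - \<nu> - r) *\<^sub>R ?A + (\<nu> - r) *\<^sub>R ?B + (2 * r) *\<^sub>R ?H"
  have X: "X = arith_mean \<nu> A B + (2 * r * M * m) *\<^sub>R (arith_mean (1/2) ?A ?B - ?H)"
    by (simp add: X_def op_inverse_eq_powr sA sB geom_mean_of_inverses)
  have XW: "X + (M * m) *\<^sub>R W \<le> (M + m) *\<^sub>R 1"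
  proof -
    have "X + (M * m) *\<^sub>R W = (1 - \<nu>) *\<^sub>R (A + (M * m) *\<^sub>R ?A) + \<nu> *\<^sub>R (B + (M * m) *\<^sub>R ?B)"
    proof -
      have "(2 * r * M * m) *\<^sub>R (arith_mean (1/2) ?A ?B - ?H)
          = (M * m * r) *\<^sub>R ?A + (M * m * r) *\<^sub>R ?B - (M * m * (2 * r)) *\<^sub>R ?H"
        by (simp add: arith_mean_def scaleR_diff_right scaleR_add_right mult.commute mult.left_commute)
      moreover have "(M * m) *\<^sub>R W = (M * m * (1 - \<nu>)) *\<^sub>R ?A - (M * m * r) *\<^sub>R ?A + ((M * m * \<nu>) *\<^sub>R ?B - (M * m * r) *\<^sub>R ?B)
          + (M * m * (2 * r)) *\<^sub>R ?H"
        by (simp add: W_def scaleR_add_right right_diff_distrib flip: scaleR_diff_left)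
      ultimately show ?thesis
        by (simp add: X arith_mean_def scaleR_add_right mult.commute mult.left_commute)
    qed
    also have "\<dots> \<le> (1 - \<nu>) *\<^sub>R ((M + m) *\<^sub>R 1) + \<nu> *\<^sub>R ((M + m) *\<^sub>R 1)"
      using \<nu> by (intro add_mono scaleR_left_mono add_scaled_inverse_le m AmM BmM) auto
    also have "\<dots> = (M + m) *\<^sub>R 1"
      by (simp flip: scaleR_add_left distrib_right)
    finally show ?thesis .
  qed
  have mX: "m *\<^sub>R 1 \<le> X"
  proof -
    have "?H \<le> (1/2) *\<^sub>R ?A + (1/2) *\<^sub>R ?B + 0 *\<^sub>R ?H"
    proof (rule inverse_geom_mean_combination [OF sA sB])
      fix t :: real assume t: "0 < t"
      have "1 powr (1/2) * (t powr (- 1)) powr (1/2) \<le> 1/2 * 1 + 1/2 * t powr (- 1)"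
        using t by (intro Youngs_inequality_0) auto
      moreover have "(t powr (- 1)) powr (1/2) = t powr (- (1/2))"
        unfolding powr_powr by simp
      moreover have "t powr 0 = 1" using t by simp
      ultimately show "t powr - (1/2) \<le> 1/2 * t powr 0 + 1/2 * t powr - 1 + 0 * t powr - (1/2)"
        by (simp only: powr_one_eq_one mult_1_left mult_1_right mult_zero_left add_0_right)
    qed
    then have "0 \<le> (2 * r * M * m) *\<^sub>R (arith_mean (1/2) ?A ?B - ?H)"
      using r0 m pos by (intro scaleR_nonneg_nonneg) (auto simp: arith_mean_def)
    then have "arith_mean \<nu> A B \<le> X" by (simp add: X)
    moreover have "(1 - \<nu>) *\<^sub>R (m *\<^sub>R 1) + \<nu> *\<^sub>R (m *\<^sub>R 1) \<le> arith_mean \<nu> A B"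
      unfolding arith_mean_def using AmM BmM \<nu>
      by (intro add_mono scaleR_left_mono) (auto simp: op_between_def)
    moreover have "(1 - \<nu>) *\<^sub>R (m *\<^sub>R 1) + \<nu> *\<^sub>R (m *\<^sub>R 1) = m *\<^sub>R (1 :: 'a bop)"
      by (simp flip: scaleR_add_left distrib_right)
    ultimately show ?thesis by simp
  qed
  have \<Phi>XW: "\<Phi> X + (M * m) *\<^sub>R \<Phi> W \<le> (M + m) *\<^sub>R 1"
    using unital_positive_mono [OF \<Phi> XW] by (simp add: unital_positiveD [OF \<Phi>])
  have m\<Phi>X: "m *\<^sub>R 1 \<le> \<Phi> X"
    using unital_positive_mono [OF \<Phi> mX] by (simp add: unital_positiveD [OF \<Phi>])
  define g1 g2 where "g1 = a1 powr (1 - \<nu>) * b1 powr \<nu>" and "g2 = a2 powr (1 - \<nu>) * b2 powr \<nu>"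
  have G: "op_between g1 g2 ?G"
    unfolding g1_def g2_def using a b pos A B \<nu> by (intro geom_mean_between)
  have G': "op_between g1 g2 (geom_mean \<nu> (\<Phi> A) (\<Phi> B))"
    unfolding g1_def g2_def using a b pos \<nu>
    by (intro geom_mean_between unital_positive_between [OF \<Phi> A] unital_positive_between [OF \<Phi> B])
  have g: "m \<le> g1" "g1 \<le> g2" "g2 \<le> M"
    unfolding g1_def g2_def using a b pos \<nu> m
    by (auto intro!: weighted_powr_bounds mult_mono powr_mono2)
  have ratio: "g2 / g1 \<le> (a2 / a1) * (b2 / b1)"
  proof -
    have "g2 / g1 = (a2 / a1) powr (1 - \<nu>) * (b2 / b1) powr \<nu>"
      using pos by (simp add: g1_def g2_def powr_divide)
    also have "\<dots> \<le> (a2 / a1) * (b2 / b1)"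
      using a b pos \<nu> by (intro weighted_powr_le_mult) auto
    finally show ?thesis .
  qed
  have final: "op_powr (\<Phi> X) p \<le> c *\<^sub>R op_powr Y p"
    if Y: "op_between g1 g2 Y" and YW: "op_powr Y (- 1) \<le> \<Phi> W" for Y
  proof -
    have "(M * m) *\<^sub>R op_powr Y (- 1) \<le> (M * m) *\<^sub>R \<Phi> W"
      using pos m by (intro scaleR_left_mono YW) auto
    then have "\<Phi> X + (M * m) *\<^sub>R op_powr Y (- 1) \<le> (M + m) *\<^sub>R 1"
      using \<Phi>XW by (meson add_left_mono order_trans)
    then show ?thesis
      unfolding c_def using p by (intro op_powr_le_if_sum_inverse_le [OF m m\<Phi>X g Y ratio])
  qed
  note Young = refined_Young_powr [OF _ \<nu> r]
  have "op_powr ?G (- 1) \<le> W"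
    unfolding W_def by (rule inverse_geom_mean_combination [OF sA sB Young])
  then have "\<Phi> (op_powr ?G (- 1)) \<le> \<Phi> W"
    by (rule unital_positive_mono [OF \<Phi>])
  then have "op_powr (\<Phi> ?G) (- 1) \<le> \<Phi> W"
    using Choi_inverse [OF \<Phi> geom_mean_spos [OF sA sB]] by (rule order_trans [rotated])
  then show "op_powr (\<Phi> X) p \<le> c *\<^sub>R op_powr (\<Phi> ?G) p"
    by (rule final [OF unital_positive_between [OF \<Phi> G]])
  have "op_powr (geom_mean \<nu> (\<Phi> A) (\<Phi> B)) (- 1)
      \<le> (1 - \<nu> - r) *\<^sub>R op_powr (\<Phi> A) (- 1) + (\<nu> - r) *\<^sub>R op_powr (\<Phi> B) (- 1)
        + (2 * r) *\<^sub>R op_powr (geom_mean (1/2) (\<Phi> A) (\<Phi> B)) (- 1)"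
    by (rule inverse_geom_mean_combination [OF sa sb Young])
  also have "\<dots> \<le> (1 - \<nu> - r) *\<^sub>R \<Phi> ?A + (\<nu> - r) *\<^sub>R \<Phi> ?B + (2 * r) *\<^sub>R \<Phi> ?H"
  proof (intro add_mono scaleR_left_mono Choi_inverse [OF \<Phi>] sA sB)
    have "op_powr (geom_mean (1/2) (\<Phi> A) (\<Phi> B)) (- 1) \<le> op_powr (\<Phi> (geom_mean (1/2) A B)) (- 1)"
      by (rule inverse_antimono [OF unital_positive_spos [OF \<Phi> geom_mean_spos [OF sA sB]] Ando_geom_mean_half [OF \<Phi> sA sB]])
    also have "\<dots> \<le> \<Phi> ?H"
      by (rule Choi_inverse [OF \<Phi> geom_mean_spos [OF sA sB]])
    finally show "op_powr (geom_mean (1/2) (\<Phi> A) (\<Phi> B)) (- 1) \<le> \<Phi> ?H" .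
  qed (use r0 in auto)
  also have "\<dots> = \<Phi> W"
    by (simp add: W_def unital_positiveD [OF \<Phi>])
  finally show "op_powr (\<Phi> X) p \<le> c *\<^sub>R op_powr (geom_mean \<nu> (\<Phi> A) (\<Phi> B)) p"
    by (rule final [OF G'])
qed

text \<open>\<open>h / h'\<close> is the product of the ratios of the intervals \<open>[m, m']\<close> and \<open>[M', M]\<close>. The factor
  \<open>K(h')\<^sup>r\<close> is absorbed by \<open>K(h')\<^sup>r K(h / h') \<le> K(h') K(h / h') \<le> K(h)\<close>.\<close>

lemma Kantorovich_constant_le:
  fixes m M h h' r p :: real
  assumes "0 < m" "0 < M" "1 \<le> h'" "1 \<le> h / h'" "0 \<le> r" "r \<le> 1" "0 < p"
  shows "(kantorovich (h / h') * (M\<^sup>2 + m\<^sup>2) / (M * m)) powr p / 16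
    \<le> (kantorovich h * (M\<^sup>2 + m\<^sup>2) / (4 powr (2 / p) * M * m * kantorovich h' powr r)) powr p"
proof -
  let ?k = "kantorovich h' powr r"
  have k1: "1 \<le> kantorovich h'" "1 \<le> kantorovich (h / h')"
    using assms by (auto intro: kantorovich_ge_1)
  have k: "0 < ?k" "?k \<le> kantorovich h'"
    using k1 assms powr_mono [of r 1 "kantorovich h'"] by auto
  have "kantorovich (h / h') * ?k \<le> kantorovich (h / h') * kantorovich h'"
    using k k1 by (intro mult_left_mono) auto
  also have "\<dots> \<le> kantorovich h"
    using kantorovich_mult_le [OF assms(4,3)] assms(3) by simp
  finally have "kantorovich (h / h') \<le> kantorovich h / ?k"
    using k by (simp add: field_simps)
  then have "kantorovich (h / h') * ((M\<^sup>2 + m\<^sup>2) / (M * m)) \<le> kantorovich h / ?k * ((M\<^sup>2 + m\<^sup>2) / (M * m))"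
    using assms by (intro mult_right_mono) auto
  then have "(kantorovich (h / h') * ((M\<^sup>2 + m\<^sup>2) / (M * m)) / 4 powr (2 / p)) powr p
      \<le> (kantorovich h / ?k * ((M\<^sup>2 + m\<^sup>2) / (M * m)) / 4 powr (2 / p)) powr p"
    using assms k1 by (intro powr_mono2 divide_right_mono) auto
  moreover have "(4 powr (2 / p)) powr p = (16 :: real)"
    using assms by (simp add: powr_powr)
  moreover have "(kantorovich (h / h') * ((M\<^sup>2 + m\<^sup>2) / (M * m)) / 4 powr (2 / p)) powr p
      = (kantorovich (h / h') * ((M\<^sup>2 + m\<^sup>2) / (M * m))) powr p / (4 powr (2 / p)) powr p"
    by (rule powr_divide)
  ultimately show ?thesis
    by (simp add: field_simps)
qed

lemma bop_zero_space:
  fixes T :: "'a::complex_hilbert_space bop"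
  assumes "(1 :: 'a bop) = 0"
  shows "S = (T :: 'a bop)"
  using assms by (metis mult_1_left mult_zero_left)

theorem theorem2p9:
  fixes A B :: "'a::complex_hilbert_space bop"
    and \<Phi> :: "'a bop \<Rightarrow> 'b::complex_hilbert_space bop"
    and m m' M M' \<nu> p r h h' :: real
  assumes "positive_op A" and "positive_op B"
    and "0 < m" and "0 < m'" and "0 < M" and "0 < M'"
    and "(m *\<^sub>R 1 \<le> B \<and> B \<le> m' *\<^sub>R 1 \<and> m' < M' \<and> M' *\<^sub>R 1 \<le> A \<and> A \<le> M *\<^sub>R 1) \<or>
         (m *\<^sub>R 1 \<le> A \<and> A \<le> m' *\<^sub>R 1 \<and> m' < M' \<and> M' *\<^sub>R 1 \<le> B \<and> B \<le> M *\<^sub>R 1)"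
    and "Vector_Spaces.linear scaleC scaleC \<Phi>" and "positive_map \<Phi>" and "\<Phi> 1 = 1"
    and "0 \<le> \<nu>" and "\<nu> \<le> 1" and "4 \<le> p"
    and "r = min \<nu> (1 - \<nu>)" and "h = M / m" and "h' = M' / m'"
  shows "op_powr (\<Phi> (arith_mean \<nu> A B + (2 * r * M * m) *\<^sub>R
             (arith_mean (1/2) (op_inverse A) (op_inverse B)
               - geom_mean (1/2) (op_inverse A) (op_inverse B)))) p
           \<le> ((kantorovich h * (M\<^sup>2 + m\<^sup>2) /
                (4 powr (2 / p) * M * m * kantorovich h' powr r)) powr p) *\<^sub>R
             op_powr (\<Phi> (geom_mean \<nu> A B)) p
       \<and> op_powr (\<Phi> (arith_mean \<nu> A B + (2 * r * M * m) *\<^sub>R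
             (arith_mean (1/2) (op_inverse A) (op_inverse B)
               - geom_mean (1/2) (op_inverse A) (op_inverse B)))) p
           \<le> ((kantorovich h * (M\<^sup>2 + m\<^sup>2) /
                (4 powr (2 / p) * M * m * kantorovich h' powr r)) powr p) *\<^sub>R
             op_powr (geom_mean \<nu> (\<Phi> A) (\<Phi> B)) p"
proof (cases "(1 :: 'b bop) = 0")
  \<comment> \<open>The scalar bounds on \<open>A\<close> and \<open>B\<close> order \<open>m\<close>, \<open>m'\<close>, \<open>M'\<close>, \<open>M\<close> only on a nonzero space, and the space is
    nonzero if its image under the unital map \<open>\<Phi>\<close> is.\<close>
  case True
  have "(S :: 'b bop) \<le> T" for S T
    using bop_zero_space [OF True, of S T] by simp
  then show ?thesis by blast
next
  case False
  have add: "\<Phi> (S + T) = \<Phi> S + \<Phi> T" and scC: "\<Phi> (z *\<^sub>C T) = z *\<^sub>C \<Phi> T" for S T z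
    using assms(8) by (simp_all add: Vector_Spaces.linear_def module_hom_def module_hom_axioms_def)
  have "linear \<Phi>"
    by (rule linearI) (simp_all add: add scC flip: scaleC_of_real)
  then have \<Phi>: "unital_positive \<Phi>"
    using assms(9,10) by (auto simp: unital_positive_def positive_map_def positive_op_nonneg)
  have "(1 :: 'a bop) \<noteq> 0"
    using False unital_positiveD(3,7) [OF \<Phi>] by metis
  note scalar = scaleR_one_le_iff [OF this]
  have r: "0 \<le> r" "r \<le> 1" using assms by auto
  have p: "0 < p" using assms by simp
  define X where "X = arith_mean \<nu> A B + (2 * r * M * m) *\<^sub>R
      (arith_mean (1/2) (op_inverse A) (op_inverse B) - geom_mean (1/2) (op_inverse A) (op_inverse B))"
  define c where "c = (kantorovich (h / h') * (M\<^sup>2 + m\<^sup>2) / (M * m)) powr p / 16"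
  define C where "C = (kantorovich h * (M\<^sup>2 + m\<^sup>2) /
      (4 powr (2 / p) * M * m * kantorovich h' powr r)) powr p"
  have chain: "m \<le> m'" "m' < M'" "M' \<le> M"
    using assms(7) order_trans [of "m *\<^sub>R 1" _ "m' *\<^sub>R (1 :: 'a bop)"]
      order_trans [of "M' *\<^sub>R 1" _ "M *\<^sub>R (1 :: 'a bop)"] scalar by blast+
  then have mM: "m \<le> M" by simp
  have main: "op_powr (\<Phi> X) p \<le> c *\<^sub>R op_powr (\<Phi> (geom_mean \<nu> A B)) p
      \<and> op_powr (\<Phi> X) p \<le> c *\<^sub>R op_powr (geom_mean \<nu> (\<Phi> A) (\<Phi> B)) p"
    using assms(7)
  proof
    assume "m *\<^sub>R 1 \<le> B \<and> B \<le> m' *\<^sub>R 1 \<and> m' < M' \<and> M' *\<^sub>R 1 \<le> A \<and> A \<le> M *\<^sub>R 1"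
    then have AB: "op_between M' M A" "op_between m m' B" by (auto simp: op_between_def)
    have h: "(M / M') * (m' / m) = h / h'" by (simp add: assms(15,16))
    show ?thesis
      using op_powr_means_le [OF \<Phi> assms(3) mM AB(1) _ _ _ AB(2) _ _ _ assms(11,12,14,13)] chain
      unfolding X_def [symmetric] c_def h by simp
  next
    assume "m *\<^sub>R 1 \<le> A \<and> A \<le> m' *\<^sub>R 1 \<and> m' < M' \<and> M' *\<^sub>R 1 \<le> B \<and> B \<le> M *\<^sub>R 1"
    then have AB: "op_between m m' A" "op_between M' M B" by (auto simp: op_between_def)
    have h: "(m' / m) * (M / M') = h / h'" by (simp add: assms(15,16))
    show ?thesis
      using op_powr_means_le [OF \<Phi> assms(3) mM AB(1) _ _ _ AB(2) _ _ _ assms(11,12,14,13)] chain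
      unfolding X_def [symmetric] c_def h by simp
  qed
  have "1 \<le> h'" "1 \<le> h / h'"
  proof -
    show "1 \<le> h'" using chain assms(4) by (simp add: assms(16))
    have "1 * 1 \<le> (M / M') * (m' / m)"
      using chain assms(3,6) by (intro mult_mono) auto
    then show "1 \<le> h / h'" by (simp add: assms(15,16) mult.commute)
  qed
  then have cC: "c \<le> C"
    unfolding c_def C_def using assms(3,5) r p by (intro Kantorovich_constant_le) auto
  have enlarge: "c *\<^sub>R op_powr Y p \<le> C *\<^sub>R op_powr Y p" if "spos Y" for Y :: "'b bop"
    by (intro scaleR_right_mono cC spos_nonneg op_powr_spos that)
  have s: "spos A" "spos B"
    using assms(3,6,7) by (auto simp: spos_def)
  have "spos (\<Phi> (geom_mean \<nu> A B))" "spos (geom_mean \<nu> (\<Phi> A) (\<Phi> B))"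
    by (rule unital_positive_spos [OF \<Phi> geom_mean_spos [OF s]],
        rule geom_mean_spos [OF unital_positive_spos [OF \<Phi> s(1)] unital_positive_spos [OF \<Phi> s(2)]])
  then show ?thesis
    unfolding X_def [symmetric] C_def [symmetric] using main enlarge by (meson order_trans)
qed

end
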